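(* Suppose $V\in L^1(\mathbb{R};dx)$ (complex-valued) and let $z\in\mathbb{C}$ with $\operatorname{Im}(z^{1/2})>0$. Let $K(z)$ be the (trace class) operator in $L^2(\mathbb{R};dx)$ and $\mathcal{F}(z)$ the Jost function defined in the context. Then $$\det(I-K(z))=\mathcal{F}(z).$$
   Context: Factor $V=uv$ with $v(x)=|V(x)|^{1/2}$, $u(x)=|V(x)|^{1/2}\exp(i\arg(V(x)))$. Let $H^{(0)}=-d^2/dx^2$ with domain the Sobolev space $H^{2,2}(\mathbb{R})$ in $L^2(\mathbb{R};dx)$, with Green's function $G^{(0)}(z,x,x')=\frac{i}{2z^{1/2}}e^{iz^{1/2}|x-x'|}$, $\operatorname{Im}(z^{1/2})>0$. $K(z)=-\overline{u(H^{(0)}-z)^{-1}v}$ (closure), i.e., the integral operator with kernel $K(z,x,x')=-u(x)G^{(0)}(z,x,x')v(x')$; it is a trace class operator in $L^2(\mathbb{R};dx)$ for $\operatorname{Im}(z^{1/2})>0$, and $\det(I-K(z))$ is its Fredholm determinant. The Jost solutions $f_\pm(z,\cdot)$ of $-\psi''+V\psi=z\psi$ on $\mathbb{R}$ are the solutions (with $e^{\mp iz^{1/2}x}f_\pm(z,x)$ bounded near $\pm\infty$) of $$f_\pm(z,x)=e^{\pm iz^{1/2}x}-\int_x^{\pm\infty}dx'\,z^{-1/2}\sin(z^{1/2}(x-x'))V(x')f_\pm(z,x'),\quad x\in\mathbb{R}.$$ The Jost function is $$\mathcal{F}(z)=\frac{W(f_-(z),f_+(z))}{2iz^{1/2}},\qquad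 W(f,g)(x)=f(x)g'(x)-f'(x)g(x)$$ (the Wronskian being constant in $x$). *)

theory Defs
  imports "HOL-Analysis.Analysis" "Jordan_Normal_Form.Determinant"
begin

section \<open>The Hilbert space \<open>L\<^sup>2(\<real>; dx)\<close>\<close>

text \<open>
  Elements of \<open>L\<^sup>2\<close> are represented by square-integrable functions, equality in \<open>L\<^sup>2\<close> being
  equality almost everywhere; operators are maps on representatives.
\<close>

definition L2 :: "(real \<Rightarrow> complex) set" where
  "L2 = {f \<in> borel_measurable lebesgue. integrable lebesgue (\<lambda>x. (norm (f x))\<^sup>2)}"

definition l2_inner :: "(real \<Rightarrow> complex) \<Rightarrow> (real \<Rightarrow> complex) \<Rightarrow> complex" where
  "l2_inner f g = (LINT x|lebesgue. cnj (f x) * g x)"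

definition l2_norm :: "(real \<Rightarrow> complex) \<Rightarrow> real" where
  "l2_norm f = sqrt (LINT x|lebesgue. (norm (f x))\<^sup>2)"

definition l2_onb :: "(nat \<Rightarrow> real \<Rightarrow> complex) \<Rightarrow> bool" where
  "l2_onb e \<longleftrightarrow>
     (\<forall>i. e i \<in> L2) \<and>
     (\<forall>i j. l2_inner (e i) (e j) = (if i = j then 1 else 0)) \<and>
     (\<forall>f\<in>L2. (\<forall>i. l2_inner (e i) f = 0) \<longrightarrow> (AE x in lebesgue. f x = 0))"

type_synonym l2_op = "(real \<Rightarrow> complex) \<Rightarrow> (real \<Rightarrow> complex)"

text \<open>Linearity and boundedness together make the map well defined on almost-everywhere classes.\<close>

definition bounded_l2_op :: "l2_op \<Rightarrow> bool" where
  "bounded_l2_op A \<longleftrightarrow>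
     (\<forall>f\<in>L2. A f \<in> L2) \<and>
     (\<forall>f\<in>L2. \<forall>g\<in>L2. \<forall>a b. AE x in lebesgue.
        A (\<lambda>y. a * f y + b * g y) x = a * A f x + b * A g x) \<and>
     (\<exists>C. \<forall>f\<in>L2. l2_norm (A f) \<le> C * l2_norm f)"

definition hilbert_schmidt :: "l2_op \<Rightarrow> bool" where
  "hilbert_schmidt A \<longleftrightarrow> bounded_l2_op A \<and>
     (\<exists>e. l2_onb e \<and> summable (\<lambda>i. (l2_norm (A (e i)))\<^sup>2))"

text \<open>The trace class, as the set of products of two Hilbert--Schmidt operators.\<close>

definition trace_class :: "l2_op \<Rightarrow> bool" where
  "trace_class T \<longleftrightarrow> bounded_l2_op T \<and>
     (\<exists>A B. hilbert_schmidt A \<and> hilbert_schmidt B \<and>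
        (\<forall>f\<in>L2. AE x in lebesgue. T f x = A (B f) x))"

section \<open>The Fredholm determinant\<close>

text \<open>
  \<open>trace_ext n A\<close> is the trace of the \<open>n\<close>-th exterior power of \<open>A\<close>. If \<open>e\<close> is an orthonormal
  basis of the Hilbert space, then the vectors \<open>e\<^bsub>i(1)\<^esub> \<and> \<dots> \<and> e\<^bsub>i(n)\<^esub>\<close> with \<open>i(1) < \<dots> < i(n)\<close> form
  an orthonormal basis of its \<open>n\<close>-th exterior power, and the diagonal matrix element of the
  exterior power of \<open>A\<close> at such a vector is the determinant of the inner products
  \<open>(e\<^bsub>i(a)\<^esub>, A e\<^bsub>i(b)\<^esub>)\<close>. For a trace class operator the trace converges absolutely and does not
  depend on the basis.
\<close>

definition trace_ext :: "nat \<Rightarrow> l2_op \<Rightarrow> complex" where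
  "trace_ext n A = (THE t. \<forall>e. l2_onb e \<longrightarrow>
     ((\<lambda>js. Determinant.det (mat n n (\<lambda>(a, b). l2_inner (e (js ! a)) (A (e (js ! b))))))
        has_sum t) {js :: nat list. length js = n \<and> sorted_wrt (<) js})"

text \<open>
  The argument is the operator \<open>D = I + A\<close>, with \<open>A\<close> of trace class, whose determinant is taken:
  \<open>det (I + A)\<close> is the sum of the traces of all exterior powers of \<open>A\<close>.
\<close>

definition fredholm_det :: "l2_op \<Rightarrow> complex" where
  "fredholm_det D = (\<Sum>n. trace_ext n (\<lambda>f x. D f x - f x))"

section \<open>The operator \<open>K(z)\<close>\<close>

text \<open>
  The branch of the square root with nonnegative imaginary part (cut along \<open>[0, \<infinity>)\<close>), as opposed
  to \<^const>\<open>csqrt\<close>, which has nonnegative real part.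
\<close>

definition zsqrt :: "complex \<Rightarrow> complex" where
  "zsqrt z = (if Im (csqrt z) \<ge> 0 then csqrt z else - csqrt z)"

definition v_factor :: "(real \<Rightarrow> complex) \<Rightarrow> real \<Rightarrow> complex" where
  "v_factor V x = of_real (sqrt (norm (V x)))"

definition u_factor :: "(real \<Rightarrow> complex) \<Rightarrow> real \<Rightarrow> complex" where
  "u_factor V x = of_real (sqrt (norm (V x))) * exp (\<i> * of_real (Arg (V x)))"

definition green0 :: "complex \<Rightarrow> real \<Rightarrow> real \<Rightarrow> complex" where
  "green0 z x x' = \<i> / (2 * zsqrt z) * exp (\<i> * zsqrt z * of_real \<bar>x - x'\<bar>)"

definition K_kernel :: "(real \<Rightarrow> complex) \<Rightarrow> complex \<Rightarrow> real \<Rightarrow> real \<Rightarrow> complex" where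
  "K_kernel V z x x' = - (u_factor V x * green0 z x x' * v_factor V x')"

definition K_op :: "(real \<Rightarrow> complex) \<Rightarrow> complex \<Rightarrow> l2_op" where
  "K_op V z f = (\<lambda>x. LINT x'|lebesgue. K_kernel V z x x' * f x')"

section \<open>Jost solutions and the Jost function\<close>

text \<open>
  Integrability is required explicitly since the integral of a non-integrable function is \<open>0\<close>.
\<close>

definition is_jost_plus :: "(real \<Rightarrow> complex) \<Rightarrow> complex \<Rightarrow> (real \<Rightarrow> complex) \<Rightarrow> bool" where
  "is_jost_plus V z f \<longleftrightarrow>
     Bfun (\<lambda>x. exp (- \<i> * zsqrt z * of_real x) * f x) at_top \<and>
     (\<forall>x. set_integrable lebesgue {x..}
            (\<lambda>x'. sin (zsqrt z * of_real (x - x')) / zsqrt z * V x' * f x') \<and>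
          f x = exp (\<i> * zsqrt z * of_real x)
            - (LINT x':{x..}|lebesgue. sin (zsqrt z * of_real (x - x')) / zsqrt z * V x' * f x'))"

text \<open>
  Here the integral from \<open>x\<close> to \<open>-\<infinity>\<close> is minus the integral over \<open>(-\<infinity>, x]\<close>, whence the plus sign.
\<close>

definition is_jost_minus :: "(real \<Rightarrow> complex) \<Rightarrow> complex \<Rightarrow> (real \<Rightarrow> complex) \<Rightarrow> bool" where
  "is_jost_minus V z f \<longleftrightarrow>
     Bfun (\<lambda>x. exp (\<i> * zsqrt z * of_real x) * f x) at_bot \<and>
     (\<forall>x. set_integrable lebesgue {..x}
            (\<lambda>x'. sin (zsqrt z * of_real (x - x')) / zsqrt z * V x' * f x') \<and>
          f x = exp (- \<i> * zsqrt z * of_real x)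
            + (LINT x':{..x}|lebesgue. sin (zsqrt z * of_real (x - x')) / zsqrt z * V x' * f x'))"

definition jost_plus :: "(real \<Rightarrow> complex) \<Rightarrow> complex \<Rightarrow> real \<Rightarrow> complex" where
  "jost_plus V z = (THE f. is_jost_plus V z f)"

definition jost_minus :: "(real \<Rightarrow> complex) \<Rightarrow> complex \<Rightarrow> real \<Rightarrow> complex" where
  "jost_minus V z = (THE f. is_jost_minus V z f)"

definition wronskian :: "(real \<Rightarrow> complex) \<Rightarrow> (real \<Rightarrow> complex) \<Rightarrow> real \<Rightarrow> complex" where
  "wronskian f g x =
     f x * vector_derivative g (at x) - vector_derivative f (at x) * g x"

text \<open>The description operator picks the constant value of the Wronskian.\<close>

definition jost_function :: "(real \<Rightarrow> complex) \<Rightarrow> complex \<Rightarrow> complex" where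
  "jost_function V z =
     (THE w. \<forall>x. wronskian (jost_minus V z) (jost_plus V z) x = w) / (2 * \<i> * zsqrt z)"

end

theory Submission
  imports Defs
begin

text \<open>
  Write \<open>k = zsqrt z\<close>. Green's function factors as the integral of \<open>exp (i k (x - y)) exp (i k (x' - y))\<close>
  over all \<open>y < min x x'\<close>, so \<open>- K = A B\<close> with Hilbert--Schmidt operators \<open>A\<close> and \<open>B\<close>. By Parseval's
  identity, the trace of the \<open>n\<close>-th exterior power of \<open>- K\<close> equals the integral of the \<open>n\<close>-point determinant of the
  kernel of \<open>B A\<close> over decreasing points \<open>y\<^sub>0 > \<dots> > y\<^bsub>n-1\<^esub>\<close>. That kernel is
  \<open>exp (- i k (y + y')) h (max y y')\<close>, where \<open>h s\<close> is the integral of \<open>V x exp (2 i k x)\<close> over \<open>x > s\<close>; hence its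
  determinants at decreasing points are products of consecutive differences of \<open>h\<close>, and integrating one
  point after the other gives the limit at \<open>- \<infinity>\<close> of the \<open>n\<close>-th term of the Volterra series of
  \<open>m x = exp (- i k x) f\<^sub>+ x\<close>. The sum of these limits is \<open>1 + i / (2 k) \<integral> V m\<close>, which is also the value of the
  constant Wronskian divided by \<open>2 i k\<close>.
\<close>

section \<open>The Hilbert space of square-integrable functions\<close>

text \<open>The factorization mirrors one of differential operators: with \<open>k = zsqrt z\<close>
  and \<open>H\<close> the free Hamiltonian, \<open>H - z = (- d/dx - i k) (d/dx - i k)\<close>, and
  the inverses of the two first-order factors are one-sided exponential kernels. It also explains
  how a trace, which is a sum over a basis, can become an integral along a diagonal: a diagonal is a
  null set, so the values of a kernel there mean nothing to the operator, but the kernel of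
  \<open>B A\<close> arises at every pair of points as an inner product of two sections, which
  Parseval's identity expands in the basis. Since \<open>trace_ext\<close> and
  \<open>hilbert_schmidt\<close> both speak of orthonormal bases, Parseval's identity has to be
  derived from mere totality, and a basis has to be exhibited. As \<open>V\<close> is only
  integrable, Jost solutions have second derivatives only almost everywhere. The Wronskian is
  therefore treated through integral identities: every function in it is an exponential times a
  constant plus a tail integral, and a product rule for such functions replaces
  differentiation.\<close>

interpretation lebesgue: sigma_finite_measure "lebesgue :: real measure"
proof
  have "sigma_finite_measure (lborel :: real measure)" by (rule sigma_finite_lborel)
  then obtain A :: "real set set" where A: "countable A" "A \<subseteq> sets lborel" "\<Union>A = space lborel"
      "\<forall>a\<in>A. emeasure lborel a \<noteq> \<infinity>"
    unfolding sigma_finite_measure_def by blast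
  show "\<exists>A::real set set. countable A \<and> A \<subseteq> sets lebesgue \<and> \<Union>A = space lebesgue \<and> (\<forall>a\<in>A. emeasure lebesgue a \<noteq> \<infinity>)"
    using A by (intro exI[of _ A]) auto
qed

interpretation lebesgue_pair: pair_sigma_finite "lebesgue :: real measure" "lebesgue :: real measure" ..

text \<open>The product of two complete measures is not complete. Joint measurability is therefore
  always reduced to Borel functions of the pair and to functions of one coordinate.\<close>

abbreviation (input) lebesgue2 :: "(real \<times> real) measure" where
  "lebesgue2 \<equiv> lebesgue \<Otimes>\<^sub>M lebesgue"

lemma borel_measurable_cnj [measurable]:
  "f \<in> borel_measurable M \<Longrightarrow> (\<lambda>x. cnj (f x)) \<in> borel_measurable M"
  by (rule borel_measurable_continuous_on[where f=cnj]) (intro continuous_intros)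

lemma L2D [measurable_dest]: "f \<in> L2 \<Longrightarrow> f \<in> borel_measurable lebesgue"
  and L2D_int: "f \<in> L2 \<Longrightarrow> integrable lebesgue (\<lambda>x. (norm (f x))\<^sup>2)"
  by (auto simp: L2_def)

lemma L2I: "f \<in> borel_measurable lebesgue \<Longrightarrow> integrable lebesgue (\<lambda>x. (norm (f x))\<^sup>2) \<Longrightarrow> f \<in> L2"
  by (auto simp: L2_def)

text \<open>A crude substitute for the Cauchy-Schwarz inequality, used wherever only integrability
  or summability of a product matters.\<close>

lemma norm_mult_le_squares: "norm (a * b) \<le> (norm a)\<^sup>2 + (norm b)\<^sup>2"
  for a b :: "'a::real_normed_div_algebra"
proof -
  have "2 * (norm a * norm b) \<le> (norm a)\<^sup>2 + (norm b)\<^sup>2"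
    using sum_squares_bound[of "norm a" "norm b"] by (simp add: mult.assoc)
  moreover have "norm a * norm b \<ge> 0" by simp
  ultimately show ?thesis unfolding norm_mult by linarith
qed

lemma integrable_mult_squares:
  fixes f g :: "'a \<Rightarrow> 'b::{real_normed_div_algebra,banach,second_countable_topology}"
  assumes [measurable]: "f \<in> borel_measurable M" "g \<in> borel_measurable M"
    and f: "integrable M (\<lambda>x. (norm (f x))\<^sup>2)" and g: "integrable M (\<lambda>x. (norm (g x))\<^sup>2)"
  shows "integrable M (\<lambda>x. f x * g x)"
  by (rule Bochner_Integration.integrable_bound[OF Bochner_Integration.integrable_add[OF f g]])
     (auto simp: norm_mult_le_squares intro!: AE_I2)

lemma L2_mult_integrable: "f \<in> L2 \<Longrightarrow> g \<in> L2 \<Longrightarrow> integrable lebesgue (\<lambda>x. f x * g x)"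
  by (intro integrable_mult_squares) (auto simp: L2_def)

lemma L2_cnj: "f \<in> L2 \<Longrightarrow> (\<lambda>x. cnj (f x)) \<in> L2"
  by (auto simp: L2_def)

lemma L2_scale: "f \<in> L2 \<Longrightarrow> (\<lambda>x. c * f x) \<in> L2"
  by (auto simp: L2_def norm_mult power_mult_distrib)

lemma L2_zero: "(\<lambda>x. 0) \<in> L2"
  by (auto simp: L2_def)

lemma L2_add:
  assumes "f \<in> L2" "g \<in> L2"
  shows "(\<lambda>x. f x + g x) \<in> L2"
proof (rule L2I)
  have [measurable]: "f \<in> borel_measurable lebesgue" "g \<in> borel_measurable lebesgue"
    using assms by (auto dest: L2D)
  show "(\<lambda>x. f x + g x) \<in> borel_measurable lebesgue" by measurable
  have i: "integrable lebesgue (\<lambda>x. 2 * ((norm (f x))\<^sup>2 + (norm (g x))\<^sup>2))"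
    using assms by (intro integrable_mult_right Bochner_Integration.integrable_add L2D_int)
  show "integrable lebesgue (\<lambda>x. (norm (f x + g x))\<^sup>2)"
  proof (rule Bochner_Integration.integrable_bound[OF i], measurable, intro AE_I2)
    fix x
    have "(norm (f x + g x))\<^sup>2 \<le> (norm (f x) + norm (g x))\<^sup>2"
      by (intro power_mono norm_triangle_ineq) auto
    also have "\<dots> \<le> 2 * ((norm (f x))\<^sup>2 + (norm (g x))\<^sup>2)"
      using sum_squares_bound[of "norm (f x)" "norm (g x)"] by (simp add: power2_sum)
    finally show "norm ((norm (f x + g x))\<^sup>2) \<le> norm (2 * ((norm (f x))\<^sup>2 + (norm (g x))\<^sup>2))" by simp
  qed
qed

lemma L2_diff: "f \<in> L2 \<Longrightarrow> g \<in> L2 \<Longrightarrow> (\<lambda>x. f x - g x) \<in> L2"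
  using L2_add[of f "\<lambda>x. (-1) * g x"] L2_scale[of g "-1"] by simp

lemma L2_sum: "(\<And>i. i \<in> I \<Longrightarrow> f i \<in> L2) \<Longrightarrow> (\<lambda>x. \<Sum>i\<in>I. f i x) \<in> L2"
  by (induction I rule: infinite_finite_induct) (auto intro: L2_zero L2_add)

lemma l2_inner_add_right: "f \<in> L2 \<Longrightarrow> g \<in> L2 \<Longrightarrow> h \<in> L2 \<Longrightarrow>
    l2_inner f (\<lambda>x. g x + h x) = l2_inner f g + l2_inner f h"
  unfolding l2_inner_def by (simp add: distrib_left L2_mult_integrable L2_cnj)

lemma l2_inner_diff_right: "f \<in> L2 \<Longrightarrow> g \<in> L2 \<Longrightarrow> h \<in> L2 \<Longrightarrow>
    l2_inner f (\<lambda>x. g x - h x) = l2_inner f g - l2_inner f h"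
  unfolding l2_inner_def by (simp add: right_diff_distrib L2_mult_integrable L2_cnj)

lemma l2_inner_scale_right: "l2_inner f (\<lambda>x. c * g x) = c * l2_inner f g"
  unfolding l2_inner_def by (simp add: mult.left_commute)

lemma l2_inner_zero_right: "l2_inner f (\<lambda>x. 0) = 0"
  unfolding l2_inner_def by simp

lemma l2_inner_sum_right: "f \<in> L2 \<Longrightarrow> (\<And>i. i \<in> I \<Longrightarrow> g i \<in> L2) \<Longrightarrow>
    l2_inner f (\<lambda>x. \<Sum>i\<in>I. g i x) = (\<Sum>i\<in>I. l2_inner f (g i))"
  by (induction I rule: infinite_finite_induct)
     (auto simp: l2_inner_zero_right l2_inner_add_right L2_sum)

lemma l2_inner_cnj: "cnj (l2_inner f g) = l2_inner g f"
proof -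
  have "cnj (LINT x|lebesgue. cnj (f x) * g x) = (LINT x|lebesgue. cnj (cnj (f x) * g x))"
    by (rule Bochner_Integration.integral_cnj[symmetric])
  then show ?thesis unfolding l2_inner_def by (simp add: mult.commute)
qed

lemma l2_inner_diff_left: "f \<in> L2 \<Longrightarrow> g \<in> L2 \<Longrightarrow> h \<in> L2 \<Longrightarrow>
    l2_inner (\<lambda>x. g x - h x) f = l2_inner g f - l2_inner h f"
  by (metis complex_cnj_diff l2_inner_cnj l2_inner_diff_right)

lemma l2_norm_nonneg: "l2_norm f \<ge> 0"
  by (simp add: l2_norm_def)

lemma l2_norm_square: "(l2_norm f)\<^sup>2 = (LINT x|lebesgue. (norm (f x))\<^sup>2)"
  by (simp add: l2_norm_def)

lemma l2_inner_self: "l2_inner f f = of_real ((l2_norm f)\<^sup>2)"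
proof -
  have "l2_inner f f = (LINT x|lebesgue. complex_of_real ((norm (f x))\<^sup>2))"
    unfolding l2_inner_def
    by (rule Bochner_Integration.integral_cong[OF refl]) (metis complex_norm_square mult.commute of_real_power)
  also have "\<dots> = of_real (LINT x|lebesgue. (norm (f x))\<^sup>2)" by (rule integral_complex_of_real)
  finally show ?thesis by (simp add: l2_norm_square)
qed

lemma nn_integral_L2: "f \<in> L2 \<Longrightarrow> (\<integral>\<^sup>+x. ennreal ((norm (f x))\<^sup>2) \<partial>lebesgue) = ennreal ((l2_norm f)\<^sup>2)"
  unfolding l2_norm_square by (rule nn_integral_eq_integral[OF L2D_int]) auto

lemma l2_Cauchy_Schwarz:
  assumes "f \<in> L2" "g \<in> L2"
  shows "(LINT x|lebesgue. norm (f x * g x)) \<le> l2_norm f * l2_norm g"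
proof -
  have [measurable]: "f \<in> borel_measurable lebesgue" "g \<in> borel_measurable lebesgue"
    using assms by (auto dest: L2D)
  have "(\<integral>\<^sup>+x. ennreal (norm (f x)) * ennreal (norm (g x)) \<partial>lebesgue)\<^sup>2
     \<le> (\<integral>\<^sup>+x. (ennreal (norm (f x)))^2 \<partial>lebesgue) * (\<integral>\<^sup>+x. (ennreal (norm (g x)))^2 \<partial>lebesgue)"
    by (rule Cauchy_Schwarz_nn_integral) auto
  also have "\<dots> = ennreal ((l2_norm f * l2_norm g)\<^sup>2)"
    using assms by (simp add: ennreal_power nn_integral_L2 ennreal_mult[symmetric] power_mult_distrib)
  also have "(\<integral>\<^sup>+x. ennreal (norm (f x)) * ennreal (norm (g x)) \<partial>lebesgue) = ennreal (LINT x|lebesgue. norm (f x * g x))"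
    using L2_mult_integrable[OF assms]
    by (subst nn_integral_eq_integral[symmetric]) (auto simp: ennreal_mult norm_mult dest: integrable_norm)
  finally have "(LINT x|lebesgue. norm (f x * g x))\<^sup>2 \<le> (l2_norm f * l2_norm g)\<^sup>2"
    by (simp add: ennreal_power)
  then show ?thesis by (rule power2_le_imp_le) (simp add: l2_norm_nonneg)
qed

lemma norm_l2_inner_le: "f \<in> L2 \<Longrightarrow> g \<in> L2 \<Longrightarrow> norm (l2_inner f g) \<le> l2_norm f * l2_norm g"
proof -
  assume fg: "f \<in> L2" "g \<in> L2"
  have "norm (l2_inner f g) \<le> (LINT x|lebesgue. norm (cnj (f x) * g x))"
    unfolding l2_inner_def by (rule integral_norm_bound)
  also have "\<dots> \<le> l2_norm (\<lambda>x. cnj (f x)) * l2_norm g" using fg by (intro l2_Cauchy_Schwarz L2_cnj)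
  finally show ?thesis by (simp add: l2_norm_def)
qed

lemma l2_norm_eq_0: "f \<in> L2 \<Longrightarrow> l2_norm f = 0 \<Longrightarrow> AE x in lebesgue. f x = 0"
proof -
  assume f: "f \<in> L2" and "l2_norm f = 0"
  then have "(LINT x|lebesgue. (norm (f x))\<^sup>2) = 0" by (simp add: l2_norm_def)
  then have "AE x in lebesgue. (norm (f x))\<^sup>2 = 0"
    by (subst (asm) integral_nonneg_eq_0_iff_AE[OF L2D_int[OF f]]) auto
  then show ?thesis by eventually_elim simp
qed

lemma l2_inner_cong_AE:
  assumes "AE x in lebesgue. f x = f' x" "AE x in lebesgue. g x = g' x"
    "f \<in> L2" "f' \<in> L2" "g \<in> L2" "g' \<in> L2"
  shows "l2_inner f g = l2_inner f' g'"
proof -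
  have [measurable]: "f \<in> borel_measurable lebesgue" "g \<in> borel_measurable lebesgue"
    "f' \<in> borel_measurable lebesgue" "g' \<in> borel_measurable lebesgue"
    using assms by (auto dest: L2D)
  show ?thesis unfolding l2_inner_def
    by (rule integral_cong_AE) (use assms(1,2) in \<open>measurable, auto\<close>)
qed

text \<open>Sets instead of sequences, because Zorn's lemma is applied to them before their
  countability is known.\<close>

definition l2_orthonormal :: "(real \<Rightarrow> complex) set \<Rightarrow> bool" where
  "l2_orthonormal S \<longleftrightarrow> (\<forall>f\<in>S. f \<in> L2) \<and> (\<forall>f\<in>S. \<forall>g\<in>S. l2_inner f g = (if f = g then 1 else 0))"

section \<open>Projections, Bessel's inequality and Parseval's identity\<close>

lemma l2_inner_orthonormal_sum:
  assumes "finite I" "\<And>j. j \<in> I \<Longrightarrow> e j \<in> L2" "e i \<in> L2"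
    "\<And>j. j \<in> I \<Longrightarrow> l2_inner (e i) (e j) = (if i = j then 1 else 0)"
  shows "l2_inner (e i) (\<lambda>x. \<Sum>j\<in>I. c j * e j x) = (if i \<in> I then c i else 0)"
proof -
  have "l2_inner (e i) (\<lambda>x. \<Sum>j\<in>I. c j * e j x) = (\<Sum>j\<in>I. c j * l2_inner (e i) (e j))"
    using assms(2,3) by (simp add: l2_inner_sum_right L2_scale l2_inner_scale_right)
  also have "\<dots> = (\<Sum>j\<in>I. if i = j then c j else 0)"
    by (rule sum.cong) (use assms(4) in auto)
  finally show ?thesis using assms(1) by simp
qed

text \<open>Pythagoras: both cross terms and the square of the projection equal the same sum of
  squared coefficients, so exactly one copy of it survives with a minus sign.\<close>

lemma l2_norm_diff_projection:
  assumes "finite I" "\<And>i. i \<in> I \<Longrightarrow> e i \<in> L2" "f \<in> L2"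
    "\<And>i j. i \<in> I \<Longrightarrow> j \<in> I \<Longrightarrow> l2_inner (e i) (e j) = (if i = j then 1 else 0)"
  shows "(l2_norm (\<lambda>x. f x - (\<Sum>i\<in>I. l2_inner (e i) f * e i x)))\<^sup>2
    = (l2_norm f)\<^sup>2 - (\<Sum>i\<in>I. (norm (l2_inner (e i) f))\<^sup>2)"
proof -
  let ?c = "\<lambda>i. l2_inner (e i) f"
  let ?s = "\<lambda>x. \<Sum>i\<in>I. ?c i * e i x"
  have s: "?s \<in> L2" using assms by (intro L2_sum L2_scale) auto
  have es: "l2_inner (e i) ?s = ?c i" if "i \<in> I" for i
    using l2_inner_orthonormal_sum[of I e i ?c] assms that by simp
  have gs: "l2_inner g ?s = (\<Sum>i\<in>I. ?c i * l2_inner g (e i))" if "g \<in> L2" for g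
    using assms that by (simp add: l2_inner_sum_right L2_scale l2_inner_scale_right)
  have fs: "l2_inner f ?s = of_real (\<Sum>i\<in>I. (norm (?c i))\<^sup>2)"
    unfolding gs[OF assms(3)] of_real_sum
    by (intro sum.cong refl) (metis complex_norm_square l2_inner_cnj of_real_power)
  have ss: "l2_inner ?s ?s = of_real (\<Sum>i\<in>I. (norm (?c i))\<^sup>2)"
  proof -
    have "l2_inner ?s (e i) = cnj (?c i)" if "i \<in> I" for i
      using es[OF that] l2_inner_cnj[of "e i" ?s] by simp
    then show ?thesis
      unfolding gs[OF s] of_real_sum
      by (intro sum.cong refl) (metis complex_norm_square of_real_power)
  qed
  have sf: "l2_inner ?s f = of_real (\<Sum>i\<in>I. (norm (?c i))\<^sup>2)"
    using arg_cong[OF fs, of cnj] by (simp add: l2_inner_cnj)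
  have "complex_of_real ((l2_norm (\<lambda>x. f x - ?s x))\<^sup>2) = l2_inner (\<lambda>x. f x - ?s x) (\<lambda>x. f x - ?s x)"
    by (rule l2_inner_self[symmetric])
  also have "\<dots> = l2_inner f f - l2_inner f ?s - (l2_inner ?s f - l2_inner ?s ?s)"
    using assms(3) s L2_diff[OF assms(3) s] by (simp add: l2_inner_diff_left l2_inner_diff_right)
  also have "\<dots> = of_real ((l2_norm f)\<^sup>2 - (\<Sum>i\<in>I. (norm (?c i))\<^sup>2))"
    unfolding fs sf ss l2_inner_self by simp
  finally show ?thesis by (simp only: of_real_eq_iff)
qed

lemma l2_Bessel:
  assumes "finite I" "\<And>i. i \<in> I \<Longrightarrow> e i \<in> L2" "f \<in> L2"
    "\<And>i j. i \<in> I \<Longrightarrow> j \<in> I \<Longrightarrow> l2_inner (e i) (e j) = (if i = j then 1 else 0)"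
  shows "(\<Sum>i\<in>I. (norm (l2_inner (e i) f))\<^sup>2) \<le> (l2_norm f)\<^sup>2"
proof -
  have "0 \<le> (l2_norm (\<lambda>x. f x - (\<Sum>i\<in>I. l2_inner (e i) f * e i x)))\<^sup>2" by simp
  also have "\<dots> = (l2_norm f)\<^sup>2 - (\<Sum>i\<in>I. (norm (l2_inner (e i) f))\<^sup>2)"
    by (rule l2_norm_diff_projection) (use assms in auto)
  finally show ?thesis by linarith
qed

text \<open>Totality in \<open>l2_onb\<close> only says that a vector orthogonal to every
  \<open>e i\<close> vanishes, so the Fourier series must first be shown to converge in norm. This
  is the Riesz-Fischer argument: a rapidly Cauchy subsequence of partial sums converges almost
  everywhere, Fatou's lemma upgrades this to convergence in norm, and the limit \<open>S\<close> has
  the coefficients of \<open>f\<close>, hence equals it.\<close>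

lemma l2_Parseval_norm:
  assumes e: "l2_onb e" and f: "f \<in> L2"
  shows "(\<lambda>i. (norm (l2_inner (e i) f))\<^sup>2) sums (l2_norm f)\<^sup>2"
proof -
  have eL: "\<And>i. e i \<in> L2" and eo: "\<And>i j. l2_inner (e i) (e j) = (if i = j then 1 else 0)"
    and ec: "\<And>f. f \<in> L2 \<Longrightarrow> (\<And>i. l2_inner (e i) f = 0) \<Longrightarrow> AE x in lebesgue. f x = 0"
    using e unfolding l2_onb_def by auto
  have [measurable]: "\<And>i. e i \<in> borel_measurable lebesgue" "f \<in> borel_measurable lebesgue"
    using eL f by (auto dest: L2D)
  define c where "c i = l2_inner (e i) f" for i
  define s where "s n x = (\<Sum>i<n. c i * e i x)" for n x
  have sL: "s n \<in> L2" for n unfolding s_def by (intro L2_sum L2_scale eL)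
  have [measurable]: "s n \<in> borel_measurable lebesgue" for n using sL by (auto dest: L2D)
  have bessel: "(\<Sum>i<n. (norm (c i))\<^sup>2) \<le> (l2_norm f)\<^sup>2" for n
    unfolding c_def by (rule l2_Bessel) (auto intro: eL f simp: eo)
  have summ: "summable (\<lambda>i. (norm (c i))\<^sup>2)"
    by (rule summableI_nonneg_bounded[OF _ bessel]) auto
  have sdiff: "(l2_norm (\<lambda>x. s n x - s m x))\<^sup>2 = (\<Sum>i\<in>{m..<n}. (norm (c i))\<^sup>2)" if "m \<le> n" for m n
  proof -
    have dec: "{..<n} = {..<m} \<union> {m..<n}" using that by auto
    have d: "s n x - s m x = (\<Sum>i\<in>{m..<n}. c i * e i x)" for x
      unfolding s_def dec by (subst sum.union_disjoint) auto
    have co: "l2_inner (e i) (\<lambda>x. s n x - s m x) = c i" if "i \<in> {m..<n}" for i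
      unfolding d using l2_inner_orthonormal_sum[of "{m..<n}" e i c] eL eo that by simp
    have "(l2_norm (\<lambda>x. (s n x - s m x) - (\<Sum>i\<in>{m..<n}. l2_inner (e i) (\<lambda>x. s n x - s m x) * e i x)))\<^sup>2
       = (l2_norm (\<lambda>x. s n x - s m x))\<^sup>2 - (\<Sum>i\<in>{m..<n}. (norm (l2_inner (e i) (\<lambda>x. s n x - s m x)))\<^sup>2)"
      by (rule l2_norm_diff_projection) (auto intro: eL L2_diff sL simp: eo)
    moreover have "(\<lambda>x. (s n x - s m x) - (\<Sum>i\<in>{m..<n}. l2_inner (e i) (\<lambda>x. s n x - s m x) * e i x)) = (\<lambda>x. 0)"
      using co by (simp add: d)
    moreover have "(\<Sum>i\<in>{m..<n}. (norm (l2_inner (e i) (\<lambda>x. s n x - s m x)))\<^sup>2) = (\<Sum>i\<in>{m..<n}. (norm (c i))\<^sup>2)"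
      by (rule sum.cong[OF refl], subst co) auto
    moreover have "l2_norm (\<lambda>x. 0) = 0" by (simp add: l2_norm_def)
    ultimately show ?thesis by simp
  qed
  have ex: "\<exists>N. \<forall>m\<ge>N. \<forall>n. (\<Sum>i\<in>{m..<n}. (norm (c i))\<^sup>2) < (1/4)^j" for j :: nat
  proof -
    obtain N where "\<forall>m\<ge>N. \<forall>n. norm (\<Sum>i\<in>{m..<n}. (norm (c i))\<^sup>2) < (1/4)^j"
      using summ[unfolded summable_Cauchy] by (metis zero_less_power zero_less_divide_1_iff zero_less_numeral)
    then show ?thesis by (intro exI[of _ N]) (auto simp: sum_nonneg)
  qed
  then obtain N0 where N0: "\<And>j m n. m \<ge> N0 j \<Longrightarrow> (\<Sum>i\<in>{m..<n}. (norm (c i))\<^sup>2) < (1/4)^j"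
    by metis
  \<comment> \<open>The sum makes \<open>N\<close> monotone and at least \<open>N0 j\<close>; the
    extra \<open>j\<close> makes it tend to infinity.\<close>
  define N where "N j = (\<Sum>i\<le>j. N0 i) + j" for j
  have NN0: "N j \<ge> N0 j" for j unfolding N_def by (simp add: member_le_sum trans_le_add1)
  have Nmono: "N j \<le> N l" if "j \<le> l" for j l unfolding N_def
    using that by (intro add_mono sum_mono2) auto
  have Nj: "N j \<ge> j" for j unfolding N_def by simp
  have nnd: "(\<integral>\<^sup>+x. ennreal ((norm (s (N l) x - s (N j) x))\<^sup>2) \<partial>lebesgue) \<le> ennreal ((1/4)^j)" if "j \<le> l" for j l
    using N0[OF NN0[of j], of "N l"] by (subst nn_integral_L2) (auto intro!: L2_diff sL ennreal_leI simp: sdiff[OF Nmono[OF that]])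
  \<comment> \<open>The squared norms of these increments are at most \<open>(1/4)^j\<close>. With
    the weight \<open>2^j\<close> they still have a finite sum, and finiteness of the weighted sum
    at a point forces \<open>norm (D j x) \<le> (sqrt (1/2))^j\<close> for large
    \<open>j\<close>.\<close>
  define D where "D j x = s (N (Suc j)) x - s (N j) x" for j x
  have [measurable]: "D j \<in> borel_measurable lebesgue" for j unfolding D_def by measurable
  have "(\<integral>\<^sup>+x. (\<Sum>j. ennreal (2^j * (norm (D j x))\<^sup>2)) \<partial>lebesgue) = (\<Sum>j. \<integral>\<^sup>+x. ennreal (2^j * (norm (D j x))\<^sup>2) \<partial>lebesgue)"
    by (rule nn_integral_suminf) auto
  also have "\<dots> \<le> (\<Sum>j. ennreal ((1/2)^j))"
  proof (intro suminf_le summableI)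
    fix j
    have "(\<integral>\<^sup>+x. ennreal (2^j * (norm (D j x))\<^sup>2) \<partial>lebesgue) = ennreal (2^j) * (\<integral>\<^sup>+x. ennreal ((norm (D j x))\<^sup>2) \<partial>lebesgue)"
      by (simp add: ennreal_mult nn_integral_cmult)
    also have "\<dots> \<le> ennreal (2^j) * ennreal ((1/4)^j)"
      unfolding D_def by (intro mult_left_mono nnd) auto
    also have "\<dots> = ennreal (2^j * (1/4)^j)" by (subst ennreal_mult) auto
    also have "2^j * (1/4)^j = (1/2::real)^j" unfolding power_mult_distrib[symmetric] by simp
    finally show "(\<integral>\<^sup>+x. ennreal (2^j * (norm (D j x))\<^sup>2) \<partial>lebesgue) \<le> ennreal ((1/2)^j)" .
  qed
  also have "(\<Sum>j. ennreal ((1/2)^j)) = ennreal (\<Sum>j. (1/2)^j)"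
    by (rule suminf_ennreal2) (auto intro: summable_geometric)
  also have "\<dots> < \<infinity>" by simp
  finally have "(\<integral>\<^sup>+x. (\<Sum>j. ennreal (2^j * (norm (D j x))\<^sup>2)) \<partial>lebesgue) \<noteq> \<infinity>"
    by (rule less_imp_neq)
  then have "AE x in lebesgue. (\<Sum>j. ennreal (2^j * (norm (D j x))\<^sup>2)) \<noteq> \<infinity>"
    by (intro nn_integral_noteq_infinite) auto
  then have conv: "AE x in lebesgue. convergent (\<lambda>j. s (N j) x)"
  proof eventually_elim
    fix x assume "(\<Sum>j. ennreal (2^j * (norm (D j x))\<^sup>2)) \<noteq> \<infinity>"
    then have "summable (\<lambda>j. 2^j * (norm (D j x))\<^sup>2)"
      by (intro summable_suminf_not_top) auto
    then have "(\<lambda>j. 2^j * (norm (D j x))\<^sup>2) \<longlonglongrightarrow> 0" by (rule summable_LIMSEQ_zero)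
    then have ev: "eventually (\<lambda>j. 2^j * (norm (D j x))\<^sup>2 < 1) sequentially"
      by (rule order_tendstoD) simp
    have "summable (\<lambda>j. D j x)"
    proof (rule summable_comparison_test_ev)
      show "summable (\<lambda>j. (sqrt (1/2))^j)" by (intro summable_geometric) (simp add: real_sqrt_divide)
      show "eventually (\<lambda>j. norm (D j x) \<le> (sqrt (1/2))^j) sequentially"
        using ev
      proof eventually_elim
        fix j assume "2^j * (norm (D j x))\<^sup>2 < 1"
        then have "(norm (D j x))\<^sup>2 \<le> (1/2)^j" by (simp add: field_simps)
        then have "norm (D j x) \<le> sqrt ((1/2)^j)" by (rule real_le_rsqrt)
        then show "norm (D j x) \<le> (sqrt (1/2))^j" by (simp add: real_sqrt_power)
      qed
    qed
    then have "convergent (\<lambda>n. \<Sum>j<n. D j x)" by (simp add: summable_iff_convergent)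
    moreover have "(\<Sum>j<n. D j x) = s (N n) x - s (N 0) x" for n
      unfolding D_def by (rule sum_lessThan_telescope)
    ultimately have "convergent (\<lambda>n. s (N n) x - s (N 0) x)" by simp
    then show "convergent (\<lambda>j. s (N j) x)"
      by (simp add: convergent_diff_const_right_iff)
  qed
  define S where "S x = lim (\<lambda>j. s (N j) x)" for x
  have [measurable]: "S \<in> borel_measurable lebesgue" unfolding S_def by measurable
  \<comment> \<open>Fatou's lemma applied to the differences with a fixed partial sum.\<close>
  have Sn: "(\<integral>\<^sup>+x. ennreal ((norm (S x - s (N l) x))\<^sup>2) \<partial>lebesgue) \<le> ennreal ((1/4)^l)" for l
  proof -
    have "(\<integral>\<^sup>+x. ennreal ((norm (S x - s (N l) x))\<^sup>2) \<partial>lebesgue)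
        = (\<integral>\<^sup>+x. liminf (\<lambda>j. ennreal ((norm (s (N j) x - s (N l) x))\<^sup>2)) \<partial>lebesgue)"
    proof (rule nn_integral_cong_AE, use conv in eventually_elim)
      fix x assume "convergent (\<lambda>j. s (N j) x)"
      then have "(\<lambda>j. s (N j) x) \<longlonglongrightarrow> S x" unfolding S_def by (simp add: convergent_LIMSEQ_iff)
      then have "(\<lambda>j. ennreal ((norm (s (N j) x - s (N l) x))\<^sup>2)) \<longlonglongrightarrow> ennreal ((norm (S x - s (N l) x))\<^sup>2)"
        by (intro tendsto_intros)
      then show "ennreal ((norm (S x - s (N l) x))\<^sup>2) = liminf (\<lambda>j. ennreal ((norm (s (N j) x - s (N l) x))\<^sup>2))"
        using lim_imp_Liminf[OF sequentially_bot] by metis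
    qed
    also have "\<dots> \<le> liminf (\<lambda>j. \<integral>\<^sup>+x. ennreal ((norm (s (N j) x - s (N l) x))\<^sup>2) \<partial>lebesgue)"
      by (rule nn_integral_liminf) auto
    also have "\<dots> \<le> ennreal ((1/4)^l)"
      by (rule Liminf_le) (auto intro!: eventually_sequentiallyI[of l] nnd)
    finally show ?thesis .
  qed
  have SdL: "(\<lambda>x. S x - s (N l) x) \<in> L2" for l
  proof (rule L2I)
    show "integrable lebesgue (\<lambda>x. (norm (S x - s (N l) x))\<^sup>2)"
      by (rule integrableI_bounded) (use Sn[of l] in \<open>auto simp: top.not_eq_extremum[symmetric] top_unique\<close>)
  qed measurable
  have SL: "S \<in> L2" using L2_add[OF SdL[of 0] sL[of "N 0"]] by simp
  have Snorm: "(l2_norm (\<lambda>x. S x - s (N l) x))\<^sup>2 \<le> (1/4)^l" for l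
    using Sn[of l] by (subst (asm) nn_integral_L2[OF SdL]) (simp add: ennreal_le_iff)
  have tend0: "(\<lambda>l. (1/4::real)^l) \<longlonglongrightarrow> 0" by (intro LIMSEQ_power_zero) simp
  have S0: "(\<lambda>l. (l2_norm (\<lambda>x. S x - s (N l) x))\<^sup>2) \<longlonglongrightarrow> 0"
    by (rule tendsto_sandwich[OF _ _ tendsto_const tend0]) (auto simp: Snorm)
  then have S0': "(\<lambda>l. l2_norm (\<lambda>x. S x - s (N l) x)) \<longlonglongrightarrow> 0"
    using tendsto_real_sqrt[OF S0] by (simp add: l2_norm_nonneg)
  have es: "l2_inner (e i) (s n) = c i" if "i < n" for i n
    unfolding s_def using l2_inner_orthonormal_sum[of "{..<n}" e i c] eL eo that by simp
  have cS: "l2_inner (e i) S = c i" for i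
  proof -
    have "complex_of_real ((l2_norm (e i))\<^sup>2) = of_real 1" using eo[of i i] l2_inner_self[of "e i"] by simp
    then have "(l2_norm (e i))\<^sup>2 = 1\<^sup>2" unfolding of_real_eq_iff by simp
    then have en1: "l2_norm (e i) = 1" using l2_norm_nonneg[of "e i"] by (rule power2_eq_imp_eq) simp
    have "(\<lambda>l. l2_inner (e i) S - c i) \<longlonglongrightarrow> 0"
    proof (rule Lim_null_comparison[OF _ S0'], rule eventually_sequentiallyI[of "Suc i"])
      \<comment> \<open>From this index on the partial sum contains the term \<open>i\<close>, so
        its coefficient is exactly \<open>c i\<close>.\<close>
      fix l assume l: "Suc i \<le> l"
      then have "l2_inner (e i) (s (N l)) = c i" using Nj[of l] by (intro es) auto
      then have "norm (l2_inner (e i) S - c i) = norm (l2_inner (e i) (\<lambda>x. S x - s (N l) x))"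
        by (simp add: l2_inner_diff_right eL SL sL)
      also have "\<dots> \<le> l2_norm (e i) * l2_norm (\<lambda>x. S x - s (N l) x)"
        by (intro norm_l2_inner_le eL SdL)
      finally show "norm (l2_inner (e i) S - c i) \<le> l2_norm (\<lambda>x. S x - s (N l) x)"
        by (simp add: en1)
    qed
    then show ?thesis by (simp add: LIMSEQ_const_iff)
  qed
  have fS: "AE x in lebesgue. f x - S x = 0"
    by (rule ec) (auto intro: L2_diff f SL simp: l2_inner_diff_right eL f SL cS, simp add: c_def)
  have "(l2_norm (\<lambda>x. S x - s (N l) x))\<^sup>2 = (l2_norm (\<lambda>x. f x - s (N l) x))\<^sup>2" for l
    unfolding l2_norm_square by (rule integral_cong_AE) (use fS in \<open>measurable, auto\<close>)
  moreover have "(l2_norm (\<lambda>x. f x - s n x))\<^sup>2 = (l2_norm f)\<^sup>2 - (\<Sum>i<n. (norm (c i))\<^sup>2)" for n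
    unfolding s_def c_def by (rule l2_norm_diff_projection) (auto intro: eL f simp: eo)
  ultimately have "(\<lambda>l. (l2_norm f)\<^sup>2 - (\<Sum>i<N l. (norm (c i))\<^sup>2)) \<longlonglongrightarrow> 0"
    using S0 by simp
  then have "(\<lambda>l. (l2_norm f)\<^sup>2 - ((l2_norm f)\<^sup>2 - (\<Sum>i<N l. (norm (c i))\<^sup>2))) \<longlonglongrightarrow> (l2_norm f)\<^sup>2 - 0"
    by (intro tendsto_intros)
  then have lim1: "(\<lambda>l. (\<Sum>i<N l. (norm (c i))\<^sup>2)) \<longlonglongrightarrow> (l2_norm f)\<^sup>2" by simp
  have "filterlim N at_top sequentially"
    by (rule filterlim_at_top_mono[OF filterlim_ident]) (auto simp: Nj)
  then have "(\<lambda>l. (\<Sum>i<N l. (norm (c i))\<^sup>2)) \<longlonglongrightarrow> (\<Sum>i. (norm (c i))\<^sup>2)"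
    using summable_LIMSEQ[OF summ] by (rule filterlim_compose[rotated])
  from LIMSEQ_unique[OF this lim1] summable_sums[OF summ] show ?thesis
    unfolding c_def by simp
qed

lemma l2_Parseval_summable:
  assumes e: "l2_onb e" and f: "f \<in> L2" and g: "g \<in> L2"
  shows "summable (\<lambda>i. norm (l2_inner f (e i) * l2_inner (e i) g))"
proof (rule summable_comparison_test')
  show "summable (\<lambda>i. (norm (l2_inner (e i) f))\<^sup>2 + (norm (l2_inner (e i) g))\<^sup>2)"
    by (rule summable_add[OF sums_summable[OF l2_Parseval_norm[OF e f]] sums_summable[OF l2_Parseval_norm[OF e g]]])
  show "norm (norm (l2_inner f (e i) * l2_inner (e i) g)) \<le> (norm (l2_inner (e i) f))\<^sup>2 + (norm (l2_inner (e i) g))\<^sup>2" for i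
  proof -
    have "norm (l2_inner f (e i)) = norm (l2_inner (e i) f)"
      by (subst l2_inner_cnj[symmetric]) simp
    then show ?thesis using norm_mult_le_squares[of "l2_inner f (e i)" "l2_inner (e i) g"] by simp
  qed
qed

lemma l2_Parseval:
  assumes e: "l2_onb e" and f: "f \<in> L2" and g: "g \<in> L2"
  shows "(\<lambda>i. l2_inner f (e i) * l2_inner (e i) g) sums l2_inner f g"
proof -
  have eL: "\<And>i. e i \<in> L2" and eo: "\<And>i j. l2_inner (e i) (e j) = (if i = j then 1 else 0)"
    using e unfolding l2_onb_def by auto
  define s where "s n x = (\<Sum>i<n. l2_inner (e i) g * e i x)" for n x
  have sL: "s n \<in> L2" for n unfolding s_def by (intro L2_sum L2_scale eL)
  have "(l2_norm (\<lambda>x. g x - s n x))\<^sup>2 = (l2_norm g)\<^sup>2 - (\<Sum>i<n. (norm (l2_inner (e i) g))\<^sup>2)" for n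
    unfolding s_def by (rule l2_norm_diff_projection) (auto intro: eL g simp: eo)
  moreover have "(\<lambda>n. (l2_norm g)\<^sup>2 - (\<Sum>i<n. (norm (l2_inner (e i) g))\<^sup>2)) \<longlonglongrightarrow> (l2_norm g)\<^sup>2 - (l2_norm g)\<^sup>2"
    using l2_Parseval_norm[OF e g] unfolding sums_def by (intro tendsto_intros)
  ultimately have "(\<lambda>n. (l2_norm (\<lambda>x. g x - s n x))\<^sup>2) \<longlonglongrightarrow> 0" by simp
  from tendsto_real_sqrt[OF this] have n0: "(\<lambda>n. l2_norm (\<lambda>x. g x - s n x)) \<longlonglongrightarrow> 0"
    by (simp add: l2_norm_nonneg)
  have "(\<lambda>n. l2_inner f g - l2_inner f (s n)) \<longlonglongrightarrow> 0"
  proof (rule Lim_null_comparison)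
    show "(\<lambda>n. l2_norm f * l2_norm (\<lambda>x. g x - s n x)) \<longlonglongrightarrow> 0"
      using tendsto_mult_right_zero[OF n0] by simp
    show "\<forall>\<^sub>F n in sequentially. norm (l2_inner f g - l2_inner f (s n)) \<le> l2_norm f * l2_norm (\<lambda>x. g x - s n x)"
      using norm_l2_inner_le[OF f L2_diff[OF g sL]] by (simp add: l2_inner_diff_right f g sL)
  qed
  moreover have "l2_inner f (s n) = (\<Sum>i<n. l2_inner f (e i) * l2_inner (e i) g)" for n
    unfolding s_def by (simp add: l2_inner_sum_right f L2_scale eL l2_inner_scale_right) (simp add: mult.commute)
  ultimately have "(\<lambda>n. l2_inner f g - (\<Sum>i<n. l2_inner f (e i) * l2_inner (e i) g)) \<longlonglongrightarrow> 0" by simp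
  then have "(\<lambda>n. l2_inner f g - (l2_inner f g - (\<Sum>i<n. l2_inner f (e i) * l2_inner (e i) g))) \<longlonglongrightarrow> l2_inner f g - 0"
    by (intro tendsto_intros)
  then show ?thesis unfolding sums_def by simp
qed

section \<open>Existence of an orthonormal basis\<close>

lemma L2_indicator:
  "A \<in> sets lebesgue \<Longrightarrow> emeasure lebesgue A < \<infinity> \<Longrightarrow> (\<lambda>x. indicator A x :: complex) \<in> L2"
proof (rule L2I)
  assume A: "A \<in> sets lebesgue" "emeasure lebesgue A < \<infinity>"
  have "(\<lambda>x. (norm (indicator A x :: complex))\<^sup>2) = (\<lambda>x. indicator A x :: real)"
    by (auto simp: indicator_def)
  then show "integrable lebesgue (\<lambda>x. (norm (indicator A x :: complex))\<^sup>2)" using A by auto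
qed auto

lemma L2_indicator_Icc: "(\<lambda>x. indicator {a..b} x :: complex) \<in> L2" for a b :: real
  by (cases "a \<le> b") (auto intro!: L2_indicator L2_zero)

text \<open>The Borel sets over which \<open>f\<close> integrates to zero contain the intervals and
  are closed under complements and countable disjoint unions; a Lebesgue set differs from a Borel
  set by a null set.\<close>

lemma AE_zero_of_Icc_integrals:
  fixes f :: "real \<Rightarrow> complex"
  assumes "integrable lebesgue f" and zero: "\<And>a b. (LINT x:{a..b}|lebesgue. f x) = 0"
  shows "AE x in lebesgue. f x = 0"
proof (rule lebesgue.density_zero[OF assms(1)])
  have si: "set_integrable lebesgue A f" if "A \<in> sets lebesgue" for A
    using assms(1) that integrable_mult_indicator set_integrable_def by blast
  \<comment> \<open>Closure under complements needs the integral over the whole line, which is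
    reached by exhaustion with bounded intervals.\<close>
  have UNIV: "(LINT x:UNIV|lebesgue. f x) = 0"
  proof -
    have "(\<lambda>n. LINT x:{-real n..real n}|lebesgue. f x) \<longlonglongrightarrow> (LINT x:(\<Union>n. {-real n..real n})|lebesgue. f x)"
    proof (rule set_integral_cont_up)
      show "incseq (\<lambda>n. {- real n..real n})" by (auto simp: incseq_def)
    qed (auto intro: si)
    moreover have "(\<Union>n. {-real n..real n}) = UNIV"
    proof (rule UNIV_eq_I[symmetric])
      fix x :: real
      obtain n where "\<bar>x\<bar> \<le> real n" using real_arch_simple by blast
      then show "x \<in> (\<Union>n. {-real n..real n})" by (auto intro!: exI[of _ n])
    qed
    ultimately show ?thesis using zero by (simp add: LIMSEQ_const_iff)
  qed
  have borel: "(LINT x:A|lebesgue. f x) = 0" if "A \<in> sets borel" for A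
    using that
  proof (induction rule: borel_set_induct)
    case empty then show ?case by (simp add: set_lebesgue_integral_def)
  next
    case (interval a b) show ?case by (rule zero)
  next
    case (compl A)
    have "(LINT x:A \<union> (-A)|lebesgue. f x) = (LINT x:A|lebesgue. f x) + (LINT x:-A|lebesgue. f x)"
      using compl by (intro set_integral_Un si) auto
    then show ?case using UNIV compl by simp
  next
    case (union A)
    have "(LINT x:(\<Union>i. A i)|lebesgue. f x) = (\<Sum>i. (LINT x:(A i)|lebesgue. f x))"
      using union by (intro lebesgue_integral_countable_add si)
        (auto simp: disjoint_family_on_def intro!: sets.countable_UN)
    then show ?case using union by simp
  qed
  fix A :: "real set" assume A: "A \<in> sets lebesgue"
  from sets_completionE[OF this] obtain S N N' where *: "A = S \<union> N" "N \<subseteq> N'" "N' \<in> null_sets lborel" "S \<in> sets lborel"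
    by metis
  have "N' \<in> null_sets lebesgue" using *(3) by (rule null_sets_completionI)
  then have "AE x in lebesgue. x \<notin> N'" by (rule AE_not_in)
  then have "(LINT x:A|lebesgue. f x) = (LINT x:S|lebesgue. f x)"
    unfolding set_lebesgue_integral_def using assms(1) A *
    by (intro integral_cong_AE) (auto elim!: eventually_mono split: split_indicator intro!: borel_measurable_scaleR borel_measurable_indicator)
  then show "(LINT x:A|lebesgue. f x) = 0" using borel[of S] *(4) by simp
qed

lemma rational_Icc_integrals_zero:
  fixes f :: "real \<Rightarrow> complex"
  assumes "f \<in> L2" and zero: "\<And>p q :: rat. l2_inner (indicator {real_of_rat p..real_of_rat q}) f = 0"
  shows "(LINT x:{a..b}|lebesgue. f x) = 0"
proof -
  have [measurable]: "f \<in> borel_measurable lebesgue" using assms by (auto dest: L2D)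
  have "\<exists>p. a - 1 / real (Suc n) < real_of_rat p \<and> real_of_rat p < a" for n by (intro of_rat_dense) auto
  then obtain p where p: "\<And>n. a - 1 / real (Suc n) < real_of_rat (p n)" "\<And>n. real_of_rat (p n) < a" by metis
  have "\<exists>q. b < real_of_rat q \<and> real_of_rat q < b + 1 / real (Suc n)" for n by (intro of_rat_dense) auto
  then obtain q where q: "\<And>n. b < real_of_rat (q n)" "\<And>n. real_of_rat (q n) < b + 1 / real (Suc n)" by metis
  let ?I = "\<lambda>n. {real_of_rat (p n)..real_of_rat (q n)}"
  have inf0: "(\<lambda>n. 1 / real (Suc n)) \<longlonglongrightarrow> 0" using LIMSEQ_inverse_real_of_nat by (simp add: inverse_eq_divide)
  have "(\<lambda>n. LINT x|lebesgue. indicator (?I n) x *\<^sub>R f x) \<longlonglongrightarrow> (LINT x|lebesgue. indicator {a..b} x *\<^sub>R f x)"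
  proof (rule integral_dominated_convergence[where w="\<lambda>x. norm (indicator {a-1..b+1} x * f x)"])
    show "integrable lebesgue (\<lambda>x. norm (indicator {a-1..b+1} x * f x))"
      by (intro integrable_norm L2_mult_integrable assms L2_indicator_Icc)
    show "AE x in lebesgue. (\<lambda>n. indicator (?I n) x *\<^sub>R f x) \<longlonglongrightarrow> indicator {a..b} x *\<^sub>R f x"
    proof (intro AE_I2 tendsto_scaleR tendsto_const)
      fix x
      show "(\<lambda>n. indicator (?I n) x :: real) \<longlonglongrightarrow> indicator {a..b} x"
      proof (cases "x \<in> {a..b}")
        case True
        then have "x \<in> ?I n" for n using p(2)[of n] q(1)[of n] by auto
        then show ?thesis using True by simp
      next
        case False
        then consider "x < a" | "x > b" by fastforce
        then have "\<forall>\<^sub>F n in sequentially. x \<notin> ?I n"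
        proof cases
          case 1
          have "\<forall>\<^sub>F n in sequentially. 1 / real (Suc n) < a - x"
            by (rule order_tendstoD(2)[OF inf0]) (use 1 in simp)
          then show ?thesis
          proof eventually_elim
            case (elim n) then show ?case using p(1)[of n] by auto
          qed
        next
          case 2
          have "\<forall>\<^sub>F n in sequentially. 1 / real (Suc n) < x - b"
            by (rule order_tendstoD(2)[OF inf0]) (use 2 in simp)
          then show ?thesis
          proof eventually_elim
            case (elim n) then show ?case using q(2)[of n] by auto
          qed
        qed
        then have "\<forall>\<^sub>F n in sequentially. indicator {a..b} x = (indicator (?I n) x :: real)"
          using False by (auto elim!: eventually_mono)
        then show ?thesis by (rule Lim_transform_eventually[OF tendsto_const])
      qed
    qed
    show "AE x in lebesgue. norm (indicator (?I n) x *\<^sub>R f x) \<le> norm (indicator {a-1..b+1} x * f x)" for n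
    proof (rule AE_I2)
      fix x
      have "1 / real (Suc n) \<le> 1" by (simp del: of_nat_Suc)
      then have "x \<in> ?I n \<Longrightarrow> x \<in> {a-1..b+1}" using p(1)[of n] q(2)[of n] unfolding atLeastAtMost_iff by linarith
      then show "norm (indicator (?I n) x *\<^sub>R f x) \<le> norm (indicator {a-1..b+1} x * f x)"
        by (auto simp: indicator_def)
    qed
  qed (auto intro!: borel_measurable_scaleR borel_measurable_indicator)
  moreover have "(LINT x|lebesgue. indicator (?I n) x *\<^sub>R f x) = 0" for n
    using zero[of "p n" "q n"] unfolding l2_inner_def
    by (subst (asm) Bochner_Integration.integral_cong[OF refl, of _ _ "\<lambda>x. indicator (?I n) x *\<^sub>R f x"])
       (auto simp: indicator_def)
  ultimately show ?thesis unfolding set_lebesgue_integral_def by (simp add: LIMSEQ_const_iff)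
qed

text \<open>A function in \<open>L2\<close> need not be integrable on the line, hence the cut-off to
  bounded intervals.\<close>

lemma L2_AE_zero_of_rational_Icc:
  assumes f: "f \<in> L2" and zero: "\<And>p q :: rat. l2_inner (indicator {real_of_rat p..real_of_rat q}) f = 0"
  shows "AE x in lebesgue. f x = 0"
proof -
  have "AE x in lebesgue. indicator {-real n..real n} x * f x = 0" for n
  proof (rule AE_zero_of_Icc_integrals)
    show "integrable lebesgue (\<lambda>x. indicator {- real n..real n} x * f x)"
      by (intro L2_mult_integrable f L2_indicator_Icc)
    fix a b
    have "(LINT x:{a..b}|lebesgue. indicator {- real n..real n} x * f x) = (LINT x:{max a (-real n)..min b (real n)}|lebesgue. f x)"
      unfolding set_lebesgue_integral_def by (intro Bochner_Integration.integral_cong) (auto simp: indicator_def)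
    also have "\<dots> = 0" by (rule rational_Icc_integrals_zero[OF assms])
    finally show "(LINT x:{a..b}|lebesgue. indicator {- real n..real n} x * f x) = 0" .
  qed
  then have "AE x in lebesgue. \<forall>n. indicator {-real n..real n} x * f x = 0"
    by (subst AE_all_countable) (rule allI)
  then show ?thesis
  proof eventually_elim
    fix x assume h: "\<forall>n. indicator {-real n..real n} x * f x = 0"
    obtain n where "\<bar>x\<bar> \<le> real n" using real_arch_simple by blast
    then have "indicator {-real n..real n} x = (1::complex)" by (auto simp: indicator_def)
    then show "f x = 0" using h by (metis mult_1)
  qed
qed

text \<open>By Bessel's inequality each rational indicator has a nonzero coefficient at only
  countably many members, and each member has a nonzero coefficient with some rational
  indicator.\<close>

lemma l2_orthonormal_countable:
  assumes S: "l2_orthonormal S"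
  shows "countable S"
proof -
  let ?h = "\<lambda>pq :: rat \<times> rat. (indicator {real_of_rat (fst pq)..real_of_rat (snd pq)} :: real \<Rightarrow> complex)"
  have hL: "?h pq \<in> L2" for pq using L2_indicator_Icc by simp
  have "countable {e \<in> S. (norm (l2_inner e (?h pq)))\<^sup>2 \<noteq> 0}" for pq
  proof (rule summable_countable_real, rule nonneg_bdd_above_summable_on)
    show "bdd_above (sum (\<lambda>e. (norm (l2_inner e (?h pq)))\<^sup>2) ` {F. F \<subseteq> S \<and> finite F})"
    proof (rule bdd_aboveI, clarsimp)
      fix F assume F: "F \<subseteq> S" "finite F"
      show "(\<Sum>e\<in>F. (norm (l2_inner e (?h pq)))\<^sup>2) \<le> (l2_norm (?h pq))\<^sup>2"
        using l2_Bessel[OF F(2), of "\<lambda>e. e" "?h pq"] S F(1) hL unfolding l2_orthonormal_def by (auto simp: subset_iff)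
    qed
  qed auto
  then have "countable (\<Union>pq. {e \<in> S. (norm (l2_inner e (?h pq)))\<^sup>2 \<noteq> 0})" by auto
  moreover have "S \<subseteq> (\<Union>pq. {e \<in> S. (norm (l2_inner e (?h pq)))\<^sup>2 \<noteq> 0})"
  proof
    fix e assume e: "e \<in> S"
    then have eL: "e \<in> L2" and e1: "l2_inner e e = 1" using S by (auto simp: l2_orthonormal_def)
    show "e \<in> (\<Union>pq. {e \<in> S. (norm (l2_inner e (?h pq)))\<^sup>2 \<noteq> 0})"
    proof (rule ccontr)
      assume "e \<notin> (\<Union>pq. {e \<in> S. (norm (l2_inner e (?h pq)))\<^sup>2 \<noteq> 0})"
      then have z: "l2_inner e (?h pq) = 0" for pq using e by auto
      have "l2_inner (?h pq) e = 0" for pq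
        using arg_cong[OF z[of pq], of cnj] unfolding l2_inner_cnj by simp
      from this[of "(p, q)" for p q] have "AE x in lebesgue. e x = 0"
        by (intro L2_AE_zero_of_rational_Icc eL) simp
      then have "l2_inner e e = l2_inner e (\<lambda>x. 0)" by (intro l2_inner_cong_AE eL L2_zero) auto
      then show False using e1 by (simp add: l2_inner_zero_right)
    qed
  qed
  ultimately show ?thesis by (rule countable_subset[rotated])
qed

text \<open>Without a basis the condition in \<open>trace_ext\<close> would hold vacuously for every
  number, and no operator would be \<open>hilbert_schmidt\<close>.\<close>

theorem l2_onb_exists: "\<exists>e. l2_onb e"
proof -
  \<comment> \<open>Indicators of disjoint unit intervals form an infinite orthonormal family. Every
    set to which Zorn's lemma is applied contains it, so the maximal one is infinite and can be
    enumerated by all natural numbers without repetition.\<close>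
  define h :: "nat \<Rightarrow> real \<Rightarrow> complex" where "h m = indicator {real m..<real m + 1}" for m
  have hL: "h m \<in> L2" for m unfolding h_def by (rule L2_indicator) auto
  have hh: "l2_inner (h m) (h n) = (if m = n then 1 else 0)" for m n
  proof (cases "m = n")
    case True
    have "l2_inner (h n) (h n) = (LINT x|lebesgue. indicator {real n..<real n + 1} x *\<^sub>R (1::complex))"
      unfolding l2_inner_def h_def by (rule Bochner_Integration.integral_cong) (auto simp: indicator_def)
    then show ?thesis using True by simp
  next
    case False
    then have "real m + 1 \<le> real n \<or> real n + 1 \<le> real m" by (cases m n rule: linorder_cases) auto
    then have "l2_inner (h m) (h n) = (LINT x|lebesgue. 0)"
      unfolding l2_inner_def h_def by (subst Bochner_Integration.integral_cong[OF refl, of _ _ "\<lambda>x. 0"]) (auto simp: indicator_def)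
    then show ?thesis using False by simp
  qed
  have injh: "inj h"
  proof (rule injI)
    fix m n assume "h m = h n"
    then have "l2_inner (h m) (h n) = 1" using hh[of m m] by simp
    then show "m = n" using hh[of m n] by (auto split: if_splits)
  qed
  have h_on: "l2_orthonormal (range h)"
    unfolding l2_orthonormal_def using hL hh injh by (auto simp: inj_eq)
  define \<A> where "\<A> = {S. l2_orthonormal S \<and> range h \<subseteq> S}"
  have "\<exists>M\<in>\<A>. \<forall>X\<in>\<A>. M \<subseteq> X \<longrightarrow> X = M"
  proof (rule subset_Zorn_nonempty)
    show "\<A> \<noteq> {}" using h_on by (auto simp: \<A>_def)
    fix C assume C: "C \<noteq> {}" "subset.chain \<A> C"
    have CA: "C \<subseteq> \<A>" and ch: "\<And>X Y. X \<in> C \<Longrightarrow> Y \<in> C \<Longrightarrow> X \<subseteq> Y \<or> Y \<subseteq> X"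
      using C(2) by (auto simp: subset.chain_def)
    have "l2_orthonormal (\<Union>C)"
      unfolding l2_orthonormal_def
    proof (intro conjI ballI)
      fix f assume "f \<in> \<Union>C" then show "f \<in> L2" using CA by (auto simp: \<A>_def l2_orthonormal_def)
    next
      fix f g assume "f \<in> \<Union>C" "g \<in> \<Union>C"
      then obtain X Y where XY: "X \<in> C" "f \<in> X" "Y \<in> C" "g \<in> Y" by auto
      from ch[OF XY(1,3)] XY obtain Z where Z: "Z \<in> C" "f \<in> Z" "g \<in> Z" by auto
      then have "l2_orthonormal Z" using CA by (auto simp: \<A>_def)
      then show "l2_inner f g = (if f = g then 1 else 0)" using Z by (auto simp: l2_orthonormal_def)
    qed
    moreover have "range h \<subseteq> \<Union>C" using C(1) CA by (auto simp: \<A>_def)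
    ultimately show "\<Union>C \<in> \<A>" by (simp add: \<A>_def)
  qed
  then obtain S where S: "l2_orthonormal S" "range h \<subseteq> S"
    and max: "\<And>X. l2_orthonormal X \<Longrightarrow> range h \<subseteq> X \<Longrightarrow> S \<subseteq> X \<Longrightarrow> X = S"
    by (auto simp: \<A>_def)
  have total: "AE x in lebesgue. f x = 0" if f: "f \<in> L2" and perp: "\<And>e. e \<in> S \<Longrightarrow> l2_inner e f = 0" for f
  proof (rule ccontr)
    assume n0: "\<not> (AE x in lebesgue. f x = 0)"
    then have nf: "l2_norm f \<noteq> 0" using l2_norm_eq_0[OF f] by auto
    define g where "g x = complex_of_real (1 / l2_norm f) * f x" for x
    have gL: "g \<in> L2" unfolding g_def by (intro L2_scale f)
    have eg: "l2_inner e g = 0" if "e \<in> S" for e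
      unfolding g_def l2_inner_scale_right using perp[OF that] by simp
    have ge: "l2_inner g e = 0" if "e \<in> S" for e
      using arg_cong[OF eg[OF that], of cnj] by (simp add: l2_inner_cnj)
    have "l2_inner g f = complex_of_real (1 / l2_norm f) * l2_inner f f"
      using arg_cong[OF l2_inner_scale_right[of f "complex_of_real (1 / l2_norm f)" f], of cnj]
      unfolding g_def by (simp add: l2_inner_cnj)
    then have gg: "l2_inner g g = 1"
      unfolding g_def l2_inner_scale_right using nf by (simp add: l2_inner_self power2_eq_square flip: g_def)
    have "l2_orthonormal (insert g S)"
      using S(1) gL eg ge gg unfolding l2_orthonormal_def by auto
    then have "insert g S = S" using S(2) by (intro max) auto
    then have "l2_inner g g = 0" using eg by blast
    then show False using gg by simp
  qed
  have "countable S" by (rule l2_orthonormal_countable[OF S(1)])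
  moreover have "infinite S" using S(2) injh by (meson finite_subset range_inj_infinite)
  ultimately have bij: "bij_betw (from_nat_into S) UNIV S" by (rule bij_betw_from_nat_into)
  have "l2_onb (from_nat_into S)"
    unfolding l2_onb_def
  proof (intro conjI allI ballI impI)
    have in_S: "from_nat_into S i \<in> S" for i using bij by (auto simp: bij_betw_def)
    show "from_nat_into S i \<in> L2" for i using in_S S(1) by (auto simp: l2_orthonormal_def)
    show "l2_inner (from_nat_into S i) (from_nat_into S j) = (if i = j then 1 else 0)" for i j
      using in_S S(1) bij by (auto simp: l2_orthonormal_def bij_betw_def inj_eq)
    show "AE x in lebesgue. f x = 0" if "f \<in> L2" "\<forall>i. l2_inner (from_nat_into S i) f = 0" for f
    proof (rule total[OF that(1)])
      fix e assume "e \<in> S"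
      then obtain i where "e = from_nat_into S i" using bij by (auto simp: bij_betw_def)
      then show "l2_inner e f = 0" using that(2) by simp
    qed
  qed
  then show ?thesis by blast
qed

section \<open>Symmetric integrands and sorted points\<close>

text \<open>The relation is a parameter because indices are sorted increasingly and points
  decreasingly.\<close>

definition sorted_fun :: "('a \<Rightarrow> 'a \<Rightarrow> bool) \<Rightarrow> nat \<Rightarrow> (nat \<Rightarrow> 'a) \<Rightarrow> bool" where
  "sorted_fun R n z \<longleftrightarrow> (\<forall>a b. a < b \<longrightarrow> b < n \<longrightarrow> R (z a) (z b))"

text \<open>The rank \<open>r a\<close>, the number of entries before \<open>z a\<close>, is a
  permutation of the positions, and its inverse sorts. Conversely, if \<open>p\<close> sorts, the
  entries before \<open>z (p a)\<close> are those at \<open>p 0, ..., p (a - 1)\<close>, so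
  \<open>r (p a) = a\<close> and \<open>p\<close> is that inverse.\<close>

lemma ex1_sorting_permutation:
  assumes irrefl: "\<And>x. \<not> R x x" and trans: "\<And>x y w. R x y \<Longrightarrow> R y w \<Longrightarrow> R x w"
    and total: "\<And>x y. x \<noteq> y \<Longrightarrow> R x y \<or> R y x" and inj: "inj_on z {0..<n}"
  shows "\<exists>!p. p permutes {0..<n} \<and> sorted_fun R n (z \<circ> p)"
proof -
  define r where "r a = card {b\<in>{0..<n}. R (z b) (z a)}" for a
  have r_lt: "r a < r b" if "R (z a) (z b)" "a < n" for a b
    unfolding r_def
  proof (rule psubset_card_mono)
    have "a \<in> {c \<in> {0..<n}. R (z c) (z b)} - {c \<in> {0..<n}. R (z c) (z a)}"
      using that irrefl by auto
    moreover have "{c \<in> {0..<n}. R (z c) (z a)} \<subseteq> {c \<in> {0..<n}. R (z c) (z b)}"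
      using that trans by auto
    ultimately show "{c \<in> {0..<n}. R (z c) (z a)} \<subset> {c \<in> {0..<n}. R (z c) (z b)}" by blast
  qed simp
  have r_iff: "R (z a) (z b)" if "r a < r b" "a < n" "b < n" for a b
  proof (rule ccontr)
    assume "\<not> R (z a) (z b)"
    then have "R (z b) (z a) \<or> z a = z b" using total by blast
    then show False using r_lt[of b a] that by (auto simp: r_def)
  qed
  define \<rho> where "\<rho> a = (if a < n then r a else a)" for a
  have inj_r: "inj_on r {0..<n}"
  proof (rule inj_onI)
    fix a b assume ab: "a \<in> {0..<n}" "b \<in> {0..<n}" "r a = r b"
    then have "\<not> R (z a) (z b)" "\<not> R (z b) (z a)" using r_lt[of a b] r_lt[of b a] by auto
    then have "z a = z b" using total by blast
    then show "a = b" using inj ab by (auto dest: inj_onD)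
  qed
  have r_bound: "r a < n" if "a < n" for a
  proof -
    have "r a < card {0..<n}" unfolding r_def
    proof (rule psubset_card_mono)
      have "a \<in> {0..<n} - {c \<in> {0..<n}. R (z c) (z a)}" using that irrefl by auto
      then show "{c \<in> {0..<n}. R (z c) (z a)} \<subset> {0..<n}" by blast
    qed simp
    then show ?thesis by simp
  qed
  have "bij_betw r {0..<n} {0..<n}"
    unfolding bij_betw_def using inj_r by (intro conjI endo_inj_surj) (auto simp: r_bound)
  then have "bij_betw \<rho> {0..<n} {0..<n}"
    by (rule bij_betw_cong[THEN iffD1, rotated]) (auto simp: \<rho>_def)
  then have perm: "\<rho> permutes {0..<n}" by (rule bij_imp_permutes) (auto simp: \<rho>_def)
  show ?thesis
  proof (rule ex1I[of _ "inv_into UNIV \<rho>"], intro conjI)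
    show ip: "inv_into UNIV \<rho> permutes {0..<n}" by (rule permutes_inv[OF perm])
    show "sorted_fun R n (z \<circ> inv_into UNIV \<rho>)" unfolding sorted_fun_def
    proof (intro allI impI)
      fix a b assume ab: "a < b" "b < n"
      have ra: "r (inv_into UNIV \<rho> a) = a" "inv_into UNIV \<rho> a < n" if "a < n" for a
      proof -
        show *: "inv_into UNIV \<rho> a < n" using permutes_in_image[OF ip, of a] that by simp
        have "\<rho> (inv_into UNIV \<rho> a) = a" using permutes_inverses(1)[OF perm] by simp
        then show "r (inv_into UNIV \<rho> a) = a" using * by (simp add: \<rho>_def)
      qed
      show "R ((z \<circ> inv_into UNIV \<rho>) a) ((z \<circ> inv_into UNIV \<rho>) b)"
        using r_iff[of "inv_into UNIV \<rho> a" "inv_into UNIV \<rho> b"] ra[of a] ra[of b] ab by auto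
    qed
  next
    fix p assume p: "p permutes {0..<n} \<and> sorted_fun R n (z \<circ> p)"
    then have pp: "p permutes {0..<n}" and ps: "\<And>a b. a < b \<Longrightarrow> b < n \<Longrightarrow> R (z (p a)) (z (p b))"
      by (auto simp: sorted_fun_def)
    have pn: "p a < n" if "a < n" for a using permutes_in_image[OF pp, of a] that by simp
    have "r (p a) = a" if a: "a < n" for a
    proof -
      have "{b\<in>{0..<n}. R (z b) (z (p a))} = p ` {0..<a}"
      proof (intro equalityI subsetI)
        fix b assume b: "b \<in> {b\<in>{0..<n}. R (z b) (z (p a))}"
        then obtain c where c: "c < n" "b = p c"
          using permutes_image[OF pp] by (metis (no_types, lifting) atLeastLessThan_iff imageE mem_Collect_eq)
        then have "c < a" using b ps[of a c] irrefl trans by (cases c a rule: linorder_cases) auto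
        then show "b \<in> p ` {0..<a}" using c by auto
      qed (use a pn ps in auto)
      then show ?thesis unfolding r_def by (simp add: card_image inj_on_subset[OF permutes_inj[OF pp]])
    qed
    then have "\<rho> (p a) = a" for a
      using pn permutes_not_in[OF pp, of a] by (cases "a < n") (auto simp: \<rho>_def)
    then show "p = inv_into UNIV \<rho>"
      using permutes_inverses(2)[OF perm] by (metis ext)
  qed
qed

lemma distr_PiM_permute:
  assumes "sigma_finite_measure M" and p: "p permutes I" and "finite I"
  shows "(\<lambda>z. z \<circ> p) \<in> measurable (PiM I (\<lambda>_. M)) (PiM I (\<lambda>_. M))"
    and "distr (PiM I (\<lambda>_. M)) (PiM I (\<lambda>_. M)) (\<lambda>z. z \<circ> p) = PiM I (\<lambda>_. M)"
proof -
  interpret sigma_finite_measure M by fact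
  interpret product_sigma_finite "\<lambda>_. M" ..
  let ?P = "PiM I (\<lambda>_. M)"
  have pin: "p i \<in> I \<longleftrightarrow> i \<in> I" for i using permutes_in_image[OF p] .
  \<comment> \<open>Points of the product space are extensional and \<open>p\<close> fixes
    everything outside \<open>I\<close>, so composition with \<open>p\<close> stays in the
    space.\<close>
  have comp: "z \<circ> p = (\<lambda>i\<in>I. z (p i))" if "z \<in> space ?P" for z
  proof
    fix i show "(z \<circ> p) i = (\<lambda>i\<in>I. z (p i)) i"
      using that permutes_not_in[OF p] by (cases "i \<in> I") (auto simp: space_PiM PiE_def extensional_def)
  qed
  have "(\<lambda>z. \<lambda>i\<in>I. z (p i)) \<in> measurable ?P ?P"
    by (rule measurable_restrict) (auto simp: pin intro!: measurable_component_singleton)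
  then show m: "(\<lambda>z. z \<circ> p) \<in> measurable ?P ?P"
    by (rule measurable_cong[THEN iffD2, rotated]) (rule comp)
  show "distr ?P ?P (\<lambda>z. z \<circ> p) = ?P"
  proof (rule PiM_eqI)
    fix A assume A: "\<And>i. i \<in> I \<Longrightarrow> A i \<in> sets M"
    have ip: "inv_into UNIV p permutes I" by (rule permutes_inv[OF p])
    have ipin: "inv_into UNIV p i \<in> I \<longleftrightarrow> i \<in> I" for i using permutes_in_image[OF ip] .
    have pip: "p (inv_into UNIV p i) = i" "inv_into UNIV p (p i) = i" for i using permutes_inverses[OF p] by auto
    have "(\<lambda>z. z \<circ> p) -` Pi\<^sub>E I A \<inter> space ?P = Pi\<^sub>E I (\<lambda>i. A (inv_into UNIV p i))"
    proof (intro equalityI subsetI)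
      fix z assume z: "z \<in> (\<lambda>z. z \<circ> p) -` Pi\<^sub>E I A \<inter> space ?P"
      then have "z (p j) \<in> A j" if "j \<in> I" for j using that by (auto simp: PiE_def Pi_def)
      then have "z i \<in> A (inv_into UNIV p i)" if "i \<in> I" for i
        using that ipin[of i] pip(1)[of i] by metis
      then show "z \<in> Pi\<^sub>E I (\<lambda>i. A (inv_into UNIV p i))" using z by (auto simp: space_PiM PiE_def)
    next
      fix z assume z: "z \<in> Pi\<^sub>E I (\<lambda>i. A (inv_into UNIV p i))"
      have "z i \<in> space M" if "i \<in> I" for i
        using z that sets.sets_into_space[OF A[of "inv_into UNIV p i"]] ipin[of i] by (auto simp: PiE_def Pi_def)
      then have zs: "z \<in> space ?P" using z by (auto simp: space_PiM PiE_def)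
      have "(z \<circ> p) i \<in> A i" if "i \<in> I" for i
      proof -
        have "z (p i) \<in> A (inv_into UNIV p (p i))" using z that pin[of i] by (auto simp: PiE_def Pi_def)
        then show ?thesis by (simp add: pip)
      qed
      then have "z \<circ> p \<in> Pi\<^sub>E I A" unfolding comp[OF zs] by auto
      then show "z \<in> (\<lambda>z. z \<circ> p) -` Pi\<^sub>E I A \<inter> space ?P" using zs by auto
    qed
    then have "emeasure (distr ?P ?P (\<lambda>z. z \<circ> p)) (Pi\<^sub>E I A) = emeasure ?P (Pi\<^sub>E I (\<lambda>i. A (inv_into UNIV p i)))"
      using A \<open>finite I\<close> by (subst emeasure_distr[OF m]) (auto intro!: sets_PiM_I_finite)
    also have "\<dots> = (\<Prod>i\<in>I. emeasure M (A (inv_into UNIV p i)))"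
      using A \<open>finite I\<close> ipin by (intro emeasure_PiM) auto
    also have "\<dots> = (\<Prod>i\<in>I. emeasure M (A i))"
      using prod.permute[OF ip, of "\<lambda>i. emeasure M (A i)"] by (simp add: o_def)
    finally show "emeasure (distr ?P ?P (\<lambda>z. z \<circ> p)) (Pi\<^sub>E I A) = (\<Prod>i\<in>I. emeasure M (A i))" .
  qed (auto simp: \<open>finite I\<close>)
qed

text \<open>\<open>f\<close> is the sum over all permutations of its sorted part, of which a single
  term is nonzero, and all terms have the same integral. Tuples with a repeated entry cannot be
  sorted strictly; the hypothesis \<open>zero\<close> takes care of them, which matters for the
  counting measure, where they are not a null set.\<close>

lemma integral_symmetric_eq_sorted:
  fixes f :: "(nat \<Rightarrow> 'a) \<Rightarrow> complex" and n :: nat and M :: "'a measure"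
  defines "P \<equiv> PiM {0..<n} (\<lambda>_. M)"
  assumes sf: "sigma_finite_measure M"
    and irrefl: "\<And>x. \<not> R x x" and trans: "\<And>x y w. R x y \<Longrightarrow> R y w \<Longrightarrow> R x w"
    and total: "\<And>x y. x \<noteq> y \<Longrightarrow> R x y \<or> R y x"
    and meas: "{z \<in> space P. sorted_fun R n z} \<in> sets P"
    and int: "integrable P f"
    and sym: "\<And>p z. p permutes {0..<n} \<Longrightarrow> z \<in> space P \<Longrightarrow> f (z \<circ> p) = f z"
    and zero: "\<And>z. z \<in> space P \<Longrightarrow> \<not> inj_on z {0..<n} \<Longrightarrow> f z = 0"
  shows "integrable P (\<lambda>z. if sorted_fun R n z then f z else 0)"
    and "(LINT z|P. f z) = fact n * (LINT z|P. (if sorted_fun R n z then f z else 0))"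
proof -
  let ?g = "\<lambda>z. if sorted_fun R n z then f z else 0"
  let ?Q = "{p. p permutes {0..<n}}"
  have "integrable P (\<lambda>z. indicator {z \<in> space P. sorted_fun R n z} z *\<^sub>R f z)"
    by (rule integrable_mult_indicator[OF meas int])
  then show gi: "integrable P ?g"
    by (rule Bochner_Integration.integrable_cong[THEN iffD1, rotated 2]) (auto simp: indicator_def)
  have dm: "(\<lambda>z. z \<circ> p) \<in> measurable P P" and dd: "distr P P (\<lambda>z. z \<circ> p) = P" if "p \<in> ?Q" for p
    using distr_PiM_permute[OF sf, of p "{0..<n}"] that unfolding P_def by auto
  have "f z = (\<Sum>p\<in>?Q. ?g (z \<circ> p))" if z: "z \<in> space P" for z
  proof (cases "inj_on z {0..<n}")
    case True
    have "\<exists>!p. p permutes {0..<n} \<and> sorted_fun R n (z \<circ> p)"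
    proof (rule ex1_sorting_permutation)
      show "\<And>x. \<not> R x x" by (rule irrefl)
      show "\<And>x y w. R x y \<Longrightarrow> R y w \<Longrightarrow> R x w" by (rule trans)
      show "\<And>x y. x \<noteq> y \<Longrightarrow> R x y \<or> R y x" by (rule total)
    qed (rule True)
    then obtain p0 where p0: "p0 permutes {0..<n}" "sorted_fun R n (z \<circ> p0)"
      and u: "\<And>p. p permutes {0..<n} \<Longrightarrow> sorted_fun R n (z \<circ> p) \<Longrightarrow> p = p0" by blast
    have "(\<Sum>p\<in>?Q. ?g (z \<circ> p)) = (\<Sum>p\<in>?Q. if p = p0 then f z else 0)"
    proof (rule sum.cong[OF refl])
      fix p assume p: "p \<in> ?Q"
      show "?g (z \<circ> p) = (if p = p0 then f z else 0)"
      proof (cases "p = p0")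
        case True
        then show ?thesis using p0 sym[OF p0(1) z] by simp
      next
        case False
        then have "\<not> sorted_fun R n (z \<circ> p)" using u[of p] p by blast
        then show ?thesis using False by simp
      qed
    qed
    also have "\<dots> = f z" using p0 by (simp add: finite_permutations)
    finally show ?thesis by simp
  next
    case False
    then have "f z = 0" by (rule zero[OF z])
    moreover have "f (z \<circ> p) = 0" if "p \<in> ?Q" for p using sym[of p z] that z calculation by simp
    ultimately show ?thesis by (simp add: sum.neutral)
  qed
  then have "(LINT z|P. f z) = (LINT z|P. (\<Sum>p\<in>?Q. ?g (z \<circ> p)))"
    by (rule Bochner_Integration.integral_cong[OF refl])
  also have "\<dots> = (\<Sum>p\<in>?Q. LINT z|P. ?g (z \<circ> p))"
  proof (rule Bochner_Integration.integral_sum)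
    fix p assume p: "p \<in> ?Q"
    show "integrable P (\<lambda>z. ?g (z \<circ> p))"
      by (rule integrable_distr[OF dm[OF p], of ?g]) (simp only: dd[OF p] gi)
  qed
  also have "\<dots> = (\<Sum>p\<in>?Q. LINT z|P. ?g z)"
  proof (rule sum.cong[OF refl])
    fix p assume p: "p \<in> ?Q"
    have "(LINT z|(distr P P (\<lambda>z. z \<circ> p)). ?g z) = (LINT z|P. ?g (z \<circ> p))"
      by (rule integral_distr[OF dm[OF p]]) (use gi in \<open>rule borel_measurable_integrable\<close>)
    then show "(LINT z|P. ?g (z \<circ> p)) = (LINT z|P. ?g z)" unfolding dd[OF p] by simp
  qed
  also have "\<dots> = fact n * (LINT z|P. ?g z)"
    by (simp add: card_permutations[OF _ finite_atLeastLessThan])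
  finally show "(LINT z|P. f z) = fact n * (LINT z|P. ?g z)" .
qed

section \<open>Andreief's identity\<close>

text \<open>Sums over tuples of indices are treated as integrals for a product of counting measures,
  so that the same product and Fubini theorems apply to indices and points.\<close>

abbreviation (input) nat_seqs :: "nat \<Rightarrow> (nat \<Rightarrow> nat) measure" where
  "nat_seqs n \<equiv> PiM {0..<n} (\<lambda>_. count_space UNIV)"

lemma nat_seqs_eq: "nat_seqs n = count_space ({0..<n} \<rightarrow>\<^sub>E UNIV)"
  by (rule count_space_PiM_finite) auto

lemma product_sigma_finite_const: "sigma_finite_measure M \<Longrightarrow> product_sigma_finite (\<lambda>_. M)"
  by (simp add: product_sigma_finite_def)

lemma sigma_finite_count_nat: "sigma_finite_measure (count_space (UNIV :: nat set))"
  by (rule sigma_finite_measure_count_space_countable) simp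

lemma pair_sigma_finite_seqs:
  assumes "sigma_finite_measure M"
  shows "pair_sigma_finite (nat_seqs n) (PiM {0..<n} (\<lambda>_. M))"
proof -
  interpret X: product_sigma_finite "\<lambda>_::nat. count_space (UNIV :: nat set)"
    by (rule product_sigma_finite_const[OF sigma_finite_count_nat])
  interpret Y: product_sigma_finite "\<lambda>_::nat. M"
    by (rule product_sigma_finite_const[OF assms])
  interpret X: finite_product_sigma_finite "\<lambda>_::nat. count_space (UNIV :: nat set)" "{0..<n}" by standard auto
  interpret Y: finite_product_sigma_finite "\<lambda>_::nat. M" "{0..<n}" by standard auto
  show ?thesis ..
qed

text \<open>The first factor is countable and discrete, so measurability of each section
  suffices.\<close>

lemma measurable_seqs_pair:
  assumes "\<And>js. (\<lambda>y. f (js, y)) \<in> measurable N K"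
  shows "f \<in> measurable (nat_seqs n \<Otimes>\<^sub>M N) K"
  unfolding nat_seqs_eq by (rule measurable_pair_measure_countable1) (auto intro!: countable_PiE assms)

lemma prod_permute:
  assumes "p permutes I"
  shows "(\<Prod>i\<in>I. f (p i)) = (\<Prod>i\<in>I. f i)"
  using prod.permute[OF assms, of f] by (simp add: o_def)

text \<open>Provides the majorants for \<open>permutation_term\<close>. For fixed indices the
  integral over the points factors; the permutation only reorders these factors, and the sum over
  the indices then factors as well.\<close>

lemma integrable_seqs_prod:
  fixes \<gamma> :: "nat \<Rightarrow> 'b \<Rightarrow> real"
  assumes sf: "sigma_finite_measure M" and int: "\<And>i. integrable M (\<gamma> i)"
    and nonneg: "\<And>i y. \<gamma> i y \<ge> 0" and summ: "summable (\<lambda>i. LINT y|M. \<gamma> i y)"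
    and p: "p permutes {0..<n}"
  shows "integrable (nat_seqs n \<Otimes>\<^sub>M PiM {0..<n} (\<lambda>_. M)) (\<lambda>(js, y). \<Prod>a\<in>{0..<n}. \<gamma> (js (p a)) (y a))"
proof -
  interpret X: product_sigma_finite "\<lambda>_::nat. count_space (UNIV :: nat set)"
    by (rule product_sigma_finite_const[OF sigma_finite_count_nat])
  interpret Y: product_sigma_finite "\<lambda>_::nat. M"
    by (rule product_sigma_finite_const[OF sf])
  interpret pair_sigma_finite "nat_seqs n" "PiM {0..<n} (\<lambda>_. M)"
    by (rule pair_sigma_finite_seqs[OF sf])
  have [measurable]: "\<gamma> i \<in> borel_measurable M" for i using int by auto
  have sec: "integrable (PiM {0..<n} (\<lambda>_. M)) (\<lambda>y. \<Prod>a\<in>{0..<n}. \<gamma> (js (p a)) (y a))" for js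
    by (rule Y.product_integrable_prod) (auto intro: int)
  show ?thesis
  proof (rule Fubini_integrable)
    show "(\<lambda>(js, y). \<Prod>a\<in>{0..<n}. \<gamma> (js (p a)) (y a)) \<in> borel_measurable (nat_seqs n \<Otimes>\<^sub>M PiM {0..<n} (\<lambda>_. M))"
      by (rule measurable_seqs_pair) (use sec in auto)
    show "AE js in nat_seqs n. integrable (PiM {0..<n} (\<lambda>_. M)) (\<lambda>y. case (js, y) of (js, y) \<Rightarrow> \<Prod>a\<in>{0..<n}. \<gamma> (js (p a)) (y a))"
      using sec by simp
    have "(LINT y|PiM {0..<n} (\<lambda>_. M). norm (\<Prod>a\<in>{0..<n}. \<gamma> (js (p a)) (y a))) = (\<Prod>a\<in>{0..<n}. LINT y|M. \<gamma> (js a) y)" for js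
    proof -
      have "(LINT y|PiM {0..<n} (\<lambda>_. M). norm (\<Prod>a\<in>{0..<n}. \<gamma> (js (p a)) (y a)))
          = (LINT y|PiM {0..<n} (\<lambda>_. M). (\<Prod>a\<in>{0..<n}. \<gamma> (js (p a)) (y a)))"
        by (rule Bochner_Integration.integral_cong) (auto simp: prod_nonneg nonneg)
      also have "\<dots> = (\<Prod>a\<in>{0..<n}. LINT y|M. \<gamma> (js (p a)) y)"
        by (rule Y.product_integral_prod) (auto intro: int)
      also have "\<dots> = (\<Prod>a\<in>{0..<n}. LINT y|M. \<gamma> (js a) y)"
        by (rule prod_permute[OF p, of "\<lambda>b. LINT y|M. \<gamma> (js b) y"])
      finally show ?thesis .
    qed
    moreover have "integrable (nat_seqs n) (\<lambda>js. \<Prod>a\<in>{0..<n}. LINT y|M. \<gamma> (js a) y)"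
    proof (rule X.product_integrable_prod)
      show "integrable (count_space UNIV) (\<lambda>i. LINT y|M. \<gamma> i y)" for a :: nat
        using summ nonneg by (simp add: integrable_count_space_nat_iff)
    qed simp
    ultimately show "integrable (nat_seqs n) (\<lambda>js. LINT y|PiM {0..<n} (\<lambda>_. M). norm (case (js, y) of (js, y) \<Rightarrow> \<Prod>a\<in>{0..<n}. \<gamma> (js (p a)) (y a)))"
      by simp
  qed
qed

text \<open>Meant for a product \<open>A B\<close> and a basis \<open>e\<close>:
  \<open>\<alpha> i y\<close> is the inner product of \<open>e i\<close> with the section at
  \<open>y\<close> of the kernel of \<open>A\<close>, and \<open>\<beta> i\<close> is
  \<open>B (e i)\<close>. Then \<open>T\<close> is the matrix of \<open>A B\<close> in the basis and
  \<open>N\<close> is the kernel of \<open>B A\<close>. The assumption \<open>summ\<close> is made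
  at every pair of points, so \<open>N\<close> also has definite values on the diagonal.\<close>

locale andreief =
  fixes M :: "'b measure" and \<alpha> \<beta> :: "nat \<Rightarrow> 'b \<Rightarrow> complex"
  assumes sf: "sigma_finite_measure M"
    and meas [measurable]: "\<And>i. \<alpha> i \<in> borel_measurable M" "\<And>i. \<beta> i \<in> borel_measurable M"
    and int2: "\<And>i. integrable M (\<lambda>y. (norm (\<alpha> i y))\<^sup>2)" "\<And>i. integrable M (\<lambda>y. (norm (\<beta> i y))\<^sup>2)"
    and summ2: "summable (\<lambda>i. LINT y|M. (norm (\<alpha> i y))\<^sup>2)" "summable (\<lambda>i. LINT y|M. (norm (\<beta> i y))\<^sup>2)"
    and summ: "\<And>y y'. summable (\<lambda>i. norm (\<alpha> i y * \<beta> i y'))"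
begin

definition T :: "nat \<Rightarrow> nat \<Rightarrow> complex" where "T i j = (LINT y|M. \<alpha> i y * \<beta> j y)"
definition N :: "'b \<Rightarrow> 'b \<Rightarrow> complex" where "N y y' = (\<Sum>i. \<alpha> i y * \<beta> i y')"

abbreviation (input) PY :: "nat \<Rightarrow> (nat \<Rightarrow> 'b) measure" where "PY n \<equiv> PiM {0..<n} (\<lambda>_. M)"

text \<open>The two sides are the iterated integrals of the single function \<open>?F\<close> of
  indices and points: integrating over the points first produces the factors \<open>T\<close>,
  summing over the indices first produces the factors \<open>N\<close>.\<close>

lemma permutation_term:
  assumes p: "p permutes {0..<n}"
  shows "integrable (nat_seqs n) (\<lambda>js. \<Prod>a\<in>{0..<n}. T (js (p a)) (js a))"
    and "integrable (PY n) (\<lambda>y. \<Prod>a\<in>{0..<n}. N (y a) (y (p a)))"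
    and "(LINT js|nat_seqs n. (\<Prod>a\<in>{0..<n}. T (js (p a)) (js a))) = (LINT y|PY n. (\<Prod>a\<in>{0..<n}. N (y a) (y (p a))))"
proof -
  interpret X: product_sigma_finite "\<lambda>_::nat. count_space (UNIV :: nat set)"
    by (rule product_sigma_finite_const[OF sigma_finite_count_nat])
  interpret Y: product_sigma_finite "\<lambda>_::nat. M"
    by (rule product_sigma_finite_const[OF sf])
  interpret pair_sigma_finite "nat_seqs n" "PY n"
    by (rule pair_sigma_finite_seqs[OF sf])
  let ?F = "\<lambda>js y. \<Prod>a\<in>{0..<n}. \<alpha> (js (p a)) (y a) * \<beta> (js a) (y a)"
  have ab: "integrable M (\<lambda>y. \<alpha> i y * \<beta> j y)" for i j
    by (rule integrable_mult_squares) (auto intro: int2)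
  have sec: "integrable (PY n) (\<lambda>y. ?F js y)" for js
    by (rule Y.product_integrable_prod) (auto intro: ab)
  \<comment> \<open>The majorant is the squared product of the \<open>\<alpha>\<close> plus that of
    the \<open>\<beta>\<close>; the second is the case of the identity permutation.\<close>
  have Fi: "integrable (nat_seqs n \<Otimes>\<^sub>M PY n) (\<lambda>(js, y). ?F js y)"
  proof (rule Bochner_Integration.integrable_bound[OF Bochner_Integration.integrable_add[OF
        integrable_seqs_prod[OF sf, of "\<lambda>i y. (norm (\<alpha> i y))\<^sup>2" p n]
        integrable_seqs_prod[OF sf, of "\<lambda>i y. (norm (\<beta> i y))\<^sup>2" "\<lambda>x. x" n]]])
    show "(\<lambda>(js, y). ?F js y) \<in> borel_measurable (nat_seqs n \<Otimes>\<^sub>M PY n)"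
      by (rule measurable_seqs_pair) (use sec in auto)
    show "AE x in nat_seqs n \<Otimes>\<^sub>M PY n. norm (case x of (js, y) \<Rightarrow> ?F js y)
       \<le> norm ((case x of (js, y) \<Rightarrow> \<Prod>a\<in>{0..<n}. (norm (\<alpha> (js (p a)) (y a)))\<^sup>2) + (case x of (js, y) \<Rightarrow> \<Prod>a\<in>{0..<n}. (norm (\<beta> (js a) (y a)))\<^sup>2))"
    proof (rule AE_I2, clarify)
      fix js y
      have "norm (?F js y) \<le> (norm (\<Prod>a\<in>{0..<n}. \<alpha> (js (p a)) (y a)))\<^sup>2 + (norm (\<Prod>a\<in>{0..<n}. \<beta> (js a) (y a)))\<^sup>2"
        unfolding prod.distrib by (rule norm_mult_le_squares)
      also have "\<dots> = (\<Prod>a\<in>{0..<n}. (norm (\<alpha> (js (p a)) (y a)))\<^sup>2) + (\<Prod>a\<in>{0..<n}. (norm (\<beta> (js a) (y a)))\<^sup>2)"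
        by (simp add: prod_norm prod_power_distrib flip: prod_norm)
      finally show "norm (?F js y) \<le> norm ((\<Prod>a\<in>{0..<n}. (norm (\<alpha> (js (p a)) (y a)))\<^sup>2) + (\<Prod>a\<in>{0..<n}. (norm (\<beta> (js a) (y a)))\<^sup>2))"
        by simp
    qed
  qed (auto intro: int2 summ2 p permutes_id[unfolded id_def])
  have Y: "(LINT y|PY n. ?F js y) = (\<Prod>a\<in>{0..<n}. T (js (p a)) (js a))" for js
    unfolding T_def by (rule Y.product_integral_prod) (auto intro: ab)
  have X: "(LINT js|nat_seqs n. ?F js y) = (\<Prod>a\<in>{0..<n}. N (y a) (y (p a)))" for y
  proof -
    \<comment> \<open>Reindexing the \<open>\<alpha>\<close> factors by \<open>p\<close> collects
      both occurrences of each index \<open>js b\<close> in one factor, so the sum over tuples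
      factors.\<close>
    let ?q = "inv_into UNIV p"
    have qp: "?q (p a) = a" "p (?q a) = a" for a using permutes_inverses[OF p] by auto
    have "?F js y = (\<Prod>b\<in>{0..<n}. \<alpha> (js b) (y (?q b)) * \<beta> (js b) (y b))" for js
      using prod_permute[OF p, of "\<lambda>b. \<alpha> (js b) (y (?q b))"] by (simp add: prod.distrib qp)
    then have "(LINT js|nat_seqs n. ?F js y) = (LINT js|nat_seqs n. (\<Prod>b\<in>{0..<n}. \<alpha> (js b) (y (?q b)) * \<beta> (js b) (y b)))"
      by simp
    also have "\<dots> = (\<Prod>b\<in>{0..<n}. LINT j|count_space UNIV. \<alpha> j (y (?q b)) * \<beta> j (y b))"
      by (rule X.product_integral_prod) (auto simp: integrable_count_space_nat_iff summ)
    also have "\<dots> = (\<Prod>b\<in>{0..<n}. N (y (?q b)) (y b))"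
      unfolding N_def by (intro prod.cong refl integral_count_space_nat) (simp add: integrable_count_space_nat_iff summ)
    also have "\<dots> = (\<Prod>a\<in>{0..<n}. N (y a) (y (p a)))"
      using prod_permute[OF p, of "\<lambda>b. N (y (?q b)) (y b)"] by (simp add: qp)
    finally show ?thesis .
  qed
  show "integrable (nat_seqs n) (\<lambda>js. \<Prod>a\<in>{0..<n}. T (js (p a)) (js a))"
    using integrable_fst[OF Fi] unfolding Y .
  show "integrable (PY n) (\<lambda>y. \<Prod>a\<in>{0..<n}. N (y a) (y (p a)))"
    using integrable_snd[OF Fi] unfolding X .
  show "(LINT js|nat_seqs n. (\<Prod>a\<in>{0..<n}. T (js (p a)) (js a))) = (LINT y|PY n. (\<Prod>a\<in>{0..<n}. N (y a) (y (p a))))"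
    using Fubini_integral[OF Fi] unfolding X Y by simp
qed

abbreviation (input) detT :: "nat \<Rightarrow> (nat \<Rightarrow> nat) \<Rightarrow> complex" where
  "detT n js \<equiv> Determinant.det (mat n n (\<lambda>(a, b). T (js a) (js b)))"
abbreviation (input) detN :: "nat \<Rightarrow> (nat \<Rightarrow> 'b) \<Rightarrow> complex" where
  "detN n y \<equiv> Determinant.det (mat n n (\<lambda>(a, b). N (y a) (y b)))"

text \<open>Expanding \<open>T\<close> with permuted rows and \<open>N\<close> with permuted columns
  makes the two Leibniz sums agree term by term through \<open>permutation_term\<close>.\<close>

lemma det_mat_col: "Determinant.det (mat n n (\<lambda>(a, b). f a b))
    = (\<Sum>p | p permutes {0..<n}. signof p * (\<Prod>j\<in>{0..<n}. f (p j) j))"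
  by (subst det_col[of _ n]) (auto intro!: sum.cong prod.cong simp: lessThan_atLeast0 permutes_in_image)

lemma det_mat_row: "Determinant.det (mat n n (\<lambda>(a, b). f a b))
    = (\<Sum>p | p permutes {0..<n}. signof p * (\<Prod>j\<in>{0..<n}. f j (p j)))"
  by (subst det_def'[of _ n]) (auto intro!: sum.cong prod.cong simp: permutes_in_image)

lemma integral_det:
  shows "integrable (nat_seqs n) (detT n)" "integrable (PY n) (detN n)"
    and "(LINT js|nat_seqs n. detT n js) = (LINT y|PY n. detN n y)"
proof -
  show "integrable (nat_seqs n) (detT n)"
    unfolding det_mat_col by (intro Bochner_Integration.integrable_sum integrable_mult_right permutation_term(1)) auto
  show "integrable (PY n) (detN n)"
    unfolding det_mat_row by (intro Bochner_Integration.integrable_sum integrable_mult_right permutation_term(2)) auto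
  have "(LINT js|nat_seqs n. detT n js) = (\<Sum>p | p permutes {0..<n}. LINT js|nat_seqs n. signof p * (\<Prod>a\<in>{0..<n}. T (js (p a)) (js a)))"
    unfolding det_mat_col by (rule Bochner_Integration.integral_sum, rule integrable_mult_right, rule permutation_term(1)) simp
  also have "\<dots> = (\<Sum>p | p permutes {0..<n}. LINT y|PY n. signof p * (\<Prod>a\<in>{0..<n}. N (y a) (y (p a))))"
    by (rule sum.cong[OF refl]) (simp add: permutation_term(3))
  also have "\<dots> = (LINT y|PY n. detN n y)"
    unfolding det_mat_row by (rule Bochner_Integration.integral_sum[symmetric], rule integrable_mult_right, rule permutation_term(2)) simp
  finally show "(LINT js|nat_seqs n. detT n js) = (LINT y|PY n. detN n y)" .
qed

end

text \<open>Rows and columns are permuted together, so the sign of \<open>p\<close> appears twice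
  and cancels.\<close>

lemma det_mat_permute:
  fixes f :: "'c \<Rightarrow> 'c \<Rightarrow> complex"
  assumes p: "p permutes {0..<n}"
  shows "Determinant.det (mat n n (\<lambda>(a, b). f ((z \<circ> p) a) ((z \<circ> p) b))) = Determinant.det (mat n n (\<lambda>(a, b). f (z a) (z b)))"
    (is "Determinant.det ?C = Determinant.det ?A")
proof -
  let ?B = "mat n n (\<lambda>(a, b). f (z (p a)) (z b))"
  have pl [simp]: "p a < n" if "a < n" for a using p that by (simp add: permutes_in_image)
  have "?B = mat n n (\<lambda>(i, j). ?A $$ (p i, j))" by (rule eq_matI) auto
  then have B: "Determinant.det ?B = signof p * Determinant.det ?A"
    using det_permute_rows[of ?A n p] p by simp
  have "transpose_mat ?C = mat n n (\<lambda>(i, j). transpose_mat ?B $$ (p i, j))" by (rule eq_matI) auto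
  then have "Determinant.det (transpose_mat ?C) = signof p * Determinant.det (transpose_mat ?B)"
    using det_permute_rows[of "transpose_mat ?B" n p] p by simp
  then have "Determinant.det ?C = signof p * Determinant.det ?B"
    using Determinant.det_transpose[of ?C n] Determinant.det_transpose[of ?B n] by simp
  then show ?thesis unfolding B by (simp add: sign_def)
qed

lemma det_mat_not_inj:
  fixes f :: "'c \<Rightarrow> 'c \<Rightarrow> complex"
  assumes "\<not> inj_on z {0..<n}"
  shows "Determinant.det (mat n n (\<lambda>(a, b). f (z a) (z b))) = 0"
proof -
  obtain i j where ij: "i < n" "j < n" "i \<noteq> j" "z i = z j" using assms by (auto simp: inj_on_def)
  show ?thesis
    by (rule det_identical_rows[of _ n i j]) (use ij in auto)
qed

lemma borel_measurable_lebesgue_id: "(\<lambda>x. x) \<in> borel_measurable (lebesgue :: real measure)"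
  by (rule measurable_completion) simp

lemma measurable_lebesgue_imp_borel:
  fixes f :: "'a \<Rightarrow> real"
  shows "f \<in> measurable M lebesgue \<Longrightarrow> f \<in> borel_measurable M"
  by (drule measurable_compose[OF _ borel_measurable_lebesgue_id]) simp

lemma sets_sorted_fun_lebesgue:
  "{z \<in> space (PiM {0..<n} (\<lambda>_. lebesgue :: real measure)). sorted_fun (>) n z} \<in> sets (PiM {0..<n} (\<lambda>_. lebesgue))"
proof -
  have m: "(\<lambda>z. z a) \<in> borel_measurable (PiM {0..<n} (\<lambda>_. lebesgue :: real measure))" if "a < n" for a
    by (rule measurable_lebesgue_imp_borel) (use that in \<open>auto intro!: measurable_component_singleton\<close>)
  have "sorted_fun (>) n z \<longleftrightarrow> (\<forall>b\<in>{0..<n}. \<forall>a\<in>{0..<b}. z b < z a)" for z :: "nat \<Rightarrow> real"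
    by (auto simp: sorted_fun_def)
  then have "{z \<in> space (PiM {0..<n} (\<lambda>_. lebesgue :: real measure)). sorted_fun (>) n z}
    = {z \<in> space (PiM {0..<n} (\<lambda>_. lebesgue :: real measure)). \<forall>b\<in>{0..<n}. \<forall>a\<in>{0..<b}. z b < z a}" by simp
  also have "\<dots> \<in> sets (PiM {0..<n} (\<lambda>_. lebesgue))"
    by (intro sets.sets_Collect_finite_All borel_measurable_less m) auto
  finally show ?thesis .
qed

lemma bij_betw_sorted_lists:
  "bij_betw (\<lambda>js. \<lambda>i\<in>{0..<n}. js ! i) {js :: nat list. length js = n \<and> sorted_wrt (<) js}
     {f \<in> {0..<n} \<rightarrow>\<^sub>E UNIV. sorted_fun (<) n f}"
proof (rule bij_betwI[where g = "\<lambda>f. map f [0..<n]"])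
  show "(\<lambda>js. \<lambda>i\<in>{0..<n}. js ! i) \<in> {js :: nat list. length js = n \<and> sorted_wrt (<) js} \<rightarrow> {f \<in> {0..<n} \<rightarrow>\<^sub>E UNIV. sorted_fun (<) n f}"
    by (auto simp: sorted_fun_def sorted_wrt_iff_nth_less)
  show "(\<lambda>f. map f [0..<n]) \<in> {f \<in> {0..<n} \<rightarrow>\<^sub>E UNIV. sorted_fun (<) n f} \<rightarrow> {js :: nat list. length js = n \<and> sorted_wrt (<) js}"
    by (auto simp: sorted_fun_def sorted_wrt_iff_nth_less)
  show "map (\<lambda>i\<in>{0..<n}. js ! i) [0..<n] = js" if "js \<in> {js :: nat list. length js = n \<and> sorted_wrt (<) js}" for js
    using that by (auto intro!: nth_equalityI)
  show "(\<lambda>i\<in>{0..<n}. map f [0..<n] ! i) = f" if "f \<in> {f \<in> {0..<n} \<rightarrow>\<^sub>E UNIV. sorted_fun (<) n f}" for f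
    using that by (auto simp: PiE_def extensional_def fun_eq_iff)
qed

text \<open>Sorting the indices on one side and the points on the other costs the factor
  \<open>fact n\<close> on each side, so it cancels. What remains on the left is the sum over
  increasing lists in \<open>trace_ext\<close>.\<close>

lemma andreief_has_sum:
  fixes \<alpha> \<beta> :: "nat \<Rightarrow> real \<Rightarrow> complex"
  assumes "andreief lebesgue \<alpha> \<beta>"
  defines "T \<equiv> andreief.T lebesgue \<alpha> \<beta>" and "N \<equiv> andreief.N \<alpha> \<beta>"
  shows "((\<lambda>js. Determinant.det (mat n n (\<lambda>(a, b). T (js ! a) (js ! b)))) has_sum
      (LINT y|PiM {0..<n} (\<lambda>_. lebesgue). (if sorted_fun (>) n y then Determinant.det (mat n n (\<lambda>(a, b). N (y a) (y b))) else 0)))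
      {js :: nat list. length js = n \<and> sorted_wrt (<) js}"
    and "integrable (PiM {0..<n} (\<lambda>_. lebesgue)) (\<lambda>y. if sorted_fun (>) n y then Determinant.det (mat n n (\<lambda>(a, b). N (y a) (y b))) else 0)"
proof -
  interpret andreief lebesgue \<alpha> \<beta> by fact
  have Te: "T = andreief.T lebesgue \<alpha> \<beta>" and Ne: "N = andreief.N \<alpha> \<beta>" by (simp_all add: assms)
  let ?dT = "\<lambda>js. Determinant.det (mat n n (\<lambda>(a, b). T (js a) (js b)))"
  let ?dN = "\<lambda>y. Determinant.det (mat n n (\<lambda>(a, b). N (y a) (y b)))"
  have iT: "integrable (nat_seqs n) ?dT" and iN: "integrable (PY n) ?dN"
    and eq: "(LINT js|nat_seqs n. ?dT js) = (LINT y|PY n. ?dN y)"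
    unfolding Te Ne using integral_det[of n] by auto
  have sT: "integrable (nat_seqs n) (\<lambda>js. if sorted_fun (<) n js then ?dT js else 0)"
    "(LINT js|nat_seqs n. ?dT js) = fact n * (LINT js|nat_seqs n. (if sorted_fun (<) n js then ?dT js else 0))"
  proof -
    note * = integral_symmetric_eq_sorted[where M="count_space (UNIV::nat set)" and R="(<)" and n=n and f="?dT", OF sigma_finite_count_nat]
    have m: "{z \<in> space (nat_seqs n). sorted_fun (<) n z} \<in> sets (nat_seqs n)"
      unfolding nat_seqs_eq by simp
    show "integrable (nat_seqs n) (\<lambda>js. if sorted_fun (<) n js then ?dT js else 0)"
      by (rule *(1)) (use m iT in \<open>auto simp: det_mat_permute[unfolded o_def] det_mat_not_inj\<close>)
    show "(LINT js|nat_seqs n. ?dT js) = fact n * (LINT js|nat_seqs n. (if sorted_fun (<) n js then ?dT js else 0))"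
      by (rule *(2)) (use m iT in \<open>auto simp: det_mat_permute[unfolded o_def] det_mat_not_inj\<close>)
  qed
  have sN: "integrable (PY n) (\<lambda>y. if sorted_fun (>) n y then ?dN y else 0)"
    "(LINT y|PY n. ?dN y) = fact n * (LINT y|PY n. (if sorted_fun (>) n y then ?dN y else 0))"
  proof -
    note * = integral_symmetric_eq_sorted[where M="lebesgue :: real measure" and R="(>)" and n=n and f="?dN", OF sf]
    show "integrable (PY n) (\<lambda>y. if sorted_fun (>) n y then ?dN y else 0)"
      by (rule *(1)) (use sets_sorted_fun_lebesgue iN in \<open>auto simp: det_mat_permute[unfolded o_def] det_mat_not_inj\<close>)
    show "(LINT y|PY n. ?dN y) = fact n * (LINT y|PY n. (if sorted_fun (>) n y then ?dN y else 0))"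
      by (rule *(2)) (use sets_sorted_fun_lebesgue iN in \<open>auto simp: det_mat_permute[unfolded o_def] det_mat_not_inj\<close>)
  qed
  show "integrable (PY n) (\<lambda>y. if sorted_fun (>) n y then ?dN y else 0)" by (rule sN(1))
  let ?L = "LINT y|PY n. (if sorted_fun (>) n y then ?dN y else 0)"
  have L: "(LINT js|nat_seqs n. (if sorted_fun (<) n js then ?dT js else 0)) = ?L"
    using sT(2) sN(2) eq by simp
  let ?h = "\<lambda>js. if sorted_fun (<) n js then ?dT js else 0"
  let ?S = "{0..<n} \<rightarrow>\<^sub>E (UNIV :: nat set)"
  \<comment> \<open>For a counting measure, integrability is absolute summability and the integral
    is \<open>infsetsum\<close>; from there the value passes to \<open>infsum\<close> and
    \<open>has_sum\<close>.\<close>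
  have abs: "Infinite_Set_Sum.abs_summable_on ?h ?S"
    using sT(1) unfolding nat_seqs_eq Infinite_Set_Sum.abs_summable_on_def .
  have "infsum ?h ?S = ?L"
    using L infsetsum_infsum[OF abs] unfolding nat_seqs_eq infsetsum_def by simp
  moreover have "?h summable_on ?S"
    using abs abs_summable_equivalent abs_summable_summable by blast
  then have "(?h has_sum infsum ?h ?S) ?S" by (rule has_sum_infsum)
  ultimately have "(?h has_sum ?L) ?S" by simp
  then have "(?dT has_sum ?L) {f \<in> ?S. sorted_fun (<) n f}"
    by (rule has_sum_cong_neutral[THEN iffD1, rotated -1]) auto
  then have "((\<lambda>js. ?dT (\<lambda>i\<in>{0..<n}. js ! i)) has_sum ?L) {js :: nat list. length js = n \<and> sorted_wrt (<) js}"
    by (subst has_sum_reindex_bij_betw[OF bij_betw_sorted_lists, of ?dT])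
  moreover have "?dT (\<lambda>i\<in>{0..<n}. js ! i) = Determinant.det (mat n n (\<lambda>(a, b). T (js ! a) (js ! b)))" for js
    by (rule arg_cong[where f=Determinant.det], rule eq_matI) auto
  ultimately show "((\<lambda>js. Determinant.det (mat n n (\<lambda>(a, b). T (js ! a) (js ! b)))) has_sum ?L)
      {js :: nat list. length js = n \<and> sorted_wrt (<) js}"
    by simp
qed

section \<open>Integral operators with square-integrable kernels\<close>

definition kernel_op :: "(real \<Rightarrow> real \<Rightarrow> complex) \<Rightarrow> l2_op" where
  "kernel_op c f = (\<lambda>x. LINT y|lebesgue. c x y * f y)"

text \<open>A Hilbert-Schmidt kernel whose sections are square-integrable at every point, not just
  almost every one, so that \<open>kernel_op\<close> is pointwise an inner product.\<close>

definition l2_kernel :: "(real \<Rightarrow> real \<Rightarrow> complex) \<Rightarrow> bool" where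
  "l2_kernel c \<longleftrightarrow> (\<lambda>(x, y). c x y) \<in> borel_measurable lebesgue2 \<and>
     (\<forall>x. c x \<in> L2) \<and> integrable lebesgue (\<lambda>x. (l2_norm (c x))\<^sup>2)"

lemma kernel_op_eq_inner: "kernel_op c f x = l2_inner (\<lambda>y. cnj (c x y)) f"
  by (simp add: kernel_op_def l2_inner_def)

lemma l2_norm_cnj: "l2_norm (\<lambda>x. cnj (f x)) = l2_norm f"
  by (simp add: l2_norm_def)

lemma l2_kernel_cnj:
  assumes "l2_kernel c" shows "l2_kernel (\<lambda>x y. cnj (c x y))"
proof -
  have [measurable]: "(\<lambda>(x, y). c x y) \<in> borel_measurable lebesgue2" using assms by (auto simp: l2_kernel_def)
  have "(\<lambda>p. cnj (case p of (x, y) \<Rightarrow> c x y)) \<in> borel_measurable lebesgue2" by measurable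
  then show ?thesis using assms by (auto simp: l2_kernel_def L2_cnj l2_norm_cnj case_prod_unfold)
qed

lemma kernel_op_measurable:
  assumes "l2_kernel c" "f \<in> L2"
  shows "kernel_op c f \<in> borel_measurable lebesgue"
proof -
  have [measurable]: "(\<lambda>(x, y). c x y) \<in> borel_measurable lebesgue2" "f \<in> borel_measurable lebesgue"
    using assms by (auto simp: l2_kernel_def dest: L2D)
  have "(\<lambda>p. (case p of (x, y) \<Rightarrow> c x y) * f (snd p)) \<in> borel_measurable lebesgue2" by measurable
  then have "(\<lambda>(x, y). c x y * f y) \<in> borel_measurable lebesgue2" by (simp add: case_prod_unfold)
  then show ?thesis unfolding kernel_op_def
    by (rule lebesgue.borel_measurable_lebesgue_integral)
qed

lemma kernel_op_bound:
  assumes "l2_kernel c" "f \<in> L2"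
  shows "(norm (kernel_op c f x))\<^sup>2 \<le> (l2_norm (c x))\<^sup>2 * (l2_norm f)\<^sup>2"
proof -
  have "c x \<in> L2" using assms by (simp add: l2_kernel_def)
  then have "norm (kernel_op c f x) \<le> l2_norm (c x) * l2_norm f"
    using norm_l2_inner_le[OF L2_cnj assms(2), of "c x"] by (simp add: kernel_op_eq_inner l2_norm_cnj)
  then have "(norm (kernel_op c f x))\<^sup>2 \<le> (l2_norm (c x) * l2_norm f)\<^sup>2" by (rule power_mono) simp
  then show ?thesis by (simp add: power_mult_distrib)
qed

lemma kernel_op_L2:
  assumes "l2_kernel c" "f \<in> L2"
  shows "kernel_op c f \<in> L2"
proof (rule L2I[OF kernel_op_measurable[OF assms]])
  have i: "integrable lebesgue (\<lambda>x. (l2_norm (c x))\<^sup>2 * (l2_norm f)\<^sup>2)"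
    using assms(1) by (intro integrable_mult_left) (auto simp: l2_kernel_def)
  have [measurable]: "kernel_op c f \<in> borel_measurable lebesgue" by (rule kernel_op_measurable[OF assms])
  show "integrable lebesgue (\<lambda>x. (norm (kernel_op c f x))\<^sup>2)"
    by (rule Bochner_Integration.integrable_bound[OF i]) (auto simp: kernel_op_bound[OF assms])
qed

lemma kernel_op_norm:
  assumes "l2_kernel c" "f \<in> L2"
  shows "l2_norm (kernel_op c f) \<le> sqrt (LINT x|lebesgue. (l2_norm (c x))\<^sup>2) * l2_norm f"
proof -
  have "(LINT x|lebesgue. (norm (kernel_op c f x))\<^sup>2) \<le> (LINT x|lebesgue. (l2_norm (c x))\<^sup>2 * (l2_norm f)\<^sup>2)"
    using kernel_op_L2[OF assms] assms
    by (intro integral_mono kernel_op_bound) (auto simp: l2_kernel_def dest: L2D_int)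
  then have "sqrt (LINT x|lebesgue. (norm (kernel_op c f x))\<^sup>2) \<le> sqrt ((LINT x|lebesgue. (l2_norm (c x))\<^sup>2) * (l2_norm f)\<^sup>2)"
    by (simp only: real_sqrt_le_iff integral_mult_left_zero)
  then show ?thesis by (simp add: l2_norm_def[of "kernel_op c f"] real_sqrt_mult l2_norm_nonneg)
qed

lemma kernel_op_linear:
  assumes c: "l2_kernel c" and fg: "f \<in> L2" "g \<in> L2"
  shows "kernel_op c (\<lambda>y. a * f y + b * g y) = (\<lambda>x. a * kernel_op c f x + b * kernel_op c g x)"
proof
  fix x
  have "c x \<in> L2" using c by (simp add: l2_kernel_def)
  then show "kernel_op c (\<lambda>y. a * f y + b * g y) x = a * kernel_op c f x + b * kernel_op c g x"
    using fg by (simp add: kernel_op_eq_inner l2_inner_add_right L2_scale L2_cnj l2_inner_scale_right)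
qed

lemma bounded_kernel_op:
  assumes c: "l2_kernel c"
  shows "bounded_l2_op (kernel_op c)"
  unfolding bounded_l2_op_def
proof (intro conjI ballI allI)
  show "kernel_op c f \<in> L2" if "f \<in> L2" for f by (rule kernel_op_L2[OF c that])
  show "\<exists>C. \<forall>f\<in>L2. l2_norm (kernel_op c f) \<le> C * l2_norm f" using kernel_op_norm[OF c] by blast
  fix f g a b assume fg: "f \<in> L2" "g \<in> L2"
  show "AE x in lebesgue. kernel_op c (\<lambda>y. a * f y + b * g y) x = a * kernel_op c f x + b * kernel_op c g x"
    by (simp add: kernel_op_linear[OF c fg])
qed

text \<open>Bessel's inequality for the conjugate of each section \<open>c x\<close>, integrated
  over \<open>x\<close>.\<close>

lemma kernel_op_onb_summable:
  assumes c: "l2_kernel c" and e: "l2_onb e"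
  shows "summable (\<lambda>i. (l2_norm (kernel_op c (e i)))\<^sup>2)"
proof (rule summableI_nonneg_bounded)
  have eL: "\<And>i. e i \<in> L2" and eo: "\<And>i j. l2_inner (e i) (e j) = (if i = j then 1 else 0)"
    using e unfolding l2_onb_def by auto
  have ci: "integrable lebesgue (\<lambda>x. (l2_norm (c x))\<^sup>2)" using c by (simp add: l2_kernel_def)
  fix n
  have ii: "integrable lebesgue (\<lambda>x. (norm (kernel_op c (e i) x))\<^sup>2)" for i
    using kernel_op_L2[OF c eL] by (rule L2D_int)
  have "(\<Sum>i<n. (l2_norm (kernel_op c (e i)))\<^sup>2) = (LINT x|lebesgue. (\<Sum>i<n. (norm (kernel_op c (e i) x))\<^sup>2))"
    unfolding l2_norm_square by (rule Bochner_Integration.integral_sum[symmetric]) (rule ii)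
  also have "\<dots> \<le> (LINT x|lebesgue. (l2_norm (c x))\<^sup>2)"
  proof (rule integral_mono)
    show "integrable lebesgue (\<lambda>x. \<Sum>i<n. (norm (kernel_op c (e i) x))\<^sup>2)"
      by (intro Bochner_Integration.integrable_sum ii)
    fix x
    have cx: "(\<lambda>y. cnj (c x y)) \<in> L2" using c by (auto simp: l2_kernel_def intro: L2_cnj)
    have "norm (kernel_op c (e i) x) = norm (l2_inner (e i) (\<lambda>y. cnj (c x y)))" for i
      unfolding kernel_op_eq_inner by (subst l2_inner_cnj[symmetric]) simp
    then have "(\<Sum>i<n. (norm (kernel_op c (e i) x))\<^sup>2) = (\<Sum>i<n. (norm (l2_inner (e i) (\<lambda>y. cnj (c x y))))\<^sup>2)"
      by simp
    also have "\<dots> \<le> (l2_norm (\<lambda>y. cnj (c x y)))\<^sup>2"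
      by (rule l2_Bessel) (auto intro: eL cx simp: eo)
    finally show "(\<Sum>i<n. (norm (kernel_op c (e i) x))\<^sup>2) \<le> (l2_norm (c x))\<^sup>2" by (simp add: l2_norm_cnj)
  qed (rule ci)
  finally show "(\<Sum>i<n. (l2_norm (kernel_op c (e i)))\<^sup>2) \<le> (LINT x|lebesgue. (l2_norm (c x))\<^sup>2)" .
qed simp

lemma hilbert_schmidt_kernel_op:
  assumes "l2_kernel c"
  shows "hilbert_schmidt (kernel_op c)"
  unfolding hilbert_schmidt_def using bounded_kernel_op[OF assms] kernel_op_onb_summable[OF assms] l2_onb_exists by blast

lemma integrable_pair_mult:
  fixes f g :: "real \<Rightarrow> 'a::{real_normed_field,banach,second_countable_topology}"
  assumes f: "integrable lebesgue f" and g: "integrable lebesgue g"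
  shows "integrable lebesgue2 (\<lambda>(x, y). f x * g y)"
proof (rule lebesgue_pair.Fubini_integrable)
  have [measurable]: "f \<in> borel_measurable lebesgue" "g \<in> borel_measurable lebesgue" using assms by auto
  show "(\<lambda>(x, y). f x * g y) \<in> borel_measurable lebesgue2" by measurable
  show "integrable lebesgue (\<lambda>x. LINT y|lebesgue. norm (case (x, y) of (x, y) \<Rightarrow> f x * g y))"
    using f g by (simp add: norm_mult)
  show "AE x in lebesgue. integrable lebesgue (\<lambda>y. case (x, y) of (x, y) \<Rightarrow> f x * g y)"
    using g by simp
qed

lemma l2_kernel_integrable_square:
  assumes "l2_kernel c"
  shows "integrable lebesgue2 (\<lambda>(x, y). (norm (c x y))\<^sup>2)"
proof (rule lebesgue_pair.Fubini_integrable)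
  have [measurable]: "(\<lambda>(x, y). c x y) \<in> borel_measurable lebesgue2" using assms by (auto simp: l2_kernel_def)
  have "(\<lambda>p. (norm (case p of (x, y) \<Rightarrow> c x y))\<^sup>2) \<in> borel_measurable lebesgue2" by measurable
  then show "(\<lambda>(x, y). (norm (c x y))\<^sup>2) \<in> borel_measurable lebesgue2"
    by (simp add: case_prod_unfold)
  show "integrable lebesgue (\<lambda>x. LINT y|lebesgue. norm (case (x, y) of (x, y) \<Rightarrow> (norm (c x y))\<^sup>2))"
    using assms by (simp add: l2_kernel_def l2_norm_square)
  show "AE x in lebesgue. integrable lebesgue (\<lambda>y. case (x, y) of (x, y) \<Rightarrow> (norm (c x y))\<^sup>2)"
    using assms by (simp add: l2_kernel_def L2D_int)
qed

lemma integrable_l2_kernel_mult: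
  assumes c: "l2_kernel c" and f: "f \<in> L2" and g: "g \<in> L2"
  shows "integrable lebesgue2 (\<lambda>(x, y). f x * g y * c x y)"
proof -
  have [measurable]: "f \<in> borel_measurable lebesgue" "g \<in> borel_measurable lebesgue" using f g by (auto dest: L2D)
  have m1: "(\<lambda>(x, y). f x * g y) \<in> borel_measurable lebesgue2" by measurable
  have "integrable lebesgue2 (\<lambda>p. (case p of (x, y) \<Rightarrow> f x * g y) * (case p of (x, y) \<Rightarrow> c x y))"
  proof (rule integrable_mult_squares[OF m1])
    show "(\<lambda>(x, y). c x y) \<in> borel_measurable lebesgue2" using c by (simp add: l2_kernel_def)
    show "integrable lebesgue2 (\<lambda>p. (norm (case p of (x, y) \<Rightarrow> c x y))\<^sup>2)"
      using l2_kernel_integrable_square[OF c] by (simp add: case_prod_unfold)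
    show "integrable lebesgue2 (\<lambda>p. (norm (case p of (x, y) \<Rightarrow> f x * g y))\<^sup>2)"
      using integrable_pair_mult[OF L2D_int[OF f] L2D_int[OF g]]
      by (simp add: case_prod_unfold norm_mult power_mult_distrib)
  qed
  then show ?thesis by (simp add: case_prod_unfold)
qed

lemma kernel_op_adjoint:
  assumes c: "l2_kernel c" and f: "f \<in> L2" and g: "g \<in> L2"
  shows "(LINT x|lebesgue. f x * kernel_op c g x) = (LINT y|lebesgue. (LINT x|lebesgue. f x * c x y) * g y)"
proof -
  have "(LINT x|lebesgue. f x * kernel_op c g x) = (LINT x|lebesgue. LINT y|lebesgue. f x * g y * c x y)"
    unfolding kernel_op_def by (intro Bochner_Integration.integral_cong refl) (simp add: ac_simps flip: integral_mult_right_zero)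
  also have "\<dots> = (LINT y|lebesgue. LINT x|lebesgue. f x * g y * c x y)"
    by (rule lebesgue_pair.Fubini_integral[symmetric]) (rule integrable_l2_kernel_mult[OF assms])
  also have "\<dots> = (LINT y|lebesgue. (LINT x|lebesgue. f x * c x y) * g y)"
    by (intro Bochner_Integration.integral_cong refl) (simp add: ac_simps flip: integral_mult_right_zero)
  finally show ?thesis .
qed

lemma measurable_lebesgue_pairI:
  fixes F :: "real \<times> real \<Rightarrow> 'a::topological_space"
  assumes "F \<in> borel_measurable (borel \<Otimes>\<^sub>M borel)"
  shows "F \<in> borel_measurable lebesgue2"
proof -
  have "(\<lambda>p. (fst p, snd p)) \<in> measurable lebesgue2 ((borel :: real measure) \<Otimes>\<^sub>M (borel :: real measure))"
    by (rule measurable_Pair; rule measurable_lebesgue_imp_borel) (rule measurable_fst measurable_snd)+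
  from measurable_compose[OF this, of F borel] assms show ?thesis by simp
qed

section \<open>Factorization of the Birman--Schwinger operator\<close>

lemma exp_integral_lessThan:
  fixes c :: complex
  assumes c: "Re c > 0"
  shows "set_integrable lebesgue {..<m} (\<lambda>y. exp (c * of_real (y - m)))"
    and "(LINT y:{..<m}|lebesgue. exp (c * of_real (y - m))) = 1 / c"
proof -
  have ei: "einterval (-\<infinity>) (ereal m) = {..<m}" by (auto simp: einterval_def)
  have lim: "((\<lambda>y. exp (r * (y - m)) / s) \<longlongrightarrow> 0) at_bot" if "r > 0" for r s :: real
  proof -
    have "filterlim (\<lambda>y. y - m) at_bot at_bot"
      unfolding filterlim_at_bot
    proof
      fix Z show "\<forall>\<^sub>F y in at_bot. y - m \<le> Z"
        using eventually_le_at_bot[of "Z + m"] by eventually_elim simp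
    qed
    then have "filterlim (\<lambda>y. r * (y - m)) at_bot at_bot"
      by (rule filterlim_tendsto_pos_mult_at_bot[OF tendsto_const that])
    then have "((\<lambda>y. exp (r * (y - m))) \<longlongrightarrow> 0) at_bot"
      by (rule filterlim_compose[OF exp_at_bot])
    from tendsto_divide_zero[OF this, of s] show ?thesis .
  qed
  \<comment> \<open>The modulus of the integrand is a real exponential; being nonnegative, it gets
    its integrability from the limits of its antiderivative.\<close>
  have "set_integrable lborel (einterval (-\<infinity>) (ereal m)) (\<lambda>y. exp (Re c * (y - m)))"
  proof (rule interval_integral_FTC_nonneg(1))
    show "((\<lambda>y. exp (Re c * (y - m)) / Re c) has_real_derivative exp (Re c * (x - m))) (at x)" for x
      using c by (auto intro!: derivative_eq_intros)
    show "(((\<lambda>y. exp (Re c * (y - m)) / Re c) \<circ> real_of_ereal) \<longlongrightarrow> 0) (at_right (- \<infinity>))"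
      unfolding ereal_tendsto_simps by (rule lim[OF c])
    show "(((\<lambda>y. exp (Re c * (y - m)) / Re c) \<circ> real_of_ereal) \<longlongrightarrow> exp (Re c * (m - m)) / Re c) (at_left (ereal m))"
      unfolding ereal_tendsto_simps using c by (intro tendsto_intros) auto
  qed (auto intro!: continuous_intros)
  then have si: "set_integrable lborel {..<m} (\<lambda>y. exp (c * of_real (y - m)))"
    unfolding ei
    by (rule set_integrable_bound) (auto simp: set_borel_measurable_def)
  have meas: "(\<lambda>y. indicator {..<m} y *\<^sub>R exp (c * of_real (y - m))) \<in> borel_measurable lborel" by measurable
  show "set_integrable lebesgue {..<m} (\<lambda>y. exp (c * of_real (y - m)))"
    using si unfolding set_integrable_def by (subst integrable_completion[OF meas])
  have "(LBINT y=-\<infinity>..ereal m. exp (c * of_real (y - m))) = exp (c * of_real (m - m)) / c - 0"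
  proof (rule interval_integral_FTC_integrable)
    show "((\<lambda>y. exp (c * of_real (y - m)) / c) has_vector_derivative exp (c * of_real (x - m))) (at x)" for x
    proof -
      have "((\<lambda>w. exp (c * (w - of_real m)) / c) has_field_derivative exp (c * (of_real x - of_real m))) (at (of_real x))"
        using c by (auto intro!: derivative_eq_intros)
      from has_vector_derivative_real_field[OF this] show ?thesis by simp
    qed
    show "set_integrable lborel (einterval (-\<infinity>) (ereal m)) (\<lambda>y. exp (c * of_real (y - m)))" unfolding ei by (rule si)
    have "((\<lambda>y. norm (exp (c * of_real (y - m)) / c)) \<longlongrightarrow> 0) at_bot"
      using lim[OF c, of "norm c"] by (simp add: norm_divide)
    then have "((\<lambda>y. exp (c * of_real (y - m)) / c) \<longlongrightarrow> 0) at_bot" by (rule tendsto_norm_zero_cancel)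
    then show "(((\<lambda>y. exp (c * of_real (y - m)) / c) \<circ> real_of_ereal) \<longlongrightarrow> 0) (at_right (- \<infinity>))"
      unfolding ereal_tendsto_simps .
    show "(((\<lambda>y. exp (c * of_real (y - m)) / c) \<circ> real_of_ereal) \<longlongrightarrow> exp (c * of_real (m - m)) / c) (at_left (ereal m))"
      unfolding ereal_tendsto_simps using c by (intro tendsto_intros) auto
  qed (auto intro!: continuous_intros)
  then have "(LINT y:{..<m}|lborel. exp (c * of_real (y - m))) = 1 / c"
    by (simp add: interval_lebesgue_integral_def ei)
  then show "(LINT y:{..<m}|lebesgue. exp (c * of_real (y - m))) = 1 / c"
    unfolding set_lebesgue_integral_def by (subst integral_completion[OF meas])
qed

text \<open>Green's function of \<open>d/dx - i k\<close> in \<open>x\<close>, and of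
  \<open>- d/dx - i k\<close> in \<open>y\<close>.\<close>

definition half_exp :: "complex \<Rightarrow> real \<Rightarrow> real \<Rightarrow> complex" where
  "half_exp k y x = (if y < x then exp (\<i> * k * of_real (x - y)) else 0)"

lemma measurable_half_exp: "(\<lambda>(y, x). half_exp k y x) \<in> borel_measurable lebesgue2"
  and measurable_half_exp': "(\<lambda>(x, y). half_exp k y x) \<in> borel_measurable lebesgue2"
proof -
  have "(\<lambda>(y, x). half_exp k y x) \<in> borel_measurable (borel \<Otimes>\<^sub>M borel)"
    unfolding half_exp_def by measurable
  then show "(\<lambda>(y, x). half_exp k y x) \<in> borel_measurable lebesgue2"
    by (rule measurable_lebesgue_pairI)
  have "(\<lambda>(x, y). half_exp k y x) \<in> borel_measurable (borel \<Otimes>\<^sub>M borel)"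
    unfolding half_exp_def by measurable
  then show "(\<lambda>(x, y). half_exp k y x) \<in> borel_measurable lebesgue2"
    by (rule measurable_lebesgue_pairI)
qed

text \<open>On the common support \<open>y < min x x'\<close> the two distances add up to
  \<open>\<bar>x - x'\<bar>\<close> plus twice the distance from \<open>y\<close> to the minimum,
  and only the latter is integrated. The value is Green's function \<open>green0\<close>.\<close>

lemma half_exp_integral:
  assumes k: "Im k > 0"
  shows "integrable lebesgue (\<lambda>y. half_exp k y x * half_exp k y x')"
    and "(LINT y|lebesgue. half_exp k y x * half_exp k y x') = \<i> / (2 * k) * exp (\<i> * k * of_real \<bar>x - x'\<bar>)"
proof -
  let ?c = "- 2 * \<i> * k" and ?m = "min x x'"
  have c: "Re ?c > 0" using k by simp
  have eq: "half_exp k y x * half_exp k y x' = exp (\<i> * k * of_real \<bar>x - x'\<bar>) * (indicator {..<?m} y *\<^sub>R exp (?c * of_real (y - ?m)))" for y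
  proof (cases "y < ?m")
    case True
    have "\<i> * k * of_real (x - y) + \<i> * k * of_real (x' - y) = \<i> * k * of_real \<bar>x - x'\<bar> + ?c * of_real (y - ?m)"
      by (cases "x \<le> x'") (auto simp: algebra_simps)
    then show ?thesis using True by (simp add: half_exp_def mult_exp_exp)
  qed (auto simp: half_exp_def)
  note e = exp_integral_lessThan[OF c, of ?m, unfolded set_integrable_def set_lebesgue_integral_def]
  show "integrable lebesgue (\<lambda>y. half_exp k y x * half_exp k y x')"
    unfolding eq by (rule integrable_mult_right[OF e(1)])
  have "(LINT y|lebesgue. half_exp k y x * half_exp k y x') = exp (\<i> * k * of_real \<bar>x - x'\<bar>) * (1 / ?c)"
    unfolding eq integral_mult_right_zero e(2) ..
  also have "1 / ?c = \<i> / (2 * k)"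
  proof -
    have "k \<noteq> 0" using k by auto
    then show ?thesis by (simp add: field_simps)
  qed
  finally show "(LINT y|lebesgue. half_exp k y x * half_exp k y x') = \<i> / (2 * k) * exp (\<i> * k * of_real \<bar>x - x'\<bar>)" by simp
qed

lemma norm_half_exp_le: "Im k > 0 \<Longrightarrow> norm (half_exp k y x) \<le> 1"
  by (simp add: half_exp_def)

lemma half_exp_L2:
  assumes k: "Im k > 0"
  shows "(\<lambda>y. half_exp k y x) \<in> L2" and "(l2_norm (\<lambda>y. half_exp k y x))\<^sup>2 = 1 / (2 * Im k)"
proof -
  \<comment> \<open>The squared modulus of \<open>half_exp k\<close> is the square of
    \<open>half_exp\<close> at the purely imaginary parameter \<open>i Im k\<close>, so the
    preceding lemma also computes the norm.\<close>
  let ?j = "\<i> * of_real (Im k)"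
  have n: "complex_of_real ((norm (half_exp k y x))\<^sup>2) = half_exp ?j y x * half_exp ?j y x" for y
    by (simp add: half_exp_def power2_eq_square flip: exp_of_real)
  have j: "Im ?j > 0" using k by simp
  have i: "integrable lebesgue (\<lambda>y. (norm (half_exp k y x))\<^sup>2)"
    using integrable_Re[OF half_exp_integral(1)[OF j, of x x, folded n]] by simp
  show "(\<lambda>y. half_exp k y x) \<in> L2"
  proof (rule L2I[OF _ i])
    show "(\<lambda>y. half_exp k y x) \<in> borel_measurable lebesgue" unfolding half_exp_def
      by (rule measurable_completion) measurable
  qed
  have "complex_of_real (LINT y|lebesgue. (norm (half_exp k y x))\<^sup>2) = 1 / (2 * Im k)"
    unfolding integral_complex_of_real[symmetric] n half_exp_integral(2)[OF j] using k by (simp add: field_simps)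
  then show "(l2_norm (\<lambda>y. half_exp k y x))\<^sup>2 = 1 / (2 * Im k)"
    unfolding l2_norm_square using of_real_eq_iff[where 'a=complex, of _ "1 / (2 * Im k)"] by simp
qed

text \<open>Both orientations occur, as kernels of \<open>A\<close> and of \<open>B\<close>. The
  first is computed from \<open>half_exp_L2\<close>; the second inherits its integrability from the
  first by Fubini's theorem.\<close>

lemma l2_kernel_half_exp:
  assumes k: "Im k > 0" and w: "w \<in> L2"
  shows "l2_kernel (\<lambda>x y. w x * half_exp k y x)" and "l2_kernel (\<lambda>y x. w x * half_exp k y x)"
proof -
  have [measurable]: "w \<in> borel_measurable lebesgue" using w by (auto dest: L2D)
  note [measurable] = measurable_half_exp measurable_half_exp'
  have "(\<lambda>p. w (fst p) * (case p of (x, y) \<Rightarrow> half_exp k y x)) \<in> borel_measurable lebesgue2" by measurable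
  then have m1: "(\<lambda>(x, y). w x * half_exp k y x) \<in> borel_measurable lebesgue2"
    by (simp add: case_prod_unfold)
  have "(\<lambda>p. w (snd p) * (case p of (y, x) \<Rightarrow> half_exp k y x)) \<in> borel_measurable lebesgue2" by measurable
  then have m2: "(\<lambda>(y, x). w x * half_exp k y x) \<in> borel_measurable lebesgue2"
    by (simp add: case_prod_unfold)
  have sq: "(l2_norm (\<lambda>y. w x * half_exp k y x))\<^sup>2 = (norm (w x))\<^sup>2 * (1 / (2 * Im k))" for x
    using half_exp_L2(2)[OF k, of x] unfolding l2_norm_square by (simp add: norm_mult power_mult_distrib)
  show K: "l2_kernel (\<lambda>x y. w x * half_exp k y x)"
    unfolding l2_kernel_def
  proof (intro conjI allI)
    show "(\<lambda>y. w x * half_exp k y x) \<in> L2" for x by (intro L2_scale half_exp_L2 k)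
    show "integrable lebesgue (\<lambda>x. (l2_norm (\<lambda>y. w x * half_exp k y x))\<^sup>2)"
      unfolding sq by (intro integrable_mult_left L2D_int w)
  qed (rule m1)
  show "l2_kernel (\<lambda>y x. w x * half_exp k y x)"
    unfolding l2_kernel_def
  proof (intro conjI allI)
    show "(\<lambda>x. w x * half_exp k y x) \<in> L2" for y
    proof (rule L2I)
      have [measurable]: "(\<lambda>x. half_exp k y x) \<in> borel_measurable lebesgue"
        unfolding half_exp_def by (rule measurable_completion) measurable
      show "(\<lambda>x. w x * half_exp k y x) \<in> borel_measurable lebesgue" by measurable
      show "integrable lebesgue (\<lambda>x. (norm (w x * half_exp k y x))\<^sup>2)"
        by (rule Bochner_Integration.integrable_bound[OF L2D_int[OF w]])
          (auto simp: norm_mult power_mult_distrib mult_left_le power_le_one norm_half_exp_le[OF k])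
    qed
    show "integrable lebesgue (\<lambda>y. (l2_norm (\<lambda>x. w x * half_exp k y x))\<^sup>2)"
      using lebesgue_pair.integrable_snd[OF l2_kernel_integrable_square[OF K]]
      by (simp add: l2_norm_square)
  qed (rule m2)
qed

text \<open>Removes \<open>Arg\<close>, which makes measurability immediate. At zeros of
  \<open>V\<close> the quotient is \<open>0\<close> by convention, as is
  \<open>u_factor\<close>.\<close>

lemma u_factor_eq: "u_factor V x = V x / of_real (sqrt (norm (V x)))"
proof (cases "V x = 0")
  case False
  have "V x = of_real (norm (V x)) * exp (\<i> * of_real (Arg (V x)))"
    using Arg_eq[OF False] .
  then have "exp (\<i> * of_real (Arg (V x))) = V x / of_real (norm (V x))"
    using False by (simp add: field_simps)
  moreover have "complex_of_real (norm (V x)) = of_real (sqrt (norm (V x))) * of_real (sqrt (norm (V x)))"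
    by (simp flip: of_real_mult)
  ultimately show ?thesis unfolding u_factor_def using False by (simp add: field_simps)
qed (simp add: u_factor_def)

lemma u_factor_mult_v_factor: "u_factor V x * v_factor V x = V x"
  by (cases "V x = 0") (simp_all add: u_factor_eq v_factor_def)

lemma uv_factor_L2:
  assumes "integrable lebesgue V"
  shows "u_factor V \<in> L2" "v_factor V \<in> L2"
proof -
  have [measurable]: "V \<in> borel_measurable lebesgue" using assms by auto
  show "v_factor V \<in> L2"
  proof (rule L2I)
    show "v_factor V \<in> borel_measurable lebesgue" unfolding v_factor_def by measurable
    show "integrable lebesgue (\<lambda>x. (norm (v_factor V x))\<^sup>2)" using assms by (simp add: v_factor_def)
  qed
  show "u_factor V \<in> L2"
  proof (rule L2I)
    show "u_factor V \<in> borel_measurable lebesgue" unfolding u_factor_eq by measurable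
    show "integrable lebesgue (\<lambda>x. (norm (u_factor V x))\<^sup>2)" using assms by (simp add: u_factor_def norm_mult)
  qed
qed

lemma trace_class_kernel_op_comp:
  assumes a: "l2_kernel a" and b: "l2_kernel b"
    and eq: "\<And>f. f \<in> L2 \<Longrightarrow> T f = kernel_op a (kernel_op b f)"
  shows "trace_class T"
  unfolding trace_class_def
proof (rule conjI)
  show "\<exists>A B. hilbert_schmidt A \<and> hilbert_schmidt B \<and> (\<forall>f\<in>L2. AE x in lebesgue. T f x = A (B f) x)"
    by (rule exI[of _ "kernel_op a"], rule exI[of _ "kernel_op b"])
      (simp add: hilbert_schmidt_kernel_op[OF a] hilbert_schmidt_kernel_op[OF b] eq)
  show "bounded_l2_op T" unfolding bounded_l2_op_def
  proof (intro conjI ballI allI)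
    show "T f \<in> L2" if "f \<in> L2" for f unfolding eq[OF that] by (intro kernel_op_L2 a b that)
    show "AE x in lebesgue. T (\<lambda>y. c * f y + d * g y) x = c * T f x + d * T g x" if "f \<in> L2" "g \<in> L2" for f g c d
    proof -
      have "(\<lambda>y. c * f y + d * g y) \<in> L2" using that by (intro L2_add L2_scale)
      then show ?thesis using that
        by (simp add: eq kernel_op_linear[OF b] kernel_op_linear[OF a] kernel_op_L2[OF b])
    qed
    let ?s = "\<lambda>c :: real \<Rightarrow> real \<Rightarrow> complex. sqrt (LINT x|lebesgue. (l2_norm (c x))\<^sup>2)"
    show "\<exists>C. \<forall>f\<in>L2. l2_norm (T f) \<le> C * l2_norm f"
    proof (intro exI ballI)
      fix f assume f: "f \<in> L2"
      have "l2_norm (T f) \<le> ?s a * l2_norm (kernel_op b f)"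
        unfolding eq[OF f] by (intro kernel_op_norm a kernel_op_L2 b f)
      also have "\<dots> \<le> ?s a * (?s b * l2_norm f)"
        by (intro mult_left_mono kernel_op_norm b f real_sqrt_ge_zero integral_nonneg_AE) auto
      finally show "l2_norm (T f) \<le> (?s a * ?s b) * l2_norm f" by (simp add: mult.assoc)
    qed
  qed
qed

lemma K_op_factorization:
  assumes V: "integrable lebesgue V" and k: "Im (zsqrt z) > 0" and f: "f \<in> L2"
  shows "K_op V z f = kernel_op (\<lambda>x y. - u_factor V x * half_exp (zsqrt z) y x)
     (kernel_op (\<lambda>y x. v_factor V x * half_exp (zsqrt z) y x) f)"
proof
  fix x
  let ?h = "half_exp (zsqrt z)" and ?u = "u_factor V" and ?v = "v_factor V"
  let ?b = "\<lambda>y x. ?v x * ?h y x"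
  have b: "l2_kernel ?b" by (rule l2_kernel_half_exp(2)[OF k uv_factor_L2(2)[OF V]])
  have G: "(LINT y|lebesgue. ?h y x * ?b y x') = green0 z x x' * ?v x'" for x'
  proof -
    have "(LINT y|lebesgue. ?h y x * ?b y x') = (LINT y|lebesgue. (?h y x * ?h y x') * ?v x')"
      by (simp add: ac_simps)
    also have "\<dots> = green0 z x x' * ?v x'"
      by (simp add: half_exp_integral(2)[OF k] green0_def)
    finally show ?thesis .
  qed
  have "kernel_op (\<lambda>x y. - ?u x * ?h y x) (kernel_op ?b f) x = - ?u x * (LINT y|lebesgue. ?h y x * kernel_op ?b f y)"
    unfolding kernel_op_def[of "\<lambda>x y. - ?u x * ?h y x"]
    by (subst integral_mult_right_zero[symmetric]) (simp add: ac_simps)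
  also have "(LINT y|lebesgue. ?h y x * kernel_op ?b f y) = (LINT x'|lebesgue. (LINT y|lebesgue. ?h y x * ?b y x') * f x')"
    by (rule kernel_op_adjoint[OF b half_exp_L2(1)[OF k] f])
  also have "- ?u x * (LINT x'|lebesgue. (LINT y|lebesgue. ?h y x * ?b y x') * f x') = K_op V z f x"
    unfolding G K_op_def K_kernel_def
    by (subst integral_mult_right_zero[symmetric]) (simp add: ac_simps)
  finally show "K_op V z f x = kernel_op (\<lambda>x y. - ?u x * ?h y x) (kernel_op ?b f) x" ..
qed

lemma trace_class_K_op:
  assumes V: "integrable lebesgue V" and k: "Im (zsqrt z) > 0"
  shows "trace_class (K_op V z)"
proof (rule trace_class_kernel_op_comp)
  have "(\<lambda>x. - u_factor V x) \<in> L2" using L2_scale[OF uv_factor_L2(1)[OF V], of "-1"] by simp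
  then show "l2_kernel (\<lambda>x y. - u_factor V x * half_exp (zsqrt z) y x)"
    by (rule l2_kernel_half_exp(1)[OF k])
  show "l2_kernel (\<lambda>y x. v_factor V x * half_exp (zsqrt z) y x)"
    by (rule l2_kernel_half_exp(2)[OF k uv_factor_L2(2)[OF V]])
qed (rule K_op_factorization[OF V k])

text \<open>The kernel of \<open>B A\<close>.\<close>

definition dual_kernel :: "(real \<Rightarrow> complex) \<Rightarrow> complex \<Rightarrow> real \<Rightarrow> real \<Rightarrow> complex" where
  "dual_kernel V k y y' = (LINT x|lebesgue. V x * half_exp k y x * half_exp k y' x)"

lemma trace_ext_K_op:
  assumes V: "integrable lebesgue V" and k: "Im (zsqrt z) > 0"
  defines "d \<equiv> \<lambda>n y. if sorted_fun (>) n y then Determinant.det (mat n n (\<lambda>(a, b). dual_kernel V (zsqrt z) (y a) (y b))) else 0"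
  shows "trace_ext n (\<lambda>f x. - K_op V z f x) = (LINT y|PiM {0..<n} (\<lambda>_. lebesgue). d n y)"
    and "integrable (PiM {0..<n} (\<lambda>_. lebesgue)) (d n)"
proof -
  let ?h = "half_exp (zsqrt z)" and ?u = "u_factor V" and ?v = "v_factor V"
  let ?a = "\<lambda>y x. ?u x * ?h y x" and ?b = "\<lambda>y x. ?v x * ?h y x" and ?a' = "\<lambda>x y. ?u x * ?h y x"
  have a: "l2_kernel ?a" by (rule l2_kernel_half_exp(2)[OF k uv_factor_L2(1)[OF V]])
  have b: "l2_kernel ?b" by (rule l2_kernel_half_exp(2)[OF k uv_factor_L2(2)[OF V]])
  have a': "l2_kernel ?a'" by (rule l2_kernel_half_exp(1)[OF k uv_factor_L2(1)[OF V]])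
  let ?P = "PiM {0..<n} (\<lambda>_. lebesgue :: real measure)"
  have main: "((\<lambda>js. Determinant.det (mat n n (\<lambda>(p, q). l2_inner (e (js ! p)) (\<lambda>x. - K_op V z (e (js ! q)) x))))
      has_sum (LINT y|?P. d n y)) {js :: nat list. length js = n \<and> sorted_wrt (<) js} \<and> integrable ?P (d n)"
    if e: "l2_onb e" for e
  proof -
    have eL: "\<And>i. e i \<in> L2" using e unfolding l2_onb_def by auto
    \<comment> \<open>With this choice \<open>T\<close> is the matrix of \<open>- K\<close> in the
      basis \<open>e\<close>, and Parseval's identity turns \<open>N\<close> into
      \<open>dual_kernel\<close>, which does not involve \<open>e\<close>. Hence all bases give the
      same sum.\<close>
    define \<alpha> where "\<alpha> i y = l2_inner (e i) (?a y)" for i y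
    define \<beta> where "\<beta> j = kernel_op ?b (e j)" for j
    have \<alpha>: "\<alpha> i y = cnj (kernel_op (\<lambda>y x. cnj (?a y x)) (e i) y)" for i y
      unfolding \<alpha>_def kernel_op_eq_inner by (subst l2_inner_cnj) simp
    have \<alpha>L: "\<alpha> i \<in> L2" for i
      unfolding \<alpha>[abs_def] by (intro L2_cnj kernel_op_L2 l2_kernel_cnj a eL)
    have \<beta>L: "\<beta> i \<in> L2" for i unfolding \<beta>_def by (intro kernel_op_L2 b eL)
    have ab_term: "\<alpha> i y * \<beta> i y' = l2_inner (\<lambda>x. cnj (?b y' x)) (e i) * l2_inner (e i) (?a y)" for i y y'
      by (simp add: \<alpha>_def \<beta>_def kernel_op_eq_inner)
    have aL: "?a y \<in> L2" and bL: "(\<lambda>x. cnj (?b y x)) \<in> L2" for y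
      using a b L2_cnj[of "?b y"] by (simp_all add: l2_kernel_def)
    interpret A: andreief lebesgue \<alpha> \<beta>
    proof
      show "\<alpha> i \<in> borel_measurable lebesgue" "\<beta> i \<in> borel_measurable lebesgue"
        "integrable lebesgue (\<lambda>y. (norm (\<alpha> i y))\<^sup>2)" "integrable lebesgue (\<lambda>y. (norm (\<beta> i y))\<^sup>2)" for i
        using \<alpha>L \<beta>L by (auto dest: L2D L2D_int)
      show "summable (\<lambda>i. LINT y|lebesgue. (norm (\<beta> i y))\<^sup>2)"
        using kernel_op_onb_summable[OF b e] by (simp add: \<beta>_def l2_norm_square)
      show "summable (\<lambda>i. LINT y|lebesgue. (norm (\<alpha> i y))\<^sup>2)"
        using kernel_op_onb_summable[OF l2_kernel_cnj[OF a] e] by (simp add: \<alpha> l2_norm_square)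
      show "summable (\<lambda>i. norm (\<alpha> i y * \<beta> i y'))" for y y'
        unfolding ab_term by (rule l2_Parseval_summable[OF e bL aL])
    qed
    have N: "A.N y y' = dual_kernel V (zsqrt z) y y'" for y y'
    proof -
      have "A.N y y' = l2_inner (\<lambda>x. cnj (?b y' x)) (?a y)"
        unfolding A.N_def ab_term by (rule sums_unique[OF l2_Parseval[OF e bL aL], symmetric])
      also have "\<dots> = dual_kernel V (zsqrt z) y y'"
        unfolding l2_inner_def dual_kernel_def
      proof (rule Bochner_Integration.integral_cong[OF refl])
        fix x
        have "cnj (cnj (?b y' x)) * ?a y x = (?u x * ?v x) * ?h y x * ?h y' x" by simp
        then show "cnj (cnj (?b y' x)) * ?a y x = V x * ?h y x * ?h y' x"
          unfolding u_factor_mult_v_factor .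
      qed
      finally show ?thesis .
    qed
    have T: "A.T i j = l2_inner (e i) (\<lambda>x. - K_op V z (e j) x)" for i j
    proof -
      have "- K_op V z (e j) x = kernel_op ?a' (\<beta> j) x" for x
        unfolding K_op_factorization[OF V k eL] \<beta>_def[symmetric]
        unfolding kernel_op_def by simp
      then have "l2_inner (e i) (\<lambda>x. - K_op V z (e j) x) = (LINT x|lebesgue. cnj (e i x) * kernel_op ?a' (\<beta> j) x)"
        by (simp add: l2_inner_def)
      also have "\<dots> = (LINT y|lebesgue. (LINT x|lebesgue. cnj (e i x) * ?a' x y) * \<beta> j y)"
        by (rule kernel_op_adjoint[OF a' L2_cnj[OF eL] \<beta>L])
      also have "\<dots> = A.T i j" by (simp add: A.T_def \<alpha>_def l2_inner_def)
      finally show ?thesis ..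
    qed
    show ?thesis
      using andreief_has_sum[OF A.andreief_axioms, of n] unfolding N T d_def by simp
  qed
  \<comment> \<open>One basis is enough to pin down the number in the description
    \<open>trace_ext\<close>.\<close>
  obtain e0 where e0: "l2_onb e0" using l2_onb_exists by blast
  show "integrable ?P (d n)" using main[OF e0] by blast
  show "trace_ext n (\<lambda>f x. - K_op V z f x) = (LINT y|?P. d n y)"
    unfolding trace_ext_def
  proof (rule the_equality)
    show "\<forall>e. l2_onb e \<longrightarrow>
     ((\<lambda>js. Determinant.det (mat n n (\<lambda>(a, b). l2_inner (e (js ! a)) (\<lambda>x. - K_op V z (e (js ! b)) x))))
        has_sum (LINT y|?P. d n y)) {js :: nat list. length js = n \<and> sorted_wrt (<) js}"
      using main by blast
    fix t assume "\<forall>e. l2_onb e \<longrightarrow>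
     ((\<lambda>js. Determinant.det (mat n n (\<lambda>(a, b). l2_inner (e (js ! a)) (\<lambda>x. - K_op V z (e (js ! b)) x))))
        has_sum t) {js :: nat list. length js = n \<and> sorted_wrt (<) js}"
    then show "t = (LINT y|?P. d n y)" using main[OF e0] e0 has_sum_unique by blast
  qed
qed

section \<open>Tail integrals\<close>

lemma integral_mult_if:
  fixes f :: "real \<Rightarrow> 'a::{real_normed_field,banach,second_countable_topology}"
  shows "(LINT x:A|M. f x) = (LINT x|M. of_bool (x \<in> A) * f x)"
  unfolding set_lebesgue_integral_def by (rule Bochner_Integration.integral_cong) (auto simp: indicator_def)

lemma measurable_of_bool_mult:
  fixes f :: "real \<Rightarrow> 'a::{real_normed_field,banach,second_countable_topology}"
  assumes [measurable]: "f \<in> borel_measurable M" "A \<in> sets M"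
  shows "(\<lambda>x. of_bool (x \<in> A) * f x) \<in> borel_measurable M"
proof -
  have "(\<lambda>x. indicator A x *\<^sub>R f x) \<in> borel_measurable M" by measurable
  then show ?thesis by (rule measurable_cong[THEN iffD1, rotated]) (auto simp: indicator_def)
qed

lemma integrable_of_bool_mult:
  fixes f :: "real \<Rightarrow> 'a::{real_normed_field,banach,second_countable_topology}"
  assumes "integrable M f" "A \<in> sets M"
  shows "integrable M (\<lambda>x. of_bool (x \<in> A) * f x)"
  using integrable_mult_indicator[OF assms(2,1)]
  by (rule Bochner_Integration.integrable_cong[THEN iffD1, rotated 2]) (auto simp: indicator_def)

lemma measurable_of_bool_less_pair:
  "(\<lambda>(x, y). of_bool (x < y) :: 'a::real_normed_field) \<in> borel_measurable (lebesgue \<Otimes>\<^sub>M (lebesgue :: real measure))"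
  "(\<lambda>(x, y). of_bool (y \<le> x) :: 'a) \<in> borel_measurable (lebesgue \<Otimes>\<^sub>M (lebesgue :: real measure))"
proof -
  have "(\<lambda>(x, y). of_bool (x < y) :: 'a) \<in> borel_measurable (borel \<Otimes>\<^sub>M (borel :: real measure))"
    unfolding of_bool_def by measurable
  then show "(\<lambda>(x, y). of_bool (x < y) :: 'a) \<in> borel_measurable (lebesgue \<Otimes>\<^sub>M (lebesgue :: real measure))"
    by (rule measurable_lebesgue_pairI)
  have "(\<lambda>(x, y). of_bool (y \<le> x) :: 'a) \<in> borel_measurable (borel \<Otimes>\<^sub>M (borel :: real measure))"
    unfolding of_bool_def by measurable
  then show "(\<lambda>(x, y). of_bool (y \<le> x) :: 'a) \<in> borel_measurable (lebesgue \<Otimes>\<^sub>M (lebesgue :: real measure))"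
    by (rule measurable_lebesgue_pairI)
qed

lemma integrable_pair_bounded_mult:
  fixes f g :: "real \<Rightarrow> 'a::{real_normed_field,banach,second_countable_topology}"
  assumes f: "integrable lebesgue f" and g: "integrable lebesgue g"
    and c: "(\<lambda>(x, y). c x y) \<in> borel_measurable lebesgue2" and B: "\<And>x y. norm (c x y) \<le> B"
  shows "integrable lebesgue2 (\<lambda>(x, y). c x y * (f x * g y))"
proof (rule Bochner_Integration.integrable_bound[OF integrable_mult_right[OF integrable_pair_mult[OF f g], of "of_real B"]])
  have [measurable]: "f \<in> borel_measurable lebesgue" "g \<in> borel_measurable lebesgue" using f g by auto
  have [measurable]: "(\<lambda>p. c (fst p) (snd p)) \<in> borel_measurable lebesgue2" using c by (simp add: case_prod_unfold)
  show "(\<lambda>(x, y). c x y * (f x * g y)) \<in> borel_measurable lebesgue2"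
    unfolding case_prod_unfold by measurable
  have "B \<ge> 0" using B[of 0 0] norm_ge_zero order_trans by blast
  then show "AE x in lebesgue2. norm (case x of (x, y) \<Rightarrow> c x y * (f x * g y)) \<le> norm (of_real B * (case x of (x, y) \<Rightarrow> f x * g y))"
    by (auto intro!: AE_I2 simp: norm_mult mult_right_mono B)
qed

text \<open>Stands for an absolutely continuous function that vanishes at infinity and has
  derivative \<open>- f\<close>. Real values serve for majorants, complex ones for the
  solutions.\<close>

definition tail :: "(real \<Rightarrow> 'a::{real_normed_field,banach,second_countable_topology}) \<Rightarrow> real \<Rightarrow> 'a" where
  "tail f x = (LINT y:{x<..}|lebesgue. f y)"

lemma tail_eq: "tail f x = (LINT y|lebesgue. of_bool (x < y) * f y)"
  by (simp add: tail_def integral_mult_if)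

lemma tail_eq_closed: "tail f x = (LINT y|lebesgue. of_bool (x \<le> y) * f y)" if "f \<in> borel_measurable lebesgue"
proof -
  have "AE y in lebesgue. y \<notin> {x}" by (rule AE_not_in) auto
  then show ?thesis unfolding tail_eq using that
    using measurable_of_bool_mult[OF that, of "{x<..}"] measurable_of_bool_mult[OF that, of "{x..}"]
    by (intro integral_cong_AE) (auto elim!: eventually_mono)
qed

lemma norm_tail_le:
  assumes "integrable lebesgue f"
  shows "norm (tail f x) \<le> (LINT y|lebesgue. norm (f y))"
proof -
  have "norm (tail f x) \<le> (LINT y|lebesgue. norm (of_bool (x < y) * f y))"
    unfolding tail_eq by (rule integral_norm_bound)
  also have "\<dots> \<le> (LINT y|lebesgue. norm (f y))"
  proof (rule integral_mono)
    show "integrable lebesgue (\<lambda>y. norm (of_bool (x < y) * f y))"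
      using integrable_norm[OF integrable_of_bool_mult[OF assms, of "{x<..}"]] by simp
    show "integrable lebesgue (\<lambda>y. norm (f y))" using assms by (rule integrable_norm)
    show "norm (of_bool (x < y) * f y) \<le> norm (f y)" for y by (simp add: of_bool_def)
  qed
  finally show ?thesis .
qed

lemma measurable_tail:
  assumes [measurable]: "f \<in> borel_measurable lebesgue"
  shows "tail f \<in> borel_measurable lebesgue"
proof -
  note [measurable] = measurable_of_bool_less_pair(1)[where 'a='a]
  have "(\<lambda>p. (case p of (x, y) \<Rightarrow> of_bool (x < y)) * f (snd p)) \<in> borel_measurable lebesgue2"
    by measurable
  then have "(\<lambda>(x, y). of_bool (x < y) * f y) \<in> borel_measurable lebesgue2"
    by (simp add: case_prod_unfold)
  then show ?thesis unfolding tail_eq[abs_def]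
    by (rule lebesgue.borel_measurable_lebesgue_integral)
qed

lemma integrable_mult_tail:
  assumes f: "integrable lebesgue f" and g: "integrable lebesgue g"
  shows "integrable lebesgue (\<lambda>s. f s * tail g s)"
proof (rule Bochner_Integration.integrable_bound[OF integrable_mult_left[OF f, of "of_real (LINT y|lebesgue. norm (g y))"]])
  have [measurable]: "f \<in> borel_measurable lebesgue" "tail g \<in> borel_measurable lebesgue" using f g by (auto intro: measurable_tail)
  show "(\<lambda>s. f s * tail g s) \<in> borel_measurable lebesgue" by measurable
  have "0 \<le> (LINT y|lebesgue. norm (g y))" by simp
  then show "AE x in lebesgue. norm (f x * tail g x) \<le> norm (f x * of_real (LINT y|lebesgue. norm (g y)))"
    by (auto intro!: AE_I2 mult_left_mono norm_tail_le[OF g] simp: norm_mult)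
qed

text \<open>Integration by parts: the product is a double integral over a quadrant, which the
  diagonal cuts into the parts \<open>s < t\<close> and \<open>t \<le> s\<close>.\<close>

lemma tail_product:
  assumes f: "integrable lebesgue f" and g: "integrable lebesgue g"
  shows "tail f x * tail g x = tail (\<lambda>s. f s * tail g s) x + tail (\<lambda>s. g s * tail f s) x"
proof -
  have fm: "f \<in> borel_measurable lebesgue" using f by auto
  let ?f = "\<lambda>s. of_bool (x < s) * f s" and ?g = "\<lambda>s. of_bool (x < s) * g s"
  have f': "integrable lebesgue ?f" and g': "integrable lebesgue ?g"
    using integrable_of_bool_mult[OF f, of "{x<..}"] integrable_of_bool_mult[OF g, of "{x<..}"] by auto
  have i1: "integrable lebesgue2 (\<lambda>(s, t). of_bool (s < t) * (?f s * ?g t))"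
    by (rule integrable_pair_bounded_mult[OF f' g' measurable_of_bool_less_pair(1)]) auto
  have i2: "integrable lebesgue2 (\<lambda>(s, t). of_bool (t \<le> s) * (?f s * ?g t))"
    by (rule integrable_pair_bounded_mult[OF f' g' measurable_of_bool_less_pair(2)]) auto
  have i0: "integrable lebesgue2 (\<lambda>(s, t). ?f s * ?g t)"
    by (rule integrable_pair_mult[OF f' g'])
  have "tail f x * tail g x = (LINT s|lebesgue. LINT t|lebesgue. ?f s * ?g t)"
    unfolding tail_eq by (simp only: integral_mult_right_zero integral_mult_left_zero)
  also have "\<dots> = integral\<^sup>L lebesgue2 (\<lambda>(s, t). ?f s * ?g t)"
    by (rule lebesgue_pair.integral_fst[OF i0])
  also have "\<dots> = integral\<^sup>L lebesgue2 (\<lambda>p. (case p of (s, t) \<Rightarrow> of_bool (s < t) * (?f s * ?g t)) + (case p of (s, t) \<Rightarrow> of_bool (t \<le> s) * (?f s * ?g t)))"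
    by (rule Bochner_Integration.integral_cong) (auto simp: of_bool_def)
  also have "\<dots> = integral\<^sup>L lebesgue2 (\<lambda>(s, t). of_bool (s < t) * (?f s * ?g t)) + integral\<^sup>L lebesgue2 (\<lambda>(s, t). of_bool (t \<le> s) * (?f s * ?g t))"
    by (rule Bochner_Integration.integral_add[OF i1 i2])
  also have "integral\<^sup>L lebesgue2 (\<lambda>(s, t). of_bool (s < t) * (?f s * ?g t)) = tail (\<lambda>s. f s * tail g s) x"
  proof -
    have "(LINT t|lebesgue. of_bool (s < t) * (?f s * ?g t)) = of_bool (x < s) * (f s * tail g s)" for s
    proof -
      have "(LINT t|lebesgue. of_bool (s < t) * (?f s * ?g t)) = (LINT t|lebesgue. ?f s * (of_bool (s < t) * g t))"
        by (rule Bochner_Integration.integral_cong) (auto simp: of_bool_def)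
      then show ?thesis unfolding tail_eq by (simp only: integral_mult_right_zero mult.assoc)
    qed
    then show ?thesis unfolding lebesgue_pair.integral_fst[OF i1, symmetric] tail_eq[of _ x] by simp
  qed
  also have "integral\<^sup>L lebesgue2 (\<lambda>(s, t). of_bool (t \<le> s) * (?f s * ?g t)) = tail (\<lambda>s. g s * tail f s) x"
  proof -
    have "(LINT s|lebesgue. of_bool (t \<le> s) * (?f s * ?g t)) = of_bool (x < t) * (g t * tail f t)" for t
    proof -
      have "(LINT s|lebesgue. of_bool (t \<le> s) * (?f s * ?g t)) = (LINT s|lebesgue. ?g t * (of_bool (t \<le> s) * f s))"
        by (rule Bochner_Integration.integral_cong) (auto simp: of_bool_def)
      then show ?thesis unfolding tail_eq_closed[OF fm] by (simp only: integral_mult_right_zero mult.assoc)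
    qed
    then show ?thesis unfolding lebesgue_pair.integral_snd[OF i2, symmetric] tail_eq[of _ x] by simp
  qed
  finally show ?thesis .
qed

section \<open>The Volterra series\<close>

text \<open>The integrable solution \<open>w\<close> of \<open>- w' - 2 i k w = F\<close>. Inserting
  \<open>f = exp (i k x) m\<close> into the Schroedinger equation gives
  \<open>m'' + 2 i k m' = V m\<close>, so \<open>m' = - Psi k (V m)\<close>.\<close>

definition Psi :: "complex \<Rightarrow> (real \<Rightarrow> complex) \<Rightarrow> real \<Rightarrow> complex" where
  "Psi k F t = (LINT x|lebesgue. half_exp (2 * k) t x * F x)"

text \<open>\<open>- sin (k (x - t)) / k\<close> conjugated by \<open>exp (i k x)\<close>, cut off to \<open>x < t\<close>.\<close>

definition jker :: "complex \<Rightarrow> real \<Rightarrow> real \<Rightarrow> complex" where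
  "jker k x t = (if x < t then \<i> / (2 * k) * (1 - exp (2 * \<i> * k * of_real (t - x))) else 0)"

lemma norm_half_exp_double: "norm (half_exp (2 * k) t x) = (norm (half_exp k t x))\<^sup>2"
  by (simp add: half_exp_def power2_eq_square flip: exp_add)

lemma half_exp_measurable [measurable]:
  "(\<lambda>x. half_exp k t x) \<in> borel_measurable lebesgue" "(\<lambda>t. half_exp k t x) \<in> borel_measurable lebesgue"
  unfolding half_exp_def by (rule measurable_completion, measurable)+

lemma half_exp_integrable:
  assumes k: "Im k > 0"
  shows "integrable lebesgue (\<lambda>t. half_exp (2 * k) t x)"
    and "(LINT t|lebesgue. norm (half_exp (2 * k) t x)) = 1 / (2 * Im k)"
    and "(LINT t|lebesgue. half_exp (2 * k) t x) = \<i> / (2 * k)"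
proof -
  have sq: "half_exp (2 * k) t x = half_exp k t x * half_exp k t x" for t
    by (simp add: half_exp_def algebra_simps flip: exp_add)
  show "integrable lebesgue (\<lambda>t. half_exp (2 * k) t x)"
    unfolding sq by (rule half_exp_integral(1)[OF k])
  show "(LINT t|lebesgue. norm (half_exp (2 * k) t x)) = 1 / (2 * Im k)"
    unfolding norm_half_exp_double using half_exp_L2(2)[OF k, of x] by (simp add: l2_norm_square)
  show "(LINT t|lebesgue. half_exp (2 * k) t x) = \<i> / (2 * k)"
    unfolding sq half_exp_integral(2)[OF k] by simp
qed

lemma Psi_pair_integrable:
  assumes k: "Im k > 0" and F: "integrable lebesgue F"
  shows "integrable lebesgue2 (\<lambda>(x, t). half_exp (2 * k) t x * F x)"
proof (rule lebesgue_pair.Fubini_integrable)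
  have [measurable]: "F \<in> borel_measurable lebesgue" using F by auto
  note [measurable] = measurable_half_exp'
  have "(\<lambda>p. (case p of (x, t) \<Rightarrow> half_exp (2 * k) t x) * F (fst p)) \<in> borel_measurable lebesgue2"
    by measurable
  then show "(\<lambda>(x, t). half_exp (2 * k) t x * F x) \<in> borel_measurable lebesgue2"
    by (simp add: case_prod_unfold)
  show "integrable lebesgue (\<lambda>x. LINT t|lebesgue. norm (case (x, t) of (x, t) \<Rightarrow> half_exp (2 * k) t x * F x))"
    using F by (simp add: norm_mult half_exp_integrable(2)[OF k])
  show "AE x in lebesgue. integrable lebesgue (\<lambda>t. case (x, t) of (x, t) \<Rightarrow> half_exp (2 * k) t x * F x)"
    using half_exp_integrable(1)[OF k] by simp
qed

lemma Psi_integrable: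
  assumes k: "Im k > 0" and F: "integrable lebesgue F"
  shows "integrable lebesgue (Psi k F)"
  using lebesgue_pair.integrable_snd[OF Psi_pair_integrable[OF assms]] by (simp add: Psi_def[abs_def])

lemma half_exp_mult_integrable:
  assumes k: "Im k > 0" and F: "integrable lebesgue F"
  shows "integrable lebesgue (\<lambda>x. half_exp k t x * F x)"
proof (rule Bochner_Integration.integrable_bound[OF F])
  have [measurable]: "F \<in> borel_measurable lebesgue" using F by auto
  show "(\<lambda>x. half_exp k t x * F x) \<in> borel_measurable lebesgue" by measurable
  show "AE x in lebesgue. norm (half_exp k t x * F x) \<le> norm (F x)"
    using norm_half_exp_le[OF k] by (auto intro!: AE_I2 simp: norm_mult mult_left_le_one_le)
qed

lemma half_exp_tail:
  assumes k: "Im k > 0"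
  shows "(LINT y|lebesgue. of_bool (x < y) * half_exp (2 * k) y t) = jker k x t"
proof (cases "x < t")
  case False
  then have "(\<lambda>y. of_bool (x < y) * half_exp (2 * k) y t) = (\<lambda>y. 0)" by (auto simp: half_exp_def)
  then show ?thesis using False by (simp only:) (simp add: jker_def)
next
  case True
  let ?h = "\<lambda>y. half_exp (2 * k) y t"
  have "tail ?h x = (LINT y|lebesgue. of_bool (x \<le> y) * ?h y)"
    by (rule tail_eq_closed) measurable
  \<comment> \<open>The integral over \<open>y \<ge> x\<close> is the whole integral minus the part
    over \<open>y < x\<close>, where the two exponentials differ by the constant factor
    \<open>exp (2 i k (t - x))\<close>.\<close>
  also have "\<dots> = (LINT y|lebesgue. ?h y - exp (2 * \<i> * k * of_real (t - x)) * half_exp (2 * k) y x)"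
  proof (rule Bochner_Integration.integral_cong[OF refl])
    fix y
    have "exp (\<i> * (2 * k) * of_real (t - y)) = exp (2 * \<i> * k * of_real (t - x)) * exp (\<i> * (2 * k) * of_real (x - y))"
      unfolding mult_exp_exp by (simp add: algebra_simps)
    then show "of_bool (x \<le> y) * ?h y = ?h y - exp (2 * \<i> * k * of_real (t - x)) * half_exp (2 * k) y x"
      using True by (auto simp: half_exp_def)
  qed
  also have "\<dots> = (LINT y|lebesgue. ?h y) - (LINT y|lebesgue. exp (2 * \<i> * k * of_real (t - x)) * half_exp (2 * k) y x)"
    by (intro Bochner_Integration.integral_diff integrable_mult_right half_exp_integrable k)
  also have "\<dots> = jker k x t"
    using True by (simp only: integral_mult_right_zero half_exp_integrable(3)[OF k]) (simp add: jker_def algebra_simps)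
  finally show ?thesis by (simp add: tail_eq)
qed

text \<open>Links the two forms of the Volterra iteration: the left side can be differentiated, the
  right side is the kernel of the Jost equation.\<close>

lemma tail_Psi:
  assumes k: "Im k > 0" and F: "integrable lebesgue F"
  shows "tail (Psi k F) x = (LINT t|lebesgue. jker k x t * F t)"
proof -
  have b: "integrable lebesgue2 (\<lambda>(t, y). of_bool (x < y) * (half_exp (2 * k) y t * F t))"
  proof (rule Bochner_Integration.integrable_bound[OF Psi_pair_integrable[OF k F]])
    have [measurable]: "(\<lambda>(t, y). half_exp (2 * k) y t * F t) \<in> borel_measurable lebesgue2"
      using Psi_pair_integrable[OF k F] by auto
    have "(\<lambda>y. of_bool (x < y) :: complex) \<in> borel_measurable lebesgue"
      unfolding of_bool_def by (rule measurable_completion) measurable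
    from measurable_compose[OF measurable_snd this]
    have [measurable]: "(\<lambda>p. of_bool (x < snd p) :: complex) \<in> borel_measurable ((lebesgue :: real measure) \<Otimes>\<^sub>M lebesgue)" .
    have "(\<lambda>p. of_bool (x < snd p) * (case p of (t, y) \<Rightarrow> half_exp (2 * k) y t * F t)) \<in> borel_measurable lebesgue2"
      by measurable
    then show "(\<lambda>(t, y). of_bool (x < y) * (half_exp (2 * k) y t * F t)) \<in> borel_measurable lebesgue2"
      by (simp add: case_prod_unfold)
    show "AE p in lebesgue2. norm (case p of (t, y) \<Rightarrow> of_bool (x < y) * (half_exp (2 * k) y t * F t))
        \<le> norm (case p of (t, y) \<Rightarrow> half_exp (2 * k) y t * F t)"
      by (auto intro!: AE_I2 simp: norm_mult of_bool_def)
  qed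
  have "tail (Psi k F) x = (LINT y|lebesgue. LINT t|lebesgue. of_bool (x < y) * (half_exp (2 * k) y t * F t))"
    unfolding tail_eq Psi_def by (simp only: integral_mult_right_zero)
  also have "\<dots> = (LINT t|lebesgue. LINT y|lebesgue. of_bool (x < y) * (half_exp (2 * k) y t * F t))"
    by (rule lebesgue_pair.Fubini_integral[OF b])
  also have "\<dots> = (LINT t|lebesgue. jker k x t * F t)"
    unfolding half_exp_tail[OF k, symmetric] mult.assoc[symmetric] by simp
  finally show ?thesis .
qed

lemma norm_jker_le:
  assumes k: "Im k > 0"
  shows "norm (jker k x t) \<le> of_bool (x < t) / norm k"
proof (cases "x < t")
  case True
  have "norm (1 - exp (2 * \<i> * k * of_real (t - x))) \<le> 1 + norm (exp (2 * \<i> * k * of_real (t - x)))"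
    by (metis norm_one norm_triangle_ineq4)
  also have "\<dots> \<le> 2" using k True by simp
  finally have "1 / (2 * norm k) * norm (1 - exp (2 * \<i> * k * of_real (t - x))) \<le> 1 / (2 * norm k) * 2"
    by (rule mult_left_mono) simp
  moreover have "norm (jker k x t) = 1 / (2 * norm k) * norm (1 - exp (2 * \<i> * k * of_real (t - x)))"
    using True unfolding jker_def by (simp add: norm_mult norm_divide)
  ultimately show ?thesis using True by simp
qed (simp add: jker_def)

lemma jker_measurable [measurable]: "jker k x \<in> borel_measurable lebesgue"
  unfolding jker_def[abs_def] by (rule measurable_completion) measurable

lemma jker_mult_integrable:
  assumes k: "Im k > 0" and F: "integrable lebesgue F"
  shows "integrable lebesgue (\<lambda>t. jker k x t * F t)"
proof (rule Bochner_Integration.integrable_bound[OF integrable_mult_right[OF F, of "1 / of_real (norm k)"]])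
  have [measurable]: "F \<in> borel_measurable lebesgue" using F by auto
  show "(\<lambda>t. jker k x t * F t) \<in> borel_measurable lebesgue" by measurable
  show "AE t in lebesgue. norm (jker k x t * F t) \<le> norm (1 / of_real (norm k) * F t)"
  proof (rule AE_I2)
    fix t
    have "norm (jker k x t) \<le> 1 / norm k" using norm_jker_le[OF k, of x t]
      by (auto simp: of_bool_def split: if_splits intro: order_trans)
    then have "norm (jker k x t) * norm (F t) \<le> 1 / norm k * norm (F t)" by (rule mult_right_mono) simp
    then show "norm (jker k x t * F t) \<le> norm (1 / of_real (norm k) * F t)" by (simp add: norm_mult norm_divide)
  qed
qed

section \<open>Iterated tail integrals and their factorial bounds\<close>

primrec wtail :: "(real \<Rightarrow> real) \<Rightarrow> nat \<Rightarrow> real \<Rightarrow> real" where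
  "wtail w 0 = (\<lambda>x. 1)"
| "wtail w (Suc n) = tail (\<lambda>t. w t * wtail w n t)"

lemma wtail_integrable:
  assumes w: "integrable lebesgue w"
  shows "integrable lebesgue (\<lambda>t. w t * wtail w n t)"
  by (induction n) (auto simp: w integrable_mult_tail)

lemma wtail_nonneg: "(\<And>x. w x \<ge> 0) \<Longrightarrow> wtail w n x \<ge> 0"
  by (induction n arbitrary: x) (auto simp: tail_eq)

text \<open>\<open>wtail w n x\<close> integrates the product of the \<open>w (t i)\<close> over the
  ordered points \<open>x < t 1 < ... < t n\<close>, so it is the \<open>n\<close>-th power of
  \<open>tail w x\<close> divided by \<open>fact n\<close>. This is the inductive form of that
  identity, obtained by integration by parts.\<close>

lemma tail_mult_wtail:
  assumes w: "integrable lebesgue w"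
  shows "tail w x * wtail w n x = real (Suc n) * wtail w (Suc n) x"
proof (induction n arbitrary: x)
  case 0 then show ?case by simp
next
  case (Suc n)
  have "tail w x * wtail w (Suc n) x = tail (\<lambda>s. w s * wtail w (Suc n) s) x + tail (\<lambda>s. w s * wtail w n s * tail w s) x"
    using tail_product[OF w wtail_integrable[OF w, of n]] by simp
  also have "(\<lambda>s. w s * wtail w n s * tail w s) = (\<lambda>s. real (Suc n) * (w s * wtail w (Suc n) s))"
    using Suc.IH by (simp add: fun_eq_iff mult.assoc mult.left_commute) (metis mult.commute mult.left_commute)
  also have "tail (\<lambda>s. real (Suc n) * (w s * wtail w (Suc n) s)) x = real (Suc n) * tail (\<lambda>s. w s * wtail w (Suc n) s) x"
    unfolding tail_eq by (subst integral_mult_right_zero[symmetric]) (simp only: mult.left_commute)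
  finally show ?case by (simp add: algebra_simps)
qed

lemma wtail_le:
  assumes w: "integrable lebesgue w" and nonneg: "\<And>x. w x \<ge> 0"
  shows "wtail w n x \<le> (LINT t|lebesgue. w t) ^ n / fact n"
proof (induction n)
  case 0 then show ?case by simp
next
  case (Suc n)
  let ?c = "LINT t|lebesgue. w t"
  have "real (Suc n) * wtail w (Suc n) x = tail w x * wtail w n x" by (rule tail_mult_wtail[OF w, symmetric])
  also have "\<dots> \<le> ?c * (?c ^ n / fact n)"
    using norm_tail_le[OF w, of x] nonneg Suc.IH wtail_nonneg[of w n x]
    by (intro mult_mono) auto
  finally have "wtail w (Suc n) x \<le> ?c * (?c ^ n / fact n) / real (Suc n)"
    by (subst pos_le_divide_eq) (simp_all only: mult.commute of_nat_0_less_iff zero_less_Suc)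
  also have "\<dots> = ?c ^ Suc n / fact (Suc n)" by simp
  finally show ?case .
qed

primrec mser :: "(real \<Rightarrow> complex) \<Rightarrow> complex \<Rightarrow> nat \<Rightarrow> real \<Rightarrow> complex" where
  "mser V k 0 = (\<lambda>x. 1)"
| "mser V k (Suc n) = tail (Psi k (\<lambda>t. V t * mser V k n t))"

lemma V_mser_integrable:
  assumes V: "integrable lebesgue V" and k: "Im k > 0"
  shows "integrable lebesgue (\<lambda>t. V t * mser V k n t)"
proof (induction n)
  case (Suc n)
  then show ?case using integrable_mult_tail[OF V Psi_integrable[OF k]] by simp
qed (simp add: V)

lemma mser_Suc_eq:
  assumes V: "integrable lebesgue V" and k: "Im k > 0"
  shows "mser V k (Suc n) x = (LINT t|lebesgue. jker k x t * (V t * mser V k n t))"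
  using tail_Psi[OF k V_mser_integrable[OF V k]] by simp

text \<open>As \<open>jker\<close> is bounded by \<open>1 / norm k\<close>, every iteration costs at
  most one ordered integration of \<open>norm V / norm k\<close>.\<close>

lemma norm_mser_le_wtail:
  assumes V: "integrable lebesgue V" and k: "Im k > 0"
  shows "norm (mser V k n x) \<le> wtail (\<lambda>t. norm (V t) / norm k) n x"
proof (induction n arbitrary: x)
  case (Suc n)
  let ?w = "\<lambda>t. norm (V t) / norm k"
  have w: "integrable lebesgue ?w" using V by (intro integrable_divide integrable_norm)
  have "norm (mser V k (Suc n) x) \<le> (LINT t|lebesgue. norm (jker k x t * (V t * mser V k n t)))"
    unfolding mser_Suc_eq[OF V k] by (rule integral_norm_bound)
  also have "\<dots> \<le> (LINT t|lebesgue. of_bool (x < t) * (?w t * wtail ?w n t))"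
  proof (rule integral_mono)
    show "integrable lebesgue (\<lambda>t. norm (jker k x t * (V t * mser V k n t)))"
      by (intro integrable_norm jker_mult_integrable k V_mser_integrable V)
    show "integrable lebesgue (\<lambda>t. of_bool (x < t) * (?w t * wtail ?w n t))"
      using integrable_of_bool_mult[OF wtail_integrable[OF w, of n], of "{x<..}"] by simp
    fix t
    have "norm (jker k x t) * (norm (V t) * norm (mser V k n t)) \<le> (of_bool (x < t) / norm k) * (norm (V t) * wtail ?w n t)"
      by (intro mult_mono norm_jker_le k Suc.IH mult_nonneg_nonneg order_refl) auto
    then show "norm (jker k x t * (V t * mser V k n t)) \<le> of_bool (x < t) * (?w t * wtail ?w n t)"
      by (simp add: norm_mult)
  qed
  also have "\<dots> = wtail ?w (Suc n) x" by (simp add: tail_eq)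
  finally show ?case .
qed simp

lemma norm_mser_le:
  assumes V: "integrable lebesgue V" and k: "Im k > 0"
  shows "norm (mser V k n x) \<le> ((LINT t|lebesgue. norm (V t)) / norm k) ^ n / fact n"
proof -
  have w: "integrable lebesgue (\<lambda>t. norm (V t) / norm k)" using V by (intro integrable_divide integrable_norm)
  have "norm (mser V k n x) \<le> wtail (\<lambda>t. norm (V t) / norm k) n x" by (rule norm_mser_le_wtail[OF V k])
  also have "\<dots> \<le> (LINT t|lebesgue. norm (V t) / norm k) ^ n / fact n" by (rule wtail_le[OF w]) simp
  finally show ?thesis by simp
qed

section \<open>Evaluation of the exterior traces\<close>

text \<open>The matrix is the product of a lower and an upper triangular one, as \<open>c (min a b)\<close> telescopes.\<close>

lemma det_min_kernel:
  fixes e c :: "nat \<Rightarrow> complex"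
  shows "Determinant.det (mat n n (\<lambda>(a, b). e a * e b * c (min a b)))
    = (\<Prod>a\<in>{0..<n}. (e a)\<^sup>2 * (c a - (if a = 0 then 0 else c (a - 1))))"
proof -
  let ?d = "\<lambda>a. c a - (if a = 0 then 0 else c (a - 1))"
  let ?A = "mat n n (\<lambda>(a, l). if l \<le> a then e a else 0)"
  let ?B = "mat n n (\<lambda>(l, b). if l \<le> b then ?d l * e b else 0)"
  have tele: "(\<Sum>l\<in>{0..m}. ?d l) = c m" for m
    by (induction m) auto
  have "mat n n (\<lambda>(a, b). e a * e b * c (min a b)) = ?A * ?B"
  proof (rule eq_matI)
    fix a b assume "a < dim_row (?A * ?B)" "b < dim_col (?A * ?B)"
    then have ab: "a < n" "b < n" by auto
    have "(?A * ?B) $$ (a, b) = (\<Sum>l\<in>{0..<n}. (if l \<le> a then e a else 0) * (if l \<le> b then ?d l * e b else 0))"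
      using ab by (simp add: scalar_prod_def)
    also have "\<dots> = (\<Sum>l\<in>{0..min a b}. e a * e b * ?d l)"
      using ab by (intro sum.mono_neutral_cong_right) auto
    also have "\<dots> = e a * e b * c (min a b)"
      unfolding sum_distrib_left[symmetric] tele ..
    finally show "mat n n (\<lambda>(a, b). e a * e b * c (min a b)) $$ (a, b) = (?A * ?B) $$ (a, b)"
      using ab by simp
  qed auto
  then have "Determinant.det (mat n n (\<lambda>(a, b). e a * e b * c (min a b))) = Determinant.det ?A * Determinant.det ?B"
    by (simp add: Determinant.det_mult[of _ n])
  also have "Determinant.det ?A = (\<Prod>a\<in>{0..<n}. e a)"
    by (subst det_lower_triangular[of n]) (auto simp: prod_list_diag_prod)
  also have "Determinant.det ?B = (\<Prod>a\<in>{0..<n}. ?d a * e a)"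
    by (subst Determinant.det_transpose[symmetric, of _ n], simp, subst det_lower_triangular[of n]) (auto simp: prod_list_diag_prod)
  finally show ?thesis by (simp add: prod.distrib[symmetric] power2_eq_square ac_simps)
qed

section \<open>The dual kernel at decreasing points\<close>

definition hfun :: "(real \<Rightarrow> complex) \<Rightarrow> complex \<Rightarrow> real \<Rightarrow> complex" where
  "hfun V k s = tail (\<lambda>x. exp (2 * \<i> * k * of_real x) * V x) s"

definition qker :: "(real \<Rightarrow> complex) \<Rightarrow> complex \<Rightarrow> real \<Rightarrow> real \<Rightarrow> complex" where
  "qker V k t s = of_bool (t < s) * (exp (- 2 * \<i> * k * of_real t) * (hfun V k t - hfun V k s))"

lemma half_exp_double_eq:
  "half_exp (2 * k) s x = exp (- 2 * \<i> * k * of_real s) * (of_bool (s < x) * exp (2 * \<i> * k * of_real x))"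
  by (simp add: half_exp_def mult_exp_exp algebra_simps)

lemma of_bool_exp_eq:
  "of_bool (s < x) * exp (2 * \<i> * k * of_real x) = exp (2 * \<i> * k * of_real s) * half_exp (2 * k) s x"
  unfolding half_exp_double_eq by (simp add: mult.assoc[symmetric] mult_exp_exp)

lemma hfun_integrable:
  assumes V: "integrable lebesgue V" and k: "Im k > 0"
  shows "integrable lebesgue (\<lambda>x. of_bool (s < x) * (exp (2 * \<i> * k * of_real x) * V x))"
proof -
  have "integrable lebesgue (\<lambda>x. exp (2 * \<i> * k * of_real s) * (half_exp (2 * k) s x * V x))"
    using k by (intro integrable_mult_right half_exp_mult_integrable V) simp
  then show ?thesis unfolding mult.assoc[symmetric] of_bool_exp_eq by simp
qed

lemma Psi_eq_hfun: "Psi k V s = exp (- 2 * \<i> * k * of_real s) * hfun V k s"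
  unfolding Psi_def hfun_def tail_eq integral_mult_right_zero[symmetric] half_exp_double_eq
  by (simp add: mult.assoc)

lemma hfun_measurable:
  assumes "V \<in> borel_measurable lebesgue"
  shows "hfun V k \<in> borel_measurable lebesgue"
  unfolding hfun_def[abs_def]
proof (rule measurable_tail)
  have "(\<lambda>x. exp (2 * \<i> * k * of_real x)) \<in> borel_measurable (lebesgue :: real measure)"
    by (rule measurable_completion) measurable
  then show "(\<lambda>x. exp (2 * \<i> * k * of_real x) * V x) \<in> borel_measurable lebesgue"
    using assms by (rule borel_measurable_times)
qed

lemma dual_kernel_eq:
  "dual_kernel V k y y' = exp (- \<i> * k * of_real y) * exp (- \<i> * k * of_real y') * hfun V k (max y y')"
  unfolding dual_kernel_def hfun_def tail_eq integral_mult_right_zero[symmetric]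
proof (rule Bochner_Integration.integral_cong[OF refl])
  fix x
  show "V x * half_exp k y x * half_exp k y' x = exp (- \<i> * k * of_real y) * exp (- \<i> * k * of_real y') *
      (of_bool (max y y' < x) * (exp (2 * \<i> * k * of_real x) * V x))"
    by (cases "max y y' < x") (auto simp: half_exp_def mult_exp_exp algebra_simps)
qed

text \<open>At decreasing points the maximum of two points belongs to the smaller index, which is
  the shape of \<open>det_min_kernel\<close>. The first point has no predecessor; the value
  \<open>0\<close> used there is the limit of \<open>hfun\<close> at plus infinity.\<close>

lemma det_dual_kernel:
  assumes "sorted_fun (>) n y"
  shows "Determinant.det (mat n n (\<lambda>(a, b). dual_kernel V k (y a) (y b)))
    = (\<Prod>a\<in>{0..<n}. exp (- 2 * \<i> * k * of_real (y a)) * (hfun V k (y a) - (if a = 0 then 0 else hfun V k (y (a - 1)))))"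
proof -
  let ?e = "\<lambda>a. exp (- \<i> * k * of_real (y a))"
  have "max (y a) (y b) = y (min a b)" if "a < n" "b < n" for a b
    using assms that unfolding sorted_fun_def by (cases a b rule: linorder_cases) (auto simp: max_def min_def, force+)
  then have "mat n n (\<lambda>(a, b). dual_kernel V k (y a) (y b)) = mat n n (\<lambda>(a, b). ?e a * ?e b * hfun V k (y (min a b)))"
    by (intro eq_matI) (auto simp: dual_kernel_eq)
  moreover have "(?e a)\<^sup>2 = exp (- 2 * \<i> * k * of_real (y a))" for a
    by (simp add: power2_eq_square mult_exp_exp mult.assoc)
  ultimately show ?thesis using det_min_kernel[of n ?e "\<lambda>a. hfun V k (y a)"] by simp
qed

text \<open>\<open>qker V k t s\<close> is the factor that a new lowest point \<open>t\<close>
  contributes when the previous one is \<open>s\<close>. The difference of the two values of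
  \<open>hfun\<close> is an integral over the bounded range from \<open>t\<close> to
  \<open>s\<close>, which the exponential prefactor keeps under control.\<close>

lemma qker_eq_Psi:
  assumes V: "integrable lebesgue V" and k: "Im k > 0"
  shows "qker V k t s = Psi k (\<lambda>x. of_bool (x \<le> s) * V x) t"
proof (cases "t < s")
  case False
  then have "half_exp (2 * k) t x * (of_bool (x \<le> s) * V x) = 0" for x by (auto simp: half_exp_def)
  then have "(\<lambda>x. half_exp (2 * k) t x * (of_bool (x \<le> s) * V x)) = (\<lambda>x. 0)" by blast
  then show ?thesis using False by (simp add: qker_def Psi_def)
next
  case True
  have "hfun V k t - hfun V k s = (LINT x|lebesgue. of_bool (t < x) * (exp (2 * \<i> * k * of_real x) * V x) - of_bool (s < x) * (exp (2 * \<i> * k * of_real x) * V x))"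
    unfolding hfun_def tail_eq by (rule Bochner_Integration.integral_diff[symmetric]) (rule hfun_integrable[OF V k])+
  also have "exp (- 2 * \<i> * k * of_real t) * \<dots> = Psi k (\<lambda>x. of_bool (x \<le> s) * V x) t"
    unfolding Psi_def integral_mult_right_zero[symmetric]
    by (rule Bochner_Integration.integral_cong[OF refl]) (use True in \<open>auto simp: half_exp_double_eq of_bool_def\<close>)
  finally show ?thesis using True by (simp add: qker_def)
qed

text \<open>The bound does not involve \<open>s\<close> and is integrable in \<open>t\<close> by
  \<open>qker_bound_integrable\<close>, so it dominates all integrations over the lowest
  point.\<close>

lemma norm_qker_le:
  assumes V: "integrable lebesgue V" and k: "Im k > 0"
  shows "norm (qker V k t s) \<le> (LINT x|lebesgue. norm (half_exp (2 * k) t x * V x))"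
proof -
  have i: "integrable lebesgue (\<lambda>x. half_exp (2 * k) t x * V x)"
    using k by (intro half_exp_mult_integrable V) simp
  have m: "integrable lebesgue (\<lambda>x. of_bool (x \<le> s) * (half_exp (2 * k) t x * V x))"
    using integrable_of_bool_mult[OF i, of "{..s}"] by simp
  have "norm (qker V k t s) \<le> (LINT x|lebesgue. norm (of_bool (x \<le> s) * (half_exp (2 * k) t x * V x)))"
    unfolding qker_eq_Psi[OF V k] Psi_def by (subst mult.left_commute) (rule integral_norm_bound)
  also have "\<dots> \<le> (LINT x|lebesgue. norm (half_exp (2 * k) t x * V x))"
    by (intro integral_mono integrable_norm i m) (auto simp: of_bool_def)
  finally show ?thesis .
qed

lemma qker_bound_integrable:
  assumes V: "integrable lebesgue V" and k: "Im k > 0"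
  shows "integrable lebesgue (\<lambda>t. LINT x|lebesgue. norm (half_exp (2 * k) t x * V x))"
proof -
  have "integrable lebesgue2 (\<lambda>(x, t). norm (half_exp (2 * k) t x * V x))"
    using integrable_norm[OF Psi_pair_integrable[OF k V]] by (simp add: case_prod_unfold)
  from lebesgue_pair.integrable_snd[OF this] show ?thesis .
qed

text \<open>Integrating over \<open>s \<ge> x\<close> first leaves \<open>tail F x\<close>. Thus the
  transition kernel acts as \<open>F \<mapsto> Psi k (V * tail F)\<close>, which is precisely the
  recursion of \<open>mser\<close>.\<close>

lemma integral_mult_qker:
  assumes V: "integrable lebesgue V" and k: "Im k > 0" and F: "integrable lebesgue F"
  shows "(LINT s|lebesgue. F s * qker V k t s) = Psi k (\<lambda>x. V x * tail F x) t"
proof -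
  have Fm: "F \<in> borel_measurable lebesgue" using F by auto
  have hV: "integrable lebesgue (\<lambda>x. half_exp (2 * k) t x * V x)"
    using k by (intro half_exp_mult_integrable V) simp
  have i: "integrable lebesgue2 (\<lambda>(s, x). of_bool (x \<le> s) * (F s * (half_exp (2 * k) t x * V x)))"
    by (rule integrable_pair_bounded_mult[OF F hV measurable_of_bool_less_pair(2)]) auto
  have "(LINT s|lebesgue. F s * qker V k t s) = (LINT s|lebesgue. LINT x|lebesgue. of_bool (x \<le> s) * (F s * (half_exp (2 * k) t x * V x)))"
    unfolding qker_eq_Psi[OF V k] Psi_def integral_mult_right_zero[symmetric] by (simp only: ac_simps)
  also have "\<dots> = (LINT x|lebesgue. LINT s|lebesgue. of_bool (x \<le> s) * (F s * (half_exp (2 * k) t x * V x)))"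
    by (rule lebesgue_pair.Fubini_integral[OF i, symmetric])
  also have "\<dots> = Psi k (\<lambda>x. V x * tail F x) t"
    unfolding Psi_def tail_eq_closed[OF Fm] integral_mult_right_zero[symmetric] by (simp only: ac_simps)
  finally show ?thesis .
qed

definition chain_weight :: "(real \<Rightarrow> complex) \<Rightarrow> complex \<Rightarrow> nat \<Rightarrow> (nat \<Rightarrow> real) \<Rightarrow> complex" where
  "chain_weight V k n y = (if sorted_fun (>) n y
     then (\<Prod>a\<in>{0..<n}. exp (- 2 * \<i> * k * of_real (y a)) * (hfun V k (y a) - (if a = 0 then 0 else hfun V k (y (a - 1)))))
     else 0)"

lemma chain_weight_eq_det:
  "chain_weight V k n y = (if sorted_fun (>) n y then Determinant.det (mat n n (\<lambda>(a, b). dual_kernel V k (y a) (y b))) else 0)"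
  by (simp add: chain_weight_def det_dual_kernel)

text \<open>The index \<open>Suc n\<close> belongs to the smallest point; it is integrated first, against the weight \<open>g\<close>
  of the lemma \<open>integral_chain_weight\<close>.\<close>

lemma chain_weight_upd:
  "chain_weight V k (Suc (Suc n)) (y(Suc n := t)) = chain_weight V k (Suc n) y * qker V k t (y n)"
proof -
  have s: "sorted_fun (>) (Suc (Suc n)) (y(Suc n := t)) \<longleftrightarrow> sorted_fun (>) (Suc n) y \<and> t < y n"
    unfolding sorted_fun_def
    by (auto simp: less_Suc_eq) (metis less_trans lessI less_antisym)+
  have "(\<Prod>a\<in>{0..<Suc n}. exp (- 2 * \<i> * k * of_real ((y(Suc n := t)) a)) * (hfun V k ((y(Suc n := t)) a) - (if a = 0 then 0 else hfun V k ((y(Suc n := t)) (a - 1)))))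
      = (\<Prod>a\<in>{0..<Suc n}. exp (- 2 * \<i> * k * of_real (y a)) * (hfun V k (y a) - (if a = 0 then 0 else hfun V k (y (a - 1)))))"
    by (rule prod.cong) auto
  then show ?thesis unfolding chain_weight_def s prod.atLeast0_lessThan_Suc[of _ "Suc n"]
    by (simp add: qker_def del: prod.op_ivl_Suc)
qed

text \<open>The bounded weight \<open>g\<close> on the lowest point lets the induction close; the
  traces are the case \<open>g = 1\<close>.\<close>

lemma integral_chain_weight:
  assumes V: "integrable lebesgue V" and k: "Im k > 0"
    and int: "\<And>n. integrable (PiM {0..<n} (\<lambda>_. lebesgue)) (chain_weight V k n)"
    and g: "g \<in> borel_measurable lebesgue" and B: "\<And>t. norm (g t) \<le> B"
  shows "(LINT y|PiM {0..<Suc n} (\<lambda>_. lebesgue). chain_weight V k (Suc n) y * g (y n))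
    = (LINT t|lebesgue. Psi k (\<lambda>t. V t * mser V k n t) t * g t)"
  using g B
proof (induction n arbitrary: g B)
  case 0
  have [measurable]: "g \<in> borel_measurable lebesgue" by fact
  interpret product_sigma_finite "\<lambda>_::nat. lebesgue :: real measure"
    by (rule product_sigma_finite_const) (rule lebesgue.sigma_finite_measure_axioms)
  have "chain_weight V k (Suc 0) y = Psi k V (y 0)" for y
    by (simp add: chain_weight_def sorted_fun_def Psi_eq_hfun)
  then have "(LINT y|PiM {0..<Suc 0} (\<lambda>_. lebesgue). chain_weight V k (Suc 0) y * g (y 0))
      = (LINT y|PiM {0::nat} (\<lambda>_. lebesgue). Psi k V (y 0) * g (y 0))" by simp
  also have "\<dots> = (LINT t|lebesgue. Psi k V t * g t)"
  proof (rule product_integral_singleton)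
    have [measurable]: "Psi k V \<in> borel_measurable lebesgue" using Psi_integrable[OF k V] by auto
    show "(\<lambda>t. Psi k V t * g t) \<in> borel_measurable lebesgue" by measurable
  qed
  finally show ?case by simp
next
  case (Suc n)
  have [measurable]: "g \<in> borel_measurable lebesgue" by fact
  have [measurable]: "hfun V k \<in> borel_measurable lebesgue" using V by (intro hfun_measurable) auto
  interpret product_sigma_finite "\<lambda>_::nat. lebesgue :: real measure"
    by (rule product_sigma_finite_const) (rule lebesgue.sigma_finite_measure_axioms)
  let ?P = "\<lambda>n. PiM {0..<n} (\<lambda>_. lebesgue :: real measure)"
  let ?F = "Psi k (\<lambda>t. V t * mser V k n t)"
  let ?Q = "\<lambda>t. LINT x|lebesgue. norm (half_exp (2 * k) t x * V x)"
  have F: "integrable lebesgue ?F" by (rule Psi_integrable[OF k V_mser_integrable[OF V k]])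
  have Qi: "integrable lebesgue ?Q" by (rule qker_bound_integrable[OF V k])
  have B0: "B \<ge> 0" using Suc.prems(2)[of 0] norm_ge_zero order_trans by blast
  \<comment> \<open>Integrating out the lowest point \<open>t\<close> turns the weight
    \<open>g\<close> into the weight \<open>S\<close> on the next lowest point \<open>s\<close>,
    again measurable and bounded, to which the induction hypothesis applies.\<close>
  define S where "S s = (LINT t|lebesgue. qker V k t s * g t)" for s
  have expm: "(\<lambda>x. exp (- 2 * \<i> * k * of_real x)) \<in> borel_measurable (lebesgue :: real measure)"
    by (rule measurable_completion) measurable
  note [measurable] = measurable_of_bool_less_pair(1)[where 'a=complex] expm
  have qm: "(\<lambda>(t, s). qker V k t s) \<in> borel_measurable lebesgue2"
  proof -
    have "(\<lambda>p. (case p of (t, s) \<Rightarrow> of_bool (t < s)) * (exp (- 2 * \<i> * k * of_real (fst p)) * (hfun V k (fst p) - hfun V k (snd p))))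
        \<in> borel_measurable lebesgue2"
      by (intro borel_measurable_times borel_measurable_diff measurable_of_bool_less_pair measurable_compose[OF measurable_fst expm]) measurable
    then show ?thesis by (simp add: qker_def case_prod_unfold)
  qed
  from measurable_compose[OF measurable_pair_swap' this]
  have [measurable]: "(\<lambda>p. qker V k (snd p) (fst p)) \<in> borel_measurable lebesgue2" by (simp add: case_prod_unfold)
  have Sm: "S \<in> borel_measurable lebesgue"
  proof -
    have "(\<lambda>p. qker V k (snd p) (fst p) * g (snd p)) \<in> borel_measurable lebesgue2" by measurable
    then have "(\<lambda>(s, t). qker V k t s * g t) \<in> borel_measurable lebesgue2" by (simp add: case_prod_unfold)
    then show ?thesis unfolding S_def[abs_def] by (rule lebesgue.borel_measurable_lebesgue_integral)
  qed
  have qg: "norm (qker V k t s * g t) \<le> ?Q t * B" for t s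
    unfolding norm_mult[of "qker V k t s" "g t"] by (intro mult_mono norm_qker_le[OF V k] Suc.prems(2)) auto
  have [measurable]: "(\<lambda>t. qker V k t s) \<in> borel_measurable lebesgue" for s
    using measurable_compose[OF measurable_Pair2'[of s lebesgue lebesgue] qm] by simp
  have qgi: "integrable lebesgue (\<lambda>t. qker V k t s * g t)" for s
    by (rule Bochner_Integration.integrable_bound[OF integrable_mult_left[OF Qi, of B]])
      (use qg B0 in \<open>auto intro!: AE_I2\<close>)
  have Sb: "norm (S s) \<le> (LINT t|lebesgue. ?Q t * B)" for s
  proof -
    have "norm (S s) \<le> (LINT t|lebesgue. norm (qker V k t s * g t))" unfolding S_def by (rule integral_norm_bound)
    also have "\<dots> \<le> (LINT t|lebesgue. ?Q t * B)"
      by (intro integral_mono integrable_norm qgi integrable_mult_left Qi qg)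
    finally show ?thesis .
  qed
  have set: "{0..<Suc (Suc n)} = insert (Suc n) {0..<Suc n}" by auto
  have gi: "integrable (?P (Suc (Suc n))) (\<lambda>y. chain_weight V k (Suc (Suc n)) y * g (y (Suc n)))"
  proof (rule Bochner_Integration.integrable_bound[OF integrable_mult_left[OF int[of "Suc (Suc n)"], of "of_real B"]])
    have "(\<lambda>y. y (Suc n)) \<in> measurable (?P (Suc (Suc n))) lebesgue"
      by (rule measurable_component_singleton) simp
    from measurable_compose[OF this, of g borel]
    have "(\<lambda>y. g (y (Suc n))) \<in> borel_measurable (?P (Suc (Suc n)))" by simp
    then show "(\<lambda>y. chain_weight V k (Suc (Suc n)) y * g (y (Suc n))) \<in> borel_measurable (?P (Suc (Suc n)))"
      using int[of "Suc (Suc n)"] by (intro borel_measurable_times) auto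
    show "AE y in ?P (Suc (Suc n)). norm (chain_weight V k (Suc (Suc n)) y * g (y (Suc n))) \<le> norm (chain_weight V k (Suc (Suc n)) y * of_real B)"
      using Suc.prems(2) B0 by (auto intro!: AE_I2 mult_left_mono simp: norm_mult)
  qed
  have "(LINT y|?P (Suc (Suc n)). chain_weight V k (Suc (Suc n)) y * g (y (Suc n)))
      = (LINT y|?P (Suc n). LINT t|lebesgue. chain_weight V k (Suc (Suc n)) (y(Suc n := t)) * g ((y(Suc n := t)) (Suc n)))"
    unfolding set by (rule product_integral_insert) (use gi in \<open>auto simp: set\<close>)
  also have "\<dots> = (LINT y|?P (Suc n). chain_weight V k (Suc n) y * S (y n))"
    unfolding chain_weight_upd S_def integral_mult_right_zero[symmetric] by (simp only: mult.assoc fun_upd_same)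
  also have "\<dots> = (LINT s|lebesgue. ?F s * S s)"
    by (rule Suc.IH[OF Sm Sb])
  also have "\<dots> = (LINT s|lebesgue. LINT t|lebesgue. ?F s * (qker V k t s * g t))"
    unfolding S_def integral_mult_right_zero[symmetric] ..
  also have "\<dots> = (LINT t|lebesgue. LINT s|lebesgue. ?F s * (qker V k t s * g t))"
  proof (rule lebesgue_pair.Fubini_integral[symmetric])
    have Qc: "integrable lebesgue (\<lambda>t. complex_of_real (?Q t * B))" using Qi by (intro integrable_of_real integrable_mult_left)
    have [measurable]: "?F \<in> borel_measurable lebesgue" using F by auto
    have "(\<lambda>p. ?F (fst p) * (qker V k (snd p) (fst p) * g (snd p))) \<in> borel_measurable lebesgue2" by measurable
    then have m: "(\<lambda>(s, t). ?F s * (qker V k t s * g t)) \<in> borel_measurable lebesgue2" by (simp add: case_prod_unfold)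
    show "integrable lebesgue2 (\<lambda>(s, t). ?F s * (qker V k t s * g t))"
    proof (rule Bochner_Integration.integrable_bound[OF integrable_pair_mult[OF F Qc] m], rule AE_I2, clarify)
      fix s t
      have "norm (?F s) * norm (qker V k t s * g t) \<le> norm (?F s) * (?Q t * B)" by (rule mult_left_mono[OF qg]) simp
      also have "\<dots> \<le> norm (?F s) * \<bar>?Q t * B\<bar>" by (rule mult_left_mono) auto
      finally show "norm (?F s * (qker V k t s * g t)) \<le> norm (?F s * complex_of_real (?Q t * B))"
        unfolding norm_mult norm_of_real .
    qed
  qed
  also have "\<dots> = (LINT t|lebesgue. (LINT s|lebesgue. ?F s * qker V k t s) * g t)"
    unfolding integral_mult_left_zero[symmetric] by (simp only: mult.assoc)
  also have "\<dots> = (LINT t|lebesgue. Psi k (\<lambda>t. V t * mser V k (Suc n) t) t * g t)"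
    unfolding integral_mult_qker[OF V k F] by simp
  finally show ?case .
qed

lemma trace_ext_K_op_series:
  assumes V: "integrable lebesgue V" and k: "Im (zsqrt z) > 0"
  shows "trace_ext 0 (\<lambda>f x. - K_op V z f x) = 1"
    and "trace_ext (Suc n) (\<lambda>f x. - K_op V z f x) = (LINT t|lebesgue. Psi (zsqrt z) (\<lambda>t. V t * mser V (zsqrt z) n t) t)"
proof -
  have int: "integrable (PiM {0..<n} (\<lambda>_. lebesgue)) (chain_weight V (zsqrt z) n)" for n
    using trace_ext_K_op(2)[OF assms, of n] unfolding chain_weight_eq_det[abs_def] .
  have tr: "trace_ext n (\<lambda>f x. - K_op V z f x) = (LINT y|PiM {0..<n} (\<lambda>_. lebesgue). chain_weight V (zsqrt z) n y)" for n
    unfolding trace_ext_K_op(1)[OF assms] chain_weight_eq_det ..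
  show "trace_ext (Suc n) (\<lambda>f x. - K_op V z f x) = (LINT t|lebesgue. Psi (zsqrt z) (\<lambda>t. V t * mser V (zsqrt z) n t) t)"
    unfolding tr using integral_chain_weight[OF V k int, of "\<lambda>_. 1" 1 n] by simp
  \<comment> \<open>The product over no coordinates is a single point of mass one, and the empty
    product is \<open>1\<close>.\<close>
  show "trace_ext 0 (\<lambda>f x. - K_op V z f x) = 1"
    unfolding tr by (simp add: chain_weight_def sorted_fun_def PiM_empty lebesgue_integral_count_space_finite)
qed

lemma integral_Psi:
  assumes k: "Im k > 0" and F: "integrable lebesgue F"
  shows "(LINT t|lebesgue. Psi k F t) = \<i> / (2 * k) * (LINT x|lebesgue. F x)"
proof -
  have "(LINT t|lebesgue. Psi k F t) = (LINT x|lebesgue. LINT t|lebesgue. half_exp (2 * k) t x * F x)"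
    unfolding Psi_def by (rule lebesgue_pair.Fubini_integral[OF Psi_pair_integrable[OF assms]])
  also have "\<dots> = \<i> / (2 * k) * (LINT x|lebesgue. F x)"
    by (simp only: integral_mult_left_zero integral_mult_right_zero half_exp_integrable(3)[OF k])
  finally show ?thesis .
qed

section \<open>The sum of the Volterra series\<close>

definition msum :: "(real \<Rightarrow> complex) \<Rightarrow> complex \<Rightarrow> real \<Rightarrow> complex" where
  "msum V k x = (\<Sum>n. mser V k n x)"

lemma mser_measurable:
  assumes V: "integrable lebesgue V" and k: "Im k > 0"
  shows "mser V k n \<in> borel_measurable lebesgue"
proof (cases n)
  case (Suc m)
  then show ?thesis using Psi_integrable[OF k V_mser_integrable[OF V k]] by (auto intro: measurable_tail)
qed simp

context
  fixes V :: "real \<Rightarrow> complex" and k :: complex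
  assumes V: "integrable lebesgue V" and k: "Im k > 0"
begin

lemma mser_summable: "summable (\<lambda>n. norm (mser V k n x))"
  by (rule summable_comparison_test'[OF summable_exp[of "(LINT t|lebesgue. norm (V t)) / norm k"]])
    (use norm_mser_le[OF V k] in \<open>simp add: field_simps\<close>)

lemma norm_msum_le: "norm (msum V k x) \<le> exp ((LINT t|lebesgue. norm (V t)) / norm k)"
proof -
  let ?c = "(LINT t|lebesgue. norm (V t)) / norm k"
  have "norm (msum V k x) \<le> (\<Sum>n. norm (mser V k n x))"
    unfolding msum_def by (rule summable_norm[OF mser_summable])
  also have "\<dots> \<le> (\<Sum>n. inverse (fact n) * ?c ^ n)"
    by (rule suminf_le[OF _ mser_summable summable_exp]) (use norm_mser_le[OF V k] in \<open>simp add: field_simps\<close>)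
  also have "\<dots> = exp ?c" by (simp add: exp_def scaleR_conv_of_real)
  finally show ?thesis .
qed

lemma msum_measurable: "msum V k \<in> borel_measurable lebesgue"
proof -
  note [measurable] = mser_measurable[OF V k]
  show ?thesis unfolding msum_def[abs_def] by measurable
qed

lemma V_msum_integrable: "integrable lebesgue (\<lambda>t. V t * msum V k t)"
proof (rule Bochner_Integration.integrable_bound[OF integrable_mult_left[OF V, of "of_real (exp ((LINT t|lebesgue. norm (V t)) / norm k))"]])
  note [measurable] = msum_measurable
  have [measurable]: "V \<in> borel_measurable lebesgue" using V by auto
  show "(\<lambda>t. V t * msum V k t) \<in> borel_measurable lebesgue" by measurable
  show "AE t in lebesgue. norm (V t * msum V k t) \<le> norm (V t * of_real (exp ((LINT t|lebesgue. norm (V t)) / norm k)))"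
    using norm_msum_le by (auto intro!: AE_I2 mult_left_mono simp: norm_mult)
qed

text \<open>The bounded factor \<open>c\<close> serves two purposes: \<open>c = jker k x\<close>
  yields the integral equation for \<open>msum\<close>, and \<open>c = 1\<close> sums the
  traces.\<close>

lemma msum_integral_sums:
  assumes c: "c \<in> borel_measurable lebesgue" and B: "\<And>t. norm (c t) \<le> B"
  shows "(\<lambda>n. LINT t|lebesgue. c t * (V t * mser V k n t)) sums (LINT t|lebesgue. c t * (V t * msum V k t))"
proof -
  let ?c = "(LINT t|lebesgue. norm (V t)) / norm k"
  have B0: "B \<ge> 0" using B[of 0] norm_ge_zero order_trans by blast
  note [measurable] = mser_measurable[OF V k] c
  have [measurable]: "V \<in> borel_measurable lebesgue" using V by auto
  have b: "norm (c t * (V t * mser V k n t)) \<le> B * norm (V t) * (inverse (fact n) * ?c ^ n)" for n t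
  proof -
    have "norm (c t * (V t * mser V k n t)) = norm (c t) * norm (V t) * norm (mser V k n t)" by (simp add: norm_mult)
    also have "\<dots> \<le> B * norm (V t) * (inverse (fact n) * ?c ^ n)"
      using norm_mser_le[OF V k, of n t] B[of t] B0 by (intro mult_mono) (auto simp: field_simps)
    finally show ?thesis .
  qed
  have bi: "integrable lebesgue (\<lambda>t. B * norm (V t) * (inverse (fact n) * ?c ^ n))" for n
    using V by (intro integrable_mult_left integrable_mult_right integrable_norm)
  have i: "integrable lebesgue (\<lambda>t. c t * (V t * mser V k n t))" for n
  proof (rule Bochner_Integration.integrable_bound[OF bi])
    show "AE t in lebesgue. norm (c t * (V t * mser V k n t)) \<le> norm (B * norm (V t) * (inverse (fact n) * ?c ^ n))"
      using b order_trans[OF b abs_ge_self] by (auto intro!: AE_I2 simp del: norm_mult)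
  qed measurable
  have s: "summable (\<lambda>n. c t * (V t * mser V k n t))" for t
    using summable_norm_cancel[OF mser_summable, of t] by (intro summable_mult)
  have sn: "summable (\<lambda>n. norm (c t * (V t * mser V k n t)))" for t
    using summable_mult[OF mser_summable, of "norm (c t) * norm (V t)" t] by (simp add: norm_mult mult.assoc)
  have si: "summable (\<lambda>n. LINT t|lebesgue. norm (c t * (V t * mser V k n t)))"
  proof (rule summable_comparison_test'[OF summable_mult[OF summable_exp[of ?c], of "LINT t|lebesgue. B * norm (V t)"]])
    fix n
    have "(LINT t|lebesgue. norm (c t * (V t * mser V k n t))) \<le> (LINT t|lebesgue. B * norm (V t) * (inverse (fact n) * ?c ^ n))"
      by (intro integral_mono integrable_norm i bi b)
    then show "norm (LINT t|lebesgue. norm (c t * (V t * mser V k n t))) \<le> (LINT t|lebesgue. B * norm (V t)) * (inverse (fact n) * ?c ^ n)"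
      by simp
  qed
  have "(\<lambda>n. LINT t|lebesgue. c t * (V t * mser V k n t)) sums (LINT t|lebesgue. (\<Sum>n. c t * (V t * mser V k n t)))"
    by (rule sums_integral[OF i _ si]) (use sn in simp)
  moreover have "(\<Sum>n. c t * (V t * mser V k n t)) = c t * (V t * msum V k t)" for t
    unfolding msum_def using summable_norm_cancel[OF mser_summable, of t]
    by (simp add: suminf_mult summable_mult)
  ultimately show ?thesis by simp
qed

text \<open>Minus the derivative of \<open>msum\<close>, as \<open>msum_eq_tail\<close>
  shows.\<close>

definition mphi :: "real \<Rightarrow> complex" where "mphi = Psi k (\<lambda>t. V t * msum V k t)"

lemma mphi_integrable: "integrable lebesgue mphi"
  unfolding mphi_def by (rule Psi_integrable[OF k V_msum_integrable])

lemma msum_eq_jker: "msum V k x = 1 + (LINT t|lebesgue. jker k x t * (V t * msum V k t))"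
proof -
  have "norm (jker k x t) \<le> 1 / norm k" for t
    using norm_jker_le[OF k, of x t] by (auto simp: of_bool_def split: if_splits intro: order_trans)
  from msum_integral_sums[OF jker_measurable this]
  have "(\<lambda>n. mser V k (Suc n) x) sums (LINT t|lebesgue. jker k x t * (V t * msum V k t))"
    unfolding mser_Suc_eq[OF V k] .
  then have "(\<lambda>n. mser V k n x) sums ((LINT t|lebesgue. jker k x t * (V t * msum V k t)) + mser V k 0 x)"
    by (rule sums_Suc_iff[THEN iffD1])
  then show ?thesis unfolding msum_def by (simp add: sums_iff)
qed

lemma msum_eq_tail: "msum V k x = 1 + tail mphi x"
  unfolding mphi_def tail_Psi[OF k V_msum_integrable] by (rule msum_eq_jker)

text \<open>The equation \<open>mphi' = - 2 i k mphi - V m\<close> in integrated form. It rests on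
  \<open>2 i k\<close> times \<open>jker\<close> being \<open>half_exp (2 * k)\<close> minus the
  indicator of \<open>x < t\<close>.\<close>

lemma mphi_eq_tail: "mphi x = tail (\<lambda>t. 2 * \<i> * k * mphi t + V t * msum V k t) x"
proof -
  let ?F = "\<lambda>t. V t * msum V k t"
  have k0: "k \<noteq> 0" using k by auto
  have F: "integrable lebesgue ?F" by (rule V_msum_integrable)
  have tF: "integrable lebesgue (\<lambda>t. of_bool (x < t) * ?F t)" and tp: "integrable lebesgue (\<lambda>t. of_bool (x < t) * mphi t)"
    using integrable_of_bool_mult[OF F, of "{x<..}"] integrable_of_bool_mult[OF mphi_integrable, of "{x<..}"] by auto
  have "2 * \<i> * k * tail mphi x = (LINT t|lebesgue. 2 * \<i> * k * (jker k x t * ?F t))"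
    unfolding mphi_def tail_Psi[OF k F] by simp
  also have "\<dots> = (LINT t|lebesgue. half_exp (2 * k) x t * ?F t - of_bool (x < t) * ?F t)"
  proof (rule Bochner_Integration.integral_cong[OF refl])
    fix t
    have "2 * \<i> * k * jker k x t = half_exp (2 * k) x t - of_bool (x < t)"
      using k0 by (simp add: jker_def half_exp_def field_simps)
    then show "2 * \<i> * k * (jker k x t * ?F t) = half_exp (2 * k) x t * ?F t - of_bool (x < t) * ?F t"
      by (metis left_diff_distrib mult.assoc)
  qed
  also have "\<dots> = mphi x - tail ?F x"
    unfolding mphi_def Psi_def tail_eq using k by (intro Bochner_Integration.integral_diff tF half_exp_mult_integrable F) simp
  finally have "mphi x = 2 * \<i> * k * tail mphi x + tail ?F x" by simp
  also have "\<dots> = (LINT t|lebesgue. 2 * \<i> * k * (of_bool (x < t) * mphi t) + of_bool (x < t) * ?F t)"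
    unfolding tail_eq using tF tp by simp
  also have "\<dots> = tail (\<lambda>t. 2 * \<i> * k * mphi t + ?F t) x"
    unfolding tail_eq by (simp only: distrib_left mult.left_commute)
  finally show ?thesis .
qed

end

section \<open>The Wronskian\<close>

lemma integrable_lebesgue_reflect:
  fixes F :: "real \<Rightarrow> complex"
  shows "integrable lebesgue (\<lambda>s. F (- s)) \<longleftrightarrow> integrable lebesgue F"
  using lebesgue_integrable_real_affine_iff[of "-1" F 0] by simp

lemma integral_lebesgue_reflect:
  fixes F :: "real \<Rightarrow> complex"
  shows "(LINT s|lebesgue. F (- s)) = (LINT s|lebesgue. F s)"
  using lebesgue_integral_real_affine[of "-1" F 0] by simp

text \<open>The left Jost solution is obtained by reflection, and this brings its left-sided
  integrals back to the form of a constant plus a tail.\<close>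

lemma tail_reflect:
  fixes F :: "real \<Rightarrow> complex"
  assumes F: "integrable lebesgue F"
  shows "tail F (- x) = (LINT s|lebesgue. F s) + tail (\<lambda>s. - F (- s)) x"
proof -
  have Fr: "integrable lebesgue (\<lambda>s. F (- s))" using F by (simp add: integrable_lebesgue_reflect)
  then have Fm: "(\<lambda>s. - F (- s)) \<in> borel_measurable lebesgue" by auto
  have i: "integrable lebesgue (\<lambda>s. of_bool (x \<le> s) * - F (- s))"
    using integrable_of_bool_mult[OF integrable_minus[OF Fr], of "{x..}"] by simp
  have "tail F (- x) = (LINT s|lebesgue. of_bool (- x < - s) * F (- s))"
    unfolding tail_eq by (rule integral_lebesgue_reflect[symmetric])
  also have "\<dots> = (LINT s|lebesgue. F (- s) + of_bool (x \<le> s) * - F (- s))"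
    by (rule Bochner_Integration.integral_cong) (auto simp: of_bool_def)
  also have "\<dots> = (LINT s|lebesgue. F (- s)) + tail (\<lambda>s. - F (- s)) x"
    unfolding tail_eq_closed[OF Fm] by (rule Bochner_Integration.integral_add[OF Fr i])
  finally show ?thesis by (simp only: integral_lebesgue_reflect)
qed

lemma tail_add: "integrable lebesgue f \<Longrightarrow> integrable lebesgue g \<Longrightarrow> tail (\<lambda>s. f s + g s) x = tail f x + tail g x"
  using integrable_of_bool_mult[of lebesgue f "{x<..}"] integrable_of_bool_mult[of lebesgue g "{x<..}"]
  unfolding tail_eq by (simp add: distrib_left)

lemma tail_cmult: "tail (\<lambda>s. c * f s) x = c * tail f x"
  unfolding tail_eq by (simp only: mult.left_commute[of _ c] integral_mult_right_zero)

lemma tail_diff: "integrable lebesgue f \<Longrightarrow> integrable lebesgue g \<Longrightarrow> tail (\<lambda>s. f s - g s) x = tail f x - tail g x"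
  using integrable_of_bool_mult[of lebesgue f "{x<..}"] integrable_of_bool_mult[of lebesgue g "{x<..}"]
  unfolding tail_eq by (simp add: right_diff_distrib)

lemma integrable_mult_const_tail:
  assumes "integrable lebesgue f" "integrable lebesgue g"
  shows "integrable lebesgue (\<lambda>s. f s * (c + tail g s))"
  unfolding distrib_left using integrable_mult_tail[OF assms] assms(1)
  by (intro Bochner_Integration.integrable_add) auto

text \<open>The product rule for absolutely continuous functions: \<open>c + tail f\<close> has the derivative \<open>- f\<close> almost everywhere.\<close>

lemma const_tail_product:
  assumes f: "integrable lebesgue f" and g: "integrable lebesgue g"
  shows "(c + tail f x) * (d + tail g x) = c * d + tail (\<lambda>s. f s * (d + tail g s) + g s * (c + tail f s)) x"
proof -
  have "tail (\<lambda>s. f s * (d + tail g s) + g s * (c + tail f s)) x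
      = tail (\<lambda>s. (f s * tail g s + g s * tail f s) + (d * f s + c * g s)) x"
    by (rule arg_cong[where f="\<lambda>h. tail h x"]) (simp add: algebra_simps)
  also have "\<dots> = tail (\<lambda>s. f s * tail g s + g s * tail f s) x + (d * tail f x + c * tail g x)"
    using assms integrable_mult_tail[OF f g] integrable_mult_tail[OF g f]
    by (simp add: tail_add tail_cmult)
  also have "tail (\<lambda>s. f s * tail g s + g s * tail f s) x = tail f x * tail g x"
    using integrable_mult_tail[OF f g] integrable_mult_tail[OF g f] by (simp add: tail_add tail_product[OF f g])
  finally show ?thesis by (simp add: algebra_simps)
qed

text \<open>Every function involved is a constant plus a tail integral; the product rule shows that the
  integrand of the combination vanishes identically.\<close>

lemma wronskian_constant:
  fixes V :: "real \<Rightarrow> complex"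
  assumes V: "integrable lebesgue V" and k: "Im k > 0"
  defines "U \<equiv> \<lambda>x. V (- x)"
  shows "2 * \<i> * k * msum U k (- x) * msum V k x - msum U k (- x) * mphi V k x - mphi U k (- x) * msum V k x
    = 2 * \<i> * k - (LINT s|lebesgue. U s * msum U k s)"
proof -
  have U: "integrable lebesgue U" unfolding U_def using V by (simp add: integrable_lebesgue_reflect)
  define m where "m = msum V k"
  define f where "f = mphi V k"
  define p where "p x = msum U k (- x)" for x
  define g where "g x = mphi U k (- x)" for x
  let ?f' = "\<lambda>s. 2 * \<i> * k * f s + V s * m s" and ?g' = "\<lambda>s. - (2 * \<i> * k * g s + V s * p s)"
  have fi: "integrable lebesgue f" unfolding f_def by (rule mphi_integrable[OF V k])
  have gi: "integrable lebesgue g" unfolding g_def by (simp add: integrable_lebesgue_reflect mphi_integrable[OF U k])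
  have Vm: "integrable lebesgue (\<lambda>s. V s * m s)" unfolding m_def by (rule V_msum_integrable[OF V k])
  have UU: "integrable lebesgue (\<lambda>s. U s * msum U k s)" by (rule V_msum_integrable[OF U k])
  have Vp: "integrable lebesgue (\<lambda>s. V s * p s)"
    using integrable_lebesgue_reflect[of "\<lambda>s. U s * msum U k s"] UU by (simp add: p_def U_def)
  have f'i: "integrable lebesgue ?f'" and g'i: "integrable lebesgue ?g'" and gmi: "integrable lebesgue (\<lambda>s. - g s)"
    using fi gi Vm Vp by auto
  let ?I = "LINT s|lebesgue. U s * msum U k s"
  \<comment> \<open>\<open>cp\<close> and \<open>cg\<close> are the constants produced by
    \<open>tail_reflect\<close>, that is, the limits of \<open>p\<close> and \<open>g\<close> at
    plus infinity. The integral of \<open>mphi\<close> drops out of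
    \<open>2 i k cp - cg\<close>.\<close>
  define cp where "cp = 1 + (LINT s|lebesgue. mphi U k s)"
  define cg where "cg = 2 * \<i> * k * (LINT s|lebesgue. mphi U k s) + ?I"
  have m: "m x = 1 + tail f x" for x unfolding m_def f_def by (rule msum_eq_tail[OF V k])
  have f: "f x = 0 + tail ?f' x" for x unfolding m_def f_def by (simp add: mphi_eq_tail[OF V k, of x])
  have p: "p x = cp + tail (\<lambda>s. - g s) x" for x
    unfolding p_def g_def cp_def msum_eq_tail[OF U k, of "- x"]
    by (simp add: tail_reflect[OF mphi_integrable[OF U k]])
  have g: "g x = cg + tail ?g' x" for x
  proof -
    have i: "integrable lebesgue (\<lambda>t. 2 * \<i> * k * mphi U k t + U t * msum U k t)"
      by (intro Bochner_Integration.integrable_add integrable_mult_right mphi_integrable U k UU)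
    have "(LINT t|lebesgue. 2 * \<i> * k * mphi U k t + U t * msum U k t) = cg"
      unfolding cg_def using mphi_integrable[OF U k] UU by simp
    moreover have "(\<lambda>s. - (2 * \<i> * k * mphi U k (- s) + U (- s) * msum U k (- s))) = ?g'"
      by (simp add: g_def p_def U_def)
    ultimately show ?thesis
      unfolding g_def[of x] mphi_eq_tail[OF U k, of "- x"] tail_reflect[OF i] by simp
  qed
  let ?A = "\<lambda>s. - g s * m s + f s * p s" and ?B = "\<lambda>s. - g s * f s + ?f' s * p s" and ?C = "\<lambda>s. ?g' s * m s + f s * g s"
  have pm: "p x * m x = cp * 1 + tail ?A x"
    unfolding p[of x] m[of x] const_tail_product[OF gmi fi] unfolding m[symmetric] p[symmetric] ..
  have pf: "p x * f x = cp * 0 + tail ?B x"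
    unfolding p[of x] f[of x] const_tail_product[OF gmi f'i] unfolding f[symmetric] p[symmetric] ..
  have gm: "g x * m x = cg * 1 + tail ?C x"
    unfolding g[of x] m[of x] const_tail_product[OF g'i fi] unfolding m[symmetric] g[symmetric] ..
  have Ai: "integrable lebesgue ?A"
    using integrable_mult_const_tail[OF gmi fi, of 1] integrable_mult_const_tail[OF fi gmi, of cp]
    unfolding m[symmetric] p[symmetric] by (rule Bochner_Integration.integrable_add)
  have Bi: "integrable lebesgue ?B"
    using integrable_mult_const_tail[OF gmi f'i, of 0] integrable_mult_const_tail[OF f'i gmi, of cp]
    unfolding f[symmetric] p[symmetric] by (rule Bochner_Integration.integrable_add)
  have Ci: "integrable lebesgue ?C"
    using integrable_mult_const_tail[OF g'i fi, of 1] integrable_mult_const_tail[OF fi g'i, of cg]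
    unfolding m[symmetric] g[symmetric] by (rule Bochner_Integration.integrable_add)
  have "tail (\<lambda>s. 2 * \<i> * k * ?A s - ?B s - ?C s) x = 2 * \<i> * k * tail ?A x - tail ?B x - tail ?C x"
    by (subst tail_diff[OF Bochner_Integration.integrable_diff[OF integrable_mult_right[OF Ai] Bi] Ci],
        subst tail_diff[OF integrable_mult_right[OF Ai] Bi], subst tail_cmult) (rule refl)
  moreover have "(\<lambda>s. 2 * \<i> * k * ?A s - ?B s - ?C s) = (\<lambda>s. 0)"
    by (simp add: algebra_simps)
  moreover have "tail (\<lambda>s. 0 :: complex) x = 0" by (simp add: tail_eq)
  ultimately have "2 * \<i> * k * tail ?A x - tail ?B x - tail ?C x = 0" by simp
  then have "2 * \<i> * k * (p x * m x) - p x * f x - g x * m x = 2 * \<i> * k * cp - cg"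
    unfolding pm pf gm by (simp add: algebra_simps)
  also have "\<dots> = 2 * \<i> * k - ?I" by (simp add: cp_def cg_def algebra_simps)
  finally show ?thesis unfolding m_def f_def p_def g_def by (simp add: mult.assoc)
qed

section \<open>Jost solutions\<close>

text \<open>The strict and the weak cut-off agree because the sine vanishes at
  \<open>t = x\<close>.\<close>

lemma jker_eq_sin:
  assumes "k \<noteq> 0"
  shows "jker k x t = - (of_bool (x \<le> t) * (sin (k * of_real (x - t)) / k) * exp (\<i> * k * of_real (t - x)))"
proof (cases "x < t")
  case True
  let ?a = "\<i> * k * of_real (t - x)"
  have "sin (k * of_real (x - t)) = (exp (- ?a) - exp ?a) / (2 * \<i>)"
    by (simp add: sin_exp_eq algebra_simps)
  then have "sin (k * of_real (x - t)) * exp ?a = (1 - exp (?a + ?a)) / (2 * \<i>)"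
    by (simp add: algebra_simps mult_exp_exp flip: exp_add)
  moreover have "?a + ?a = 2 * \<i> * k * of_real (t - x)" by simp
  ultimately have "sin (k * of_real (x - t)) * exp ?a = (1 - exp (2 * \<i> * k * of_real (t - x))) / (2 * \<i>)" by (simp only:)
  moreover have "- (s / k * e) = - (s * e) / k" for s e :: complex by simp
  moreover have "- (y / (2 * \<i>)) / k = \<i> / (2 * k) * y" for y using assms by (simp add: field_simps)
  ultimately have "- (sin (k * of_real (x - t)) / k * exp ?a) = \<i> / (2 * k) * (1 - exp (2 * \<i> * k * of_real (t - x)))"
    by (simp only:)
  then show ?thesis using True by (simp add: jker_def)
qed (auto simp: jker_def of_bool_def)

text \<open>What the Jost equation becomes for \<open>m\<close> when
  \<open>f = exp (i k x) m\<close>; the conjugated sine kernel is bounded.\<close>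

definition jost_eq :: "(real \<Rightarrow> complex) \<Rightarrow> complex \<Rightarrow> (real \<Rightarrow> complex) \<Rightarrow> bool" where
  "jost_eq V k m \<longleftrightarrow> (\<forall>x. integrable lebesgue (\<lambda>t. jker k x t * (V t * m t)) \<and>
     m x = 1 + (LINT t|lebesgue. jker k x t * (V t * m t)))"

lemma jost_integrand:
  assumes "k \<noteq> 0"
  shows "indicator {x..} t *\<^sub>R (sin (k * of_real (x - t)) / k * V t * (exp (\<i> * k * of_real t) * m t))
    = - (exp (\<i> * k * of_real x) * (jker k x t * (V t * m t)))"
proof -
  have "exp (\<i> * k * of_real t) = exp (\<i> * k * of_real x) * exp (\<i> * k * of_real (t - x))"
    by (simp add: mult_exp_exp algebra_simps)
  then show ?thesis
    unfolding jker_eq_sin[OF assms] by (simp add: indicator_def)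
qed

lemma is_jost_plus_iff:
  assumes "zsqrt z \<noteq> 0"
  defines "k \<equiv> zsqrt z"
  shows "is_jost_plus V z (\<lambda>x. exp (\<i> * k * of_real x) * m x) \<longleftrightarrow> Bfun m at_top \<and> jost_eq V k m"
proof -
  have k: "k \<noteq> 0" using assms by simp
  have e: "exp (- \<i> * k * of_real x) * (exp (\<i> * k * of_real x) * m x) = m x" for x
    by (simp add: mult.assoc[symmetric] mult_exp_exp)
  have si: "set_integrable lebesgue {x..} (\<lambda>t. sin (k * of_real (x - t)) / k * V t * (exp (\<i> * k * of_real t) * m t))
      \<longleftrightarrow> integrable lebesgue (\<lambda>t. jker k x t * (V t * m t))" for x
    unfolding set_integrable_def jost_integrand[OF k]
  proof
    assume "integrable lebesgue (\<lambda>t. - (exp (\<i> * k * of_real x) * (jker k x t * (V t * m t))))"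
    from integrable_mult_right[OF this, of "- exp (- \<i> * k * of_real x)"]
    show "integrable lebesgue (\<lambda>t. jker k x t * (V t * m t))"
      by (simp add: mult.assoc[symmetric] mult_exp_exp)
  qed simp
  have "(exp (\<i> * k * of_real x) * m x = exp (\<i> * k * of_real x)
          - (LINT t:{x..}|lebesgue. sin (k * of_real (x - t)) / k * V t * (exp (\<i> * k * of_real t) * m t)))
      \<longleftrightarrow> m x = 1 + (LINT t|lebesgue. jker k x t * (V t * m t))" for x
  proof -
    have "exp (\<i> * k * of_real x) - (LINT t:{x..}|lebesgue. sin (k * of_real (x - t)) / k * V t * (exp (\<i> * k * of_real t) * m t))
       = exp (\<i> * k * of_real x) * (1 + (LINT t|lebesgue. jker k x t * (V t * m t)))"
      unfolding set_lebesgue_integral_def jost_integrand[OF k] by (simp add: distrib_left)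
    then show ?thesis by simp
  qed
  then show ?thesis unfolding is_jost_plus_def jost_eq_def k_def[symmetric] e si by simp
qed

text \<open>Integrability of the Jost integrand at \<open>x0 - 1\<close> thus bounds a solution on all of \<open>[x0, \<infinity>)\<close>.\<close>

lemma jker_compare:
  assumes k: "Im k > 0" and x: "x0 \<le> x"
  shows "norm (jker k x t) \<le> 2 / (1 - exp (- 2 * Im k)) * norm (jker k (x0 - 1) t)"
proof (cases "x < t")
  case True
  \<comment> \<open>The base point \<open>x0 - 1\<close> keeps \<open>t\<close> at distance more
    than \<open>1\<close>, so \<open>norm (1 - ?E)\<close> is at least
    \<open>1 - exp (- 2 * Im k)\<close>, whereas the corresponding factor in
    \<open>jker k x t\<close> is at most \<open>2\<close>.\<close>
  let ?R = "2 / (1 - exp (- 2 * Im k))"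
  let ?E = "exp (2 * \<i> * k * of_real (t - (x0 - 1)))"
  have pos: "1 - exp (- 2 * Im k) > 0" using k by simp
  have "norm ?E = exp (- 2 * Im k * (t - (x0 - 1)))" by simp
  also have "\<dots> \<le> exp (- 2 * Im k)" using True x k by simp
  finally have "1 - exp (- 2 * Im k) \<le> 1 - norm ?E" by simp
  also have "\<dots> \<le> norm (1 - ?E)" by (metis norm_one norm_triangle_ineq2)
  finally have "1 - exp (- 2 * Im k) \<le> norm (1 - ?E)" .
  then have "2 \<le> ?R * norm (1 - ?E)" using pos by (simp add: field_simps)
  then have "1 / (2 * norm k) * 2 \<le> 1 / (2 * norm k) * (?R * norm (1 - ?E))" by (rule mult_left_mono) simp
  also have "\<dots> = ?R * (1 / (2 * norm k) * norm (1 - ?E))" by (simp only: mult.left_commute)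
  also have "1 / (2 * norm k) * norm (1 - ?E) = norm (jker k (x0 - 1) t)"
    using True x unfolding jker_def by (simp add: norm_mult norm_divide)
  finally show ?thesis using norm_jker_le[OF k, of x t] True by simp
next
  case False
  have "1 - exp (- 2 * Im k) > 0" using k by simp
  then show ?thesis using False by (simp add: jker_def)
qed

text \<open>The difference \<open>d\<close> solves the homogeneous equation. Starting from the bound
  \<open>B\<close> on the half-line to the right of \<open>x0\<close>, each substitution into that
  equation adds one ordered integration, so \<open>norm (d x0)\<close> is at most \<open>B\<close>
  times the \<open>n\<close>-th term of an exponential series, for every \<open>n\<close>.\<close>

lemma jost_eq_unique:
  assumes V: "integrable lebesgue V" and k: "Im k > 0" and m: "jost_eq V k m" and m': "jost_eq V k m'"
  shows "m = m'"
proof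
  fix x0
  define d where "d t = m t - m' t" for t
  let ?w = "\<lambda>t. norm (V t) / norm k" and ?R = "2 / (1 - exp (- 2 * Im k))"
  have w: "integrable lebesgue ?w" using V by (intro integrable_divide integrable_norm)
  have mi: "integrable lebesgue (\<lambda>t. jker k x t * (V t * m t))" "integrable lebesgue (\<lambda>t. jker k x t * (V t * m' t))" for x
    using m m' unfolding jost_eq_def by blast+
  have di: "integrable lebesgue (\<lambda>t. jker k x t * (V t * d t))" for x
    using Bochner_Integration.integrable_diff[OF mi, of x] by (simp add: d_def right_diff_distrib)
  have d: "d x = (LINT t|lebesgue. jker k x t * (V t * d t))" for x
  proof -
    have "m x = 1 + (LINT t|lebesgue. jker k x t * (V t * m t))" "m' x = 1 + (LINT t|lebesgue. jker k x t * (V t * m' t))"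
      using m m' unfolding jost_eq_def by blast+
    then have "d x = (LINT t|lebesgue. jker k x t * (V t * m t)) - (LINT t|lebesgue. jker k x t * (V t * m' t))"
      unfolding d_def by simp
    also have "\<dots> = (LINT t|lebesgue. jker k x t * (V t * m t) - jker k x t * (V t * m' t))"
      by (rule Bochner_Integration.integral_diff[OF mi, symmetric])
    finally show ?thesis by (simp add: d_def right_diff_distrib)
  qed
  define B where "B = (LINT t|lebesgue. ?R * norm (jker k (x0 - 1) t * (V t * d t)))"
  have bound: "norm (d x) \<le> B * wtail ?w n x" if "x0 \<le> x" for n x
    using that
  proof (induction n arbitrary: x)
    case 0
    have "norm (d x) \<le> (LINT t|lebesgue. norm (jker k x t * (V t * d t)))"
      by (subst d) (rule integral_norm_bound)
    also have "\<dots> \<le> B" unfolding B_def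
    proof (intro integral_mono integrable_norm integrable_mult_right di)
      fix t
      have "norm (jker k x t) * norm (V t * d t) \<le> ?R * norm (jker k (x0 - 1) t) * norm (V t * d t)"
        by (intro mult_right_mono jker_compare[OF k 0]) simp
      then show "norm (jker k x t * (V t * d t)) \<le> ?R * norm (jker k (x0 - 1) t * (V t * d t))"
        by (simp add: norm_mult mult.assoc)
    qed
    finally show ?case by simp
  next
    case (Suc n)
    have ti: "integrable lebesgue (\<lambda>t. of_bool (x < t) * (?w t * wtail ?w n t))"
      using integrable_of_bool_mult[OF wtail_integrable[OF w, of n], of "{x<..}"] by simp
    have "norm (d x) \<le> (LINT t|lebesgue. norm (jker k x t * (V t * d t)))"
      by (subst d) (rule integral_norm_bound)
    also have "\<dots> \<le> (LINT t|lebesgue. B * (of_bool (x < t) * (?w t * wtail ?w n t)))"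
    proof (intro integral_mono integrable_norm integrable_mult_right di ti)
      fix t
      show "norm (jker k x t * (V t * d t)) \<le> B * (of_bool (x < t) * (?w t * wtail ?w n t))"
      proof (cases "x < t")
        case True
        have "norm (jker k x t) * (norm (V t) * norm (d t)) \<le> 1 / norm k * (norm (V t) * (B * wtail ?w n t))"
          using norm_jker_le[OF k, of x t] True Suc.prems Suc.IH[of t]
          by (intro mult_mono mult_nonneg_nonneg order_refl) auto
        then show ?thesis using True by (simp add: norm_mult ac_simps)
      qed (simp add: jker_def)
    qed
    also have "\<dots> = B * wtail ?w (Suc n) x" by (simp add: tail_eq)
    finally show ?case .
  qed
  let ?c = "LINT t|lebesgue. ?w t"
  have B0: "B \<ge> 0" using bound[of x0 0] norm_ge_zero[of "d x0"] by (simp only: wtail.simps mult_1_right) linarith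
  have le: "norm (d x0) \<le> B * (inverse (fact n) * ?c ^ n)" for n
  proof -
    have "wtail ?w n x0 \<le> ?c ^ n / fact n" by (rule wtail_le[OF w]) simp
    then have "B * wtail ?w n x0 \<le> B * (?c ^ n / fact n)" using B0 by (rule mult_left_mono)
    then show ?thesis using bound[of x0 n] by (simp add: field_simps)
  qed
  have "(\<lambda>n. B * (inverse (fact n) * ?c ^ n)) \<longlonglongrightarrow> B * 0"
    by (intro tendsto_mult tendsto_const summable_LIMSEQ_zero summable_exp)
  then have "norm (d x0) \<le> B * 0" by (rule LIMSEQ_le_const) (use le in blast)
  then show "m x0 = m' x0" by (simp add: d_def)
qed

lemma jost_plus_eq:
  assumes V: "integrable lebesgue V" and k: "Im (zsqrt z) > 0"
  shows "is_jost_plus V z f \<longleftrightarrow> f = (\<lambda>x. exp (\<i> * zsqrt z * of_real x) * msum V (zsqrt z) x)"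
proof -
  let ?k = "zsqrt z"
  have k0: "?k \<noteq> 0" using k by auto
  have sol: "jost_eq V ?k (msum V ?k)"
    unfolding jost_eq_def using msum_eq_jker[OF V k] jker_mult_integrable[OF k V_msum_integrable[OF V k]] by blast
  have "Bfun (msum V ?k) at_top"
    by (rule BfunI) (use norm_msum_le[OF V k] in \<open>auto intro: always_eventually\<close>)
  with sol have plus: "is_jost_plus V z (\<lambda>x. exp (\<i> * ?k * of_real x) * msum V ?k x)"
    unfolding is_jost_plus_iff[OF k0] by simp
  show ?thesis
  proof
    assume f: "is_jost_plus V z f"
    define m where "m x = exp (- \<i> * ?k * of_real x) * f x" for x
    have fm: "f = (\<lambda>x. exp (\<i> * ?k * of_real x) * m x)"
      unfolding m_def by (simp add: mult.assoc[symmetric] mult_exp_exp)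
    have "jost_eq V ?k m" using f is_jost_plus_iff[OF k0, of V m] unfolding fm by simp
    then have "m = msum V ?k" by (rule jost_eq_unique[OF V k _ sol])
    then show "f = (\<lambda>x. exp (\<i> * ?k * of_real x) * msum V ?k x)" using fm by simp
  qed (simp add: plus)
qed

text \<open>The reflection \<open>x \<mapsto> - x\<close> exchanges the two ends of the line, so
  existence and uniqueness on the right also give them on the left.\<close>

lemma is_jost_minus_iff_reflect:
  "is_jost_minus V z f \<longleftrightarrow> is_jost_plus (\<lambda>x. V (- x)) z (\<lambda>x. f (- x))"
proof -
  let ?k = "zsqrt z"
  let ?S = "\<lambda>x t. sin (?k * of_real (x - t)) / ?k * V t * f t"
  let ?T = "\<lambda>x t. sin (?k * of_real (x - t)) / ?k * V (- t) * f (- t)"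
  have ind: "indicator {x..} t *\<^sub>R ?T x t = - (indicator {..- x} (- t) *\<^sub>R ?S (- x) (- t))" for x t :: real
  proof -
    have "sin (?k * of_real (x - t)) = - sin (?k * of_real (- x - (- t)))"
      by (simp add: algebra_simps flip: sin_minus)
    then show ?thesis by (simp add: indicator_def)
  qed
  have si: "set_integrable lebesgue {x..} (?T x) \<longleftrightarrow> set_integrable lebesgue {..- x} (?S (- x))" for x
    unfolding set_integrable_def ind using integrable_lebesgue_reflect[of "\<lambda>t. indicator {..- x} t *\<^sub>R ?S (- x) t"] by simp
  have int: "(LINT t:{x..}|lebesgue. ?T x t) = - (LINT t:{..- x}|lebesgue. ?S (- x) t)" for x
    unfolding set_lebesgue_integral_def ind using integral_lebesgue_reflect[of "\<lambda>t. indicator {..- x} t *\<^sub>R ?S (- x) t"] by simp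
  have bf: "Bfun (\<lambda>x. exp (\<i> * ?k * of_real x) * f x) at_bot \<longleftrightarrow> Bfun (\<lambda>x. exp (- \<i> * ?k * of_real x) * f (- x)) at_top"
    unfolding Bfun_def at_bot_mirror eventually_filtermap by simp
  have all: "(\<forall>x. P x) \<longleftrightarrow> (\<forall>x. P (- x))" for P :: "real \<Rightarrow> bool" by (metis minus_minus)
  show ?thesis
    unfolding is_jost_minus_def is_jost_plus_def bf si int
    by (subst all) (simp add: algebra_simps)
qed

lemma jost_plus_explicit:
  assumes "integrable lebesgue V" and "Im (zsqrt z) > 0"
  shows "jost_plus V z = (\<lambda>x. exp (\<i> * zsqrt z * of_real x) * msum V (zsqrt z) x)"
  unfolding jost_plus_def jost_plus_eq[OF assms] by simp

lemma jost_minus_explicit: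
  assumes V: "integrable lebesgue V" and k: "Im (zsqrt z) > 0"
  shows "jost_minus V z = (\<lambda>x. exp (- \<i> * zsqrt z * of_real x) * msum (\<lambda>x. V (- x)) (zsqrt z) (- x))"
proof -
  have U: "integrable lebesgue (\<lambda>x. V (- x))" using V by (simp add: integrable_lebesgue_reflect)
  have "is_jost_minus V z f \<longleftrightarrow> f = (\<lambda>x. exp (- \<i> * zsqrt z * of_real x) * msum (\<lambda>x. V (- x)) (zsqrt z) (- x))" for f
    unfolding is_jost_minus_iff_reflect jost_plus_eq[OF U k] fun_eq_iff
  proof (intro iffI allI)
    fix x assume "\<forall>x. f (- x) = exp (\<i> * zsqrt z * of_real x) * msum (\<lambda>x. V (- x)) (zsqrt z) x"
    from spec[OF this, of "- x"] show "f x = exp (- \<i> * zsqrt z * of_real x) * msum (\<lambda>x. V (- x)) (zsqrt z) (- x)" by simp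
  qed simp
  then show ?thesis unfolding jost_minus_def by (intro the_equality) simp_all
qed

section \<open>Derivatives of the Jost solutions and the value of the Wronskian\<close>

lemma Psi_continuous:
  assumes k: "Im k > 0" and F: "integrable lebesgue F"
  shows "continuous_on UNIV (Psi k F)"
  unfolding continuous_on_eq_continuous_at[OF open_UNIV]
proof
  fix t0
  show "isCont (Psi k F) t0"
  proof (rule continuous_at_sequentiallyI)
    fix u assume u: "u \<longlonglongrightarrow> t0"
    have Fm [measurable]: "F \<in> borel_measurable lebesgue" using F by auto
    have k2: "Im (2 * k) > 0" using k by simp
    show "(\<lambda>n. Psi k F (u n)) \<longlonglongrightarrow> Psi k F t0"
      unfolding Psi_def
    proof (rule integral_dominated_convergence[where w="\<lambda>x. norm (F x)"])
      show "AE x in lebesgue. norm (half_exp (2 * k) (u n) x * F x) \<le> norm (F x)" for n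
        using norm_half_exp_le[OF k2] by (auto intro!: AE_I2 simp: norm_mult mult_left_le_one_le)
      \<comment> \<open>\<open>half_exp\<close> jumps where its arguments meet, which for the limit
        point concerns the single value \<open>x = t0\<close>.\<close>
      have "AE x in lebesgue. x \<notin> {t0}" by (rule AE_not_in) auto
      then show "AE x in lebesgue. (\<lambda>n. half_exp (2 * k) (u n) x * F x) \<longlonglongrightarrow> half_exp (2 * k) t0 x * F x"
      proof eventually_elim
        fix x assume "x \<notin> {t0}"
        then consider "t0 < x" | "x < t0" by fastforce
        then show "(\<lambda>n. half_exp (2 * k) (u n) x * F x) \<longlonglongrightarrow> half_exp (2 * k) t0 x * F x"
        proof cases
          case 1
          have "(\<lambda>n. exp (\<i> * (2 * k) * of_real (x - u n)) * F x) \<longlonglongrightarrow> exp (\<i> * (2 * k) * of_real (x - t0)) * F x"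
            by (intro tendsto_intros u)
          then have "(\<lambda>n. exp (\<i> * (2 * k) * of_real (x - u n)) * F x) \<longlonglongrightarrow> half_exp (2 * k) t0 x * F x"
            using 1 by (simp add: half_exp_def)
          moreover have "\<forall>\<^sub>F n in sequentially. exp (\<i> * (2 * k) * of_real (x - u n)) * F x = half_exp (2 * k) (u n) x * F x"
            using order_tendstoD(2)[OF u 1] by eventually_elim (simp add: half_exp_def)
          ultimately show ?thesis by (rule Lim_transform_eventually)
        next
          case 2
          have "\<forall>\<^sub>F n in sequentially. half_exp (2 * k) t0 x * F x = half_exp (2 * k) (u n) x * F x"
            using order_tendstoD(1)[OF u 2] by eventually_elim (use 2 in \<open>simp add: half_exp_def\<close>)
          then show ?thesis by (rule Lim_transform_eventually[OF tendsto_const])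
        qed
      qed
    qed (use F in auto)
  qed
qed

text \<open>The Wronskian uses \<open>vector_derivative\<close> at every point, so an almost
  everywhere derivative would not do; continuity of the density, from \<open>Psi_continuous\<close>,
  gives it everywhere.\<close>

lemma tail_has_vector_derivative:
  fixes f :: "real \<Rightarrow> complex"
  assumes f: "integrable lebesgue f" and cont: "continuous_on UNIV f"
  shows "(tail f has_vector_derivative - f x) (at x)"
proof -
  \<comment> \<open>A compact window with \<open>x\<close> in its interior: there the tail differs
    from a constant by an ordinary integral, and the derivative within the window is the full
    derivative.\<close>
  let ?a = "x - 1" and ?b = "x + 1"
  have si: "set_integrable lebesgue A f" if "A \<in> sets lebesgue" for A
    unfolding set_integrable_def by (rule integrable_mult_indicator[OF that f])
  have eq: "tail f u = tail f ?a - integral {?a..u} f" if "u \<in> {?a..?b}" for u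
  proof -
    have fm: "f \<in> borel_measurable lebesgue" using f by auto
    have "tail f ?a = (LINT y:{?a..}|lebesgue. f y)"
      unfolding tail_eq_closed[OF fm] by (simp add: integral_mult_if)
    also have "{?a..} = {?a..u} \<union> {u<..}" using that by auto
    also have "(LINT y:{?a..u} \<union> {u<..}|lebesgue. f y) = (LINT y:{?a..u}|lebesgue. f y) + (LINT y:{u<..}|lebesgue. f y)"
      by (rule set_integral_Un) (auto intro!: si)
    also have "(LINT y:{?a..u}|lebesgue. f y) = integral {?a..u} f"
      by (rule set_lebesgue_integral_eq_integral(2)) (auto intro!: si)
    finally show ?thesis by (simp add: tail_def)
  qed
  have "((\<lambda>u. integral {?a..u} f) has_vector_derivative f x) (at x within {?a..?b})"
    by (rule integral_has_vector_derivative) (use cont continuous_on_subset in auto)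
  then have "((\<lambda>u. tail f ?a - integral {?a..u} f) has_vector_derivative 0 - f x) (at x within {?a..?b})"
    by (intro has_vector_derivative_diff has_vector_derivative_const)
  then have "(tail f has_vector_derivative 0 - f x) (at x within {?a..?b})"
  proof (rule has_vector_derivative_transform[rotated 2])
    show "tail f u = tail f ?a - integral {?a..u} f" if "u \<in> {?a..?b}" for u by (rule eq[OF that])
  qed simp
  moreover have "at x within {?a..?b} = at x" by (rule at_within_interior) auto
  ultimately show ?thesis by simp
qed

lemma msum_has_vector_derivative:
  assumes V: "integrable lebesgue V" and k: "Im k > 0"
  shows "(msum V k has_vector_derivative - mphi V k x) (at x)"
proof -
  have "continuous_on UNIV (mphi V k)"
    unfolding mphi_def[OF V k] by (rule Psi_continuous[OF k V_msum_integrable[OF V k]])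
  then have "(tail (mphi V k) has_vector_derivative - mphi V k x) (at x)"
    by (rule tail_has_vector_derivative[OF mphi_integrable[OF V k]])
  then have "((\<lambda>x. 1 + tail (mphi V k) x) has_vector_derivative 0 + - mphi V k x) (at x)"
    by (intro has_vector_derivative_add has_vector_derivative_const)
  moreover have "(\<lambda>x. 1 + tail (mphi V k) x) = msum V k"
    by (rule ext) (rule msum_eq_tail[OF V k, symmetric])
  ultimately show ?thesis by simp
qed

lemma exp_has_vector_derivative:
  fixes c :: complex
  shows "((\<lambda>x. exp (c * of_real x)) has_vector_derivative c * exp (c * of_real x)) (at x)"
proof -
  have "((\<lambda>w. exp (c * w)) has_field_derivative c * exp (c * of_real x)) (at (of_real x))"
    by (auto intro!: derivative_eq_intros)
  from has_vector_derivative_real_field[OF this] show ?thesis by simp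
qed

lemma wronskian_jost:
  assumes V: "integrable lebesgue V" and k: "Im (zsqrt z) > 0"
  shows "wronskian (jost_minus V z) (jost_plus V z) x = 2 * \<i> * zsqrt z - (LINT s|lebesgue. V s * msum V (zsqrt z) s)"
proof -
  let ?k = "zsqrt z"
  define U where "U x = V (- x)" for x
  have U: "integrable lebesgue U" unfolding U_def using V by (simp add: integrable_lebesgue_reflect)
  have UV: "(\<lambda>x. U (- x)) = V" by (simp add: U_def)
  let ?e = "exp (\<i> * ?k * of_real x)" and ?e' = "exp (- \<i> * ?k * of_real x)"
  let ?m = "msum V ?k x" and ?p = "msum U ?k (- x)" and ?f = "mphi V ?k x" and ?g = "mphi U ?k (- x)"
  have dp: "vector_derivative (jost_plus V z) (at x) = ?e * - ?f + \<i> * ?k * ?e * ?m"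
    unfolding jost_plus_explicit[OF assms]
    by (intro vector_derivative_at has_vector_derivative_mult exp_has_vector_derivative msum_has_vector_derivative[OF V k])
  have "((msum U ?k \<circ> (\<lambda>x. - x)) has_vector_derivative (- 1) *\<^sub>R - mphi U ?k (- x)) (at x)"
    by (rule vector_diff_chain_at) (auto intro!: derivative_eq_intros msum_has_vector_derivative[OF U k])
  then have "((\<lambda>x. msum U ?k (- x)) has_vector_derivative ?g) (at x)" by (simp add: o_def)
  then have dm: "vector_derivative (jost_minus V z) (at x) = ?e' * ?g + - \<i> * ?k * ?e' * ?p"
    unfolding jost_minus_explicit[OF assms] U_def[symmetric]
    by (intro vector_derivative_at has_vector_derivative_mult exp_has_vector_derivative)
  have ee: "?e' * ?e = 1" by (simp add: mult_exp_exp)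
  have "wronskian (jost_minus V z) (jost_plus V z) x
      = (?e' * ?p) * (?e * - ?f + \<i> * ?k * ?e * ?m) - (?e' * ?g + - \<i> * ?k * ?e' * ?p) * (?e * ?m)"
    unfolding wronskian_def dp dm unfolding jost_plus_explicit[OF assms] jost_minus_explicit[OF assms] U_def[symmetric] ..
  also have "\<dots> = (?e' * ?e) * (2 * \<i> * ?k * ?p * ?m - ?p * ?f - ?g * ?m)" by (simp add: algebra_simps)
  also have "\<dots> = 2 * \<i> * ?k * ?m * ?p - ?m * ?g - ?f * ?p" unfolding ee by (simp add: algebra_simps)
  \<comment> \<open>\<open>wronskian_constant\<close> is applied to the reflected potential at
    \<open>- x\<close>, so that the integral on its right-hand side contains \<open>V\<close> and
    its own \<open>msum\<close>, the one occurring in the determinant.\<close>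
  also have "\<dots> = 2 * \<i> * ?k - (LINT s|lebesgue. V s * msum V ?k s)"
    using wronskian_constant[OF U k, of "- x"] unfolding UV by (simp add: U_def)
  finally show ?thesis .
qed

theorem theorem4p6:
  fixes V :: "real \<Rightarrow> complex" and z :: complex
  assumes "integrable lebesgue V"
    and "Im (zsqrt z) > 0"
  shows "trace_class (K_op V z) \<and>
    fredholm_det (\<lambda>f x. f x - K_op V z f x) = jost_function V z"
proof (rule conjI)
  note V = assms(1) and k = assms(2)
  let ?k = "zsqrt z" and ?I = "LINT s|lebesgue. V s * msum V (zsqrt z) s"
  have k0: "?k \<noteq> 0" using k by auto
  show "trace_class (K_op V z)" by (rule trace_class_K_op[OF assms])
  \<comment> \<open>\<open>fredholm_det\<close> takes the whole operator and subtracts the identity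
    again, which leaves \<open>- K\<close>.\<close>
  have D: "(\<lambda>f x. (f x - K_op V z f x) - f x) = (\<lambda>f x. - K_op V z f x)" by simp
  have "(\<lambda>n. LINT t|lebesgue. 1 * (V t * mser V ?k n t)) sums (LINT t|lebesgue. 1 * (V t * msum V ?k t))"
    by (rule msum_integral_sums[OF V k, of "\<lambda>_. 1" 1]) auto
  then have "(\<lambda>n. \<i> / (2 * ?k) * (LINT t|lebesgue. V t * mser V ?k n t)) sums (\<i> / (2 * ?k) * ?I)"
    by (intro sums_mult) simp
  then have "(\<lambda>n. trace_ext (Suc n) (\<lambda>f x. - K_op V z f x)) sums (\<i> / (2 * ?k) * ?I)"
    unfolding trace_ext_K_op_series(2)[OF assms] integral_Psi[OF k V_mser_integrable[OF V k]] .
  then have "(\<lambda>n. trace_ext n (\<lambda>f x. - K_op V z f x)) sums (\<i> / (2 * ?k) * ?I + trace_ext 0 (\<lambda>f x. - K_op V z f x))"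
    by (rule sums_Suc_iff[THEN iffD1])
  then have "fredholm_det (\<lambda>f x. f x - K_op V z f x) = \<i> / (2 * ?k) * ?I + 1"
    unfolding fredholm_det_def D trace_ext_K_op_series(1)[OF assms] by (rule sums_unique[symmetric])
  \<comment> \<open>The factor \<open>i / (2 k)\<close> from Green's function is
    \<open>- 1 / (2 i k)\<close>, the sign and normalization that the Jost function
    requires.\<close>
  also have "\<dots> = (2 * \<i> * ?k - ?I) / (2 * \<i> * ?k)" using k0 by (simp add: field_simps)
  also have "\<dots> = jost_function V z"
    unfolding jost_function_def wronskian_jost[OF assms] by simp
  finally show "fredholm_det (\<lambda>f x. f x - K_op V z f x) = jost_function V z" .
qed

end
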